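(* Let $\bar{u}$ be a solution of the optimal control problem $$\min_{(y,u)\in H_0^1(\Omega)\times L^2(\Omega)} J(y,u)=\tfrac12\|y-y_d\|_{L^2(\Omega)}^2+\tfrac{\alpha}{2}\|u\|_{L^2(\Omega)}^2\quad\text{s.t.}\quad \mathcal{A}y=u+f \text{ in }\Omega,\; y=0 \text{ on }\Gamma,\; \nabla y\in\mathcal{K},\; u\in\mathcal{W}.$$ Then there exist a real number $\bar{\lambda}\geq 0$ and elements $\bar{y}\in H^1_0(\Omega)$, $\bar{p}\in H^1_0(\Omega)$ and $\bar{\mu}\in L^2(\Omega)^n$ satisfying (i) $\bar{\lambda}+\|\bar{\mu}\|_{L^2(\Omega)^n}>0$; (ii) $\langle \mathcal{A}\bar{y},z\rangle=\langle\bar{u},z\rangle+\langle f,z\rangle$ for all $z\in H_0^1(\Omega)$; (iii) $\langle\bar{p},\mathcal{A}z\rangle=\bar{\lambda}\langle\bar{y}-y_d,z\rangle+\langle\bar{\mu},\nabla z\rangle$ for all $z\in H_0^1(\Omega)$; (iv) $\langle\bar{\mu},z-\nabla\bar{y}\rangle\leq 0$ for all $z\in\mathcal{K}$; (v) $\int_\Omega(\bar{p}+\bar{\lambda}\alpha\bar{u})(u-\bar{u})\,dx\geq 0$ for all $u\in\mathcal{W}$. Moreover, if the Slater condition holds, i.e. there exists $u_0\in\mathcal{W}$ such that $\nabla\bar{y}+\nabla z_0\in\mathcal{K}^{\circ}$ (interior of $\mathcal{K}$), where $z_0$ solves $\mathcal{A}z_0=u_0-\bar{u}$ in $\Omega$,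 $z_0=0$ on $\Gamma$, then the system (i)–(v) is satisfied with $\bar{\lambda}=1$.
   Context: $\Omega\subseteq\mathbb{R}^n$ ($n=2,3$) is a convex, open, bounded domain with $C^{1,1}$ or polygonal boundary $\Gamma$; $y_d,f\in L^2(\Omega)$ are given; $a,b\in\mathbb{R}$ and $\alpha>0$ are given; $\mathcal{K}=\{\mathbf{z}\in L^2(\Omega)^n : \int_\Omega|\mathbf{z}(x)|^2dx\leq\delta\}$ is a closed convex subset of $L^2(\Omega)^n$ with nonempty interior; $\mathcal{W}=\{v\in L^\infty(\Omega): a\leq v\leq b \text{ a.e. in }\Omega\}$ is a nonempty closed convex subset of $L^2(\Omega)$. $\mathcal{A}y=-\sum_{i,j=1}^n\partial_{x_j}(a_{ij}y_{x_i})+c_0y$ with $a_{ij},c_0\in L^\infty(\Omega)$, $c_0\geq0$, $a_{ij}=a_{ji}$, and $\sum_{i,j}a_{ij}(x)\xi_i\xi_j\geq\theta|\xi|^2$ for some $\theta>0$. $\langle\cdot,\cdot\rangle$ denotes the $L^2$ inner product (or duality pairing). For each $u\in L^2(\Omega)$ the state equation has a unique weak solution $y_u\in H_0^1(\Omega)$, and the map $u\mapsto y_u$ is $C^1$ from $L^2(\Omega)$ to $H_0^1(\Omega)$. *)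

theory Defs
  imports "HOL-Analysis.Analysis"
begin

text \<open>Functions on a domain Omega of real^'n are represented by total functions;
 all notions are taken with respect to Lebesgue measure restricted to Omega.\<close>

definition L2 :: "('a::euclidean_space) set \<Rightarrow> ('a \<Rightarrow> 'b::euclidean_space) \<Rightarrow> bool" where
  "L2 \<Omega> g \<longleftrightarrow> g \<in> borel_measurable (lebesgue_on \<Omega>) \<and>
      integrable (lebesgue_on \<Omega>) (\<lambda>x. (norm (g x))^2)"

definition L2norm :: "('a::euclidean_space) set \<Rightarrow> ('a \<Rightarrow> 'b::euclidean_space) \<Rightarrow> real" where
  "L2norm \<Omega> g = sqrt (integral\<^sup>L (lebesgue_on \<Omega>) (\<lambda>x. (norm (g x))^2))"

definition L2inner :: "('a::euclidean_space) set \<Rightarrow> ('a \<Rightarrow> 'b::euclidean_space) \<Rightarrow> ('a \<Rightarrow> 'b) \<Rightarrow> real" where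
  "L2inner \<Omega> g h = integral\<^sup>L (lebesgue_on \<Omega>) (\<lambda>x. g x \<bullet> h x)"

definition Linf :: "('a::euclidean_space) set \<Rightarrow> ('a \<Rightarrow> real) \<Rightarrow> bool" where
  "Linf \<Omega> g \<longleftrightarrow> g \<in> borel_measurable (lebesgue_on \<Omega>) \<and>
      (\<exists>C. AE x in lebesgue_on \<Omega>. \<bar>g x\<bar> \<le> C)"

definition partial :: "'n::finite \<Rightarrow> (real^'n \<Rightarrow> real) \<Rightarrow> real^'n \<Rightarrow> real" where
  "partial i \<phi> x = frechet_derivative \<phi> (at x) (axis i 1)"

fun iter_partial :: "'n::finite list \<Rightarrow> (real^'n \<Rightarrow> real) \<Rightarrow> real^'n \<Rightarrow> real" where
  "iter_partial [] \<phi> = \<phi>"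
| "iter_partial (i # is) \<phi> = partial i (iter_partial is \<phi>)"

definition smooth :: "(real^'n::finite \<Rightarrow> real) \<Rightarrow> bool" where
  "smooth \<phi> \<longleftrightarrow> (\<forall>is x. iter_partial is \<phi> differentiable (at x))"

definition test_fun :: "(real^'n::finite) set \<Rightarrow> (real^'n \<Rightarrow> real) \<Rightarrow> bool" where
  "test_fun \<Omega> \<phi> \<longleftrightarrow> smooth \<phi> \<and> compact (closure {x. \<phi> x \<noteq> 0}) \<and>
      closure {x. \<phi> x \<noteq> 0} \<subseteq> \<Omega>"

definition is_weak_grad :: "(real^'n::finite) set \<Rightarrow> (real^'n \<Rightarrow> real) \<Rightarrow> (real^'n \<Rightarrow> real^'n) \<Rightarrow> bool" where
  "is_weak_grad \<Omega> y g \<longleftrightarrow>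
     (\<forall>i. set_integrable lebesgue \<Omega> (\<lambda>x. g x $ i)) \<and>
     (\<forall>K. compact K \<and> K \<subseteq> \<Omega> \<longrightarrow> set_integrable lebesgue K y) \<and>
     (\<forall>\<phi> i. test_fun \<Omega> \<phi> \<longrightarrow>
        integral\<^sup>L (lebesgue_on \<Omega>) (\<lambda>x. y x * partial i \<phi> x) =
        - integral\<^sup>L (lebesgue_on \<Omega>) (\<lambda>x. g x $ i * \<phi> x))"

definition weak_grad :: "(real^'n::finite) set \<Rightarrow> (real^'n \<Rightarrow> real) \<Rightarrow> real^'n \<Rightarrow> real^'n" where
  "weak_grad \<Omega> y = (SOME g. is_weak_grad \<Omega> y g)"

definition H1 :: "(real^'n::finite) set \<Rightarrow> (real^'n \<Rightarrow> real) \<Rightarrow> bool" where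
  "H1 \<Omega> y \<longleftrightarrow> L2 \<Omega> y \<and> (\<exists>g. is_weak_grad \<Omega> y g) \<and> L2 \<Omega> (weak_grad \<Omega> y)"

definition H01 :: "(real^'n::finite) set \<Rightarrow> (real^'n \<Rightarrow> real) \<Rightarrow> bool" where
  "H01 \<Omega> y \<longleftrightarrow> H1 \<Omega> y \<and>
     (\<exists>\<phi>. (\<forall>k. test_fun \<Omega> (\<phi> k)) \<and>
        (\<lambda>k. (L2norm \<Omega> (\<lambda>x. \<phi> k x - y x))^2 +
             (L2norm \<Omega> (\<lambda>x. weak_grad \<Omega> (\<phi> k) x - weak_grad \<Omega> y x))^2)
        \<longlonglongrightarrow> 0)"

text \<open>Duality pairing \<langle>A y, z\<rangle> for y, z in H_0^1, where
  A y = - sum_ij d_j (a_ij d_i y) + c0 y.\<close>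
definition Apair :: "(real^'n::finite) set \<Rightarrow> ('n \<Rightarrow> 'n \<Rightarrow> real^'n \<Rightarrow> real) \<Rightarrow> (real^'n \<Rightarrow> real)
    \<Rightarrow> (real^'n \<Rightarrow> real) \<Rightarrow> (real^'n \<Rightarrow> real) \<Rightarrow> real" where
  "Apair \<Omega> a c0 y z = integral\<^sup>L (lebesgue_on \<Omega>)
     (\<lambda>x. (\<Sum>i\<in>UNIV. \<Sum>j\<in>UNIV. a i j x * (weak_grad \<Omega> y x $ i) * (weak_grad \<Omega> z x $ j))
          + c0 x * y x * z x)"

definition weak_sol :: "(real^'n::finite) set \<Rightarrow> ('n \<Rightarrow> 'n \<Rightarrow> real^'n \<Rightarrow> real) \<Rightarrow> (real^'n \<Rightarrow> real)
    \<Rightarrow> (real^'n \<Rightarrow> real) \<Rightarrow> (real^'n \<Rightarrow> real) \<Rightarrow> bool" where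
  "weak_sol \<Omega> a c0 g y \<longleftrightarrow> H01 \<Omega> y \<and>
     (\<forall>z. H01 \<Omega> z \<longrightarrow> Apair \<Omega> a c0 y z = L2inner \<Omega> g z)"

definition Kset :: "(real^'n::finite) set \<Rightarrow> real \<Rightarrow> (real^'n \<Rightarrow> real^'n) set" where
  "Kset \<Omega> \<delta> = {z. L2 \<Omega> z \<and> integral\<^sup>L (lebesgue_on \<Omega>) (\<lambda>x. (norm (z x))^2) \<le> \<delta>}"

definition Wset :: "(real^'n::finite) set \<Rightarrow> real \<Rightarrow> real \<Rightarrow> (real^'n \<Rightarrow> real) set" where
  "Wset \<Omega> a b = {v. Linf \<Omega> v \<and> (AE x in lebesgue_on \<Omega>. a \<le> v x \<and> v x \<le> b)}"

definition L2_interior :: "(real^'n::finite) set \<Rightarrow> (real^'n \<Rightarrow> real^'n) set \<Rightarrow> (real^'n \<Rightarrow> real^'n) set" where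
  "L2_interior \<Omega> S = {v \<in> S. \<exists>e>0. \<forall>w. L2 \<Omega> w \<and> L2norm \<Omega> (\<lambda>x. w x - v x) < e \<longrightarrow> w \<in> S}"

definition Jcost :: "(real^'n::finite) set \<Rightarrow> (real^'n \<Rightarrow> real) \<Rightarrow> real \<Rightarrow> (real^'n \<Rightarrow> real) \<Rightarrow> (real^'n \<Rightarrow> real) \<Rightarrow> real" where
  "Jcost \<Omega> yd \<alpha> y u = (1/2) * (L2norm \<Omega> (\<lambda>x. y x - yd x))^2 + (\<alpha>/2) * (L2norm \<Omega> u)^2"

text \<open>C^{1,1} boundary: near each boundary point, Omega is locally the region below the
 graph of a C^1 function with Lipschitz gradient over the tangent hyperplane.\<close>
definition C11_boundary :: "(real^'n::finite) set \<Rightarrow> bool" where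
  "C11_boundary \<Omega> \<longleftrightarrow> (\<forall>x0\<in>frontier \<Omega>. \<exists>r>0. \<exists>\<nu>. \<exists>h :: real^'n \<Rightarrow> real.
      norm \<nu> = 1 \<and> (\<forall>x. h x = h (x - (x \<bullet> \<nu>) *\<^sub>R \<nu>)) \<and>
      (\<forall>x. h differentiable (at x)) \<and>
      (\<exists>L. \<forall>x y. onorm (\<lambda>v. frechet_derivative h (at x) v - frechet_derivative h (at y) v)
                 \<le> L * norm (x - y)) \<and>
      \<Omega> \<inter> ball x0 r = {x \<in> ball x0 r. (x - x0) \<bullet> \<nu> < h (x - x0)})"

definition polygonal_boundary :: "(real^'n::finite) set \<Rightarrow> bool" where
  "polygonal_boundary \<Omega> \<longleftrightarrow> polytope (closure \<Omega>)"

end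

theory Submission
  imports Defs
begin

text \<open>
  The state constraint is the scalar inequality \<open>\<parallel>\<nabla>y\<parallel>\<^sup>2 \<le> \<delta>\<close>, so the multiplier can be sought in the form
  \<open>\<mu> = \<nu> \<nabla>ybar\<close> with a number \<open>\<nu> \<ge> 0\<close>. For \<open>u\<close> admissible and \<open>z\<close> solving \<open>A z = u - ubar\<close>, the slopes of the
  cost and of \<open>\<parallel>\<nabla>y\<parallel>\<^sup>2 / 2\<close> in the direction \<open>(u, z)\<close> cannot both be negative when the constraint is active
  (the first cannot be negative when it is inactive). The pairs of slopes form a convex subset of the
  plane, and separating it from the open negative quadrant gives \<open>(\<lambda>, \<nu>)\<close>. A Slater point has negative
  constraint slope, which forces \<open>\<lambda> > 0\<close>. Solving the adjoint equation with right-hand side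
  \<open>(\<lambda> (ybar - yd), \<mu>)\<close> turns the multiplier inequality into the variational inequality for the adjoint state.

  Weak solutions are obtained by minimising the energy over test functions; the Poincare inequality makes
  minimising sequences Cauchy in mean square together with their gradients, and the mean square limit
  is the jet \<open>(y, \<nabla>y)\<close> of a function in \<open>H\<^sub>0\<^sup>1\<close>.
\<close>

subsection \<open>The space of square integrable functions\<close>

text \<open>\<open>weak_grad\<close> is a Hilbert choice, so even its additivity can hold only
  almost everywhere, and only once weak gradients are known to be unique up to null sets. This
  uniqueness is the fundamental lemma of the calculus of variations, which the explicit bump
  functions serve to prove. To keep chosen gradients out of limit arguments, limits are taken of
  pairs (test function, classical gradient); a chosen gradient is compared with the limit only at
  the very end. Right-hand sides are pairs as well: a functional acting on function and gradient
  together covers both the state equation and the adjoint equation, whose datum \<open>\<mu>\<close>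
  enters through gradients.

  One number suffices as multiplier because \<open>Kset\<close> is a ball of radius
  \<open>sqrt \<delta>\<close>: its normal cone at a point of the sphere is the ray through that
  point, and it is zero inside. Since \<open>\<delta> > 0\<close>, an active gradient is nonzero, so
  a positive \<open>\<nu>\<close> gives a nonzero field \<open>\<mu>\<close>. The state equation is
  affine and cost and constraint are quadratic, so the expansions along a direction are exact
  polynomials of degree two in the step.\<close>

lemma L2_measurable: "L2 \<Omega> f \<Longrightarrow> f \<in> borel_measurable (lebesgue_on \<Omega>)"
  by (simp add: L2_def)

lemma L2_norm_square_integrable: "L2 \<Omega> f \<Longrightarrow> integrable (lebesgue_on \<Omega>) (\<lambda>x. (norm (f x))\<^sup>2)"
  by (simp add: L2_def)

lemma L2_dominated:
  assumes "L2 \<Omega> f" "g \<in> borel_measurable (lebesgue_on \<Omega>)"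
    and "AE x in lebesgue_on \<Omega>. norm (g x) \<le> C * norm (f x)"
  shows "L2 \<Omega> g"
  unfolding L2_def
proof
  have [measurable]: "g \<in> borel_measurable (lebesgue_on \<Omega>)" by fact
  show "integrable (lebesgue_on \<Omega>) (\<lambda>x. (norm (g x))\<^sup>2)"
  proof (rule Bochner_Integration.integrable_bound)
    show "integrable (lebesgue_on \<Omega>) (\<lambda>x. C\<^sup>2 * (norm (f x))\<^sup>2)"
      using L2_norm_square_integrable[OF assms(1)] by simp
    show "AE x in lebesgue_on \<Omega>. norm ((norm (g x))\<^sup>2) \<le> norm (C\<^sup>2 * (norm (f x))\<^sup>2)"
      using assms(3)
    proof eventually_elim
      case (elim x)
      have "(norm (g x))\<^sup>2 \<le> (C * norm (f x))\<^sup>2" using elim by (intro power_mono) auto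
      then show ?case by (simp add: power_mult_distrib)
    qed
  qed simp
qed (rule assms)

lemma L2_zero [simp]: "L2 \<Omega> (\<lambda>x. 0)"
  by (simp add: L2_def)

lemma L2_add:
  assumes "L2 \<Omega> f" "L2 \<Omega> g"
  shows "L2 \<Omega> (\<lambda>x. f x + g x)"
  unfolding L2_def
proof
  have [measurable]: "f \<in> borel_measurable (lebesgue_on \<Omega>)" "g \<in> borel_measurable (lebesgue_on \<Omega>)"
    using assms by (auto simp: L2_def)
  show "(\<lambda>x. f x + g x) \<in> borel_measurable (lebesgue_on \<Omega>)" by measurable
  show "integrable (lebesgue_on \<Omega>) (\<lambda>x. (norm (f x + g x))\<^sup>2)"
  proof (rule Bochner_Integration.integrable_bound)
    show "integrable (lebesgue_on \<Omega>) (\<lambda>x. 2 * (norm (f x))\<^sup>2 + 2 * (norm (g x))\<^sup>2)"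
      using assms by (auto simp: L2_def)
    show "AE x in lebesgue_on \<Omega>. norm ((norm (f x + g x))\<^sup>2)
        \<le> norm (2 * (norm (f x))\<^sup>2 + 2 * (norm (g x))\<^sup>2)"
    proof (rule AE_I2)
      fix x
      have "(norm (f x + g x))\<^sup>2 \<le> (norm (f x) + norm (g x))\<^sup>2"
        by (intro power_mono norm_triangle_ineq) auto
      also have "\<dots> \<le> 2 * (norm (f x))\<^sup>2 + 2 * (norm (g x))\<^sup>2"
        using sum_squares_bound[of "norm (f x)" "norm (g x)"] by (simp add: power2_sum)
      finally show "norm ((norm (f x + g x))\<^sup>2) \<le> norm (2 * (norm (f x))\<^sup>2 + 2 * (norm (g x))\<^sup>2)"
        by simp
    qed
  qed simp
qed

lemma L2_scaleR: "L2 \<Omega> f \<Longrightarrow> L2 \<Omega> (\<lambda>x. c *\<^sub>R f x)"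
  by (rule L2_dominated[where C = "\<bar>c\<bar>"]) (auto dest: L2_measurable)

lemma L2_mult: "L2 \<Omega> f \<Longrightarrow> L2 \<Omega> (\<lambda>x. c * f x :: real)"
  using L2_scaleR[of \<Omega> f c] by simp

lemma L2_diff:
  assumes "L2 \<Omega> f" "L2 \<Omega> g"
  shows "L2 \<Omega> (\<lambda>x. f x - g x)"
  using L2_add[OF assms(1) L2_scaleR[OF assms(2), of "-1"]] by simp

lemma L2_inner_integrable:
  assumes "L2 \<Omega> f" "L2 \<Omega> g"
  shows "integrable (lebesgue_on \<Omega>) (\<lambda>x. f x \<bullet> g x)"
proof (rule Bochner_Integration.integrable_bound)
  have [measurable]: "f \<in> borel_measurable (lebesgue_on \<Omega>)" "g \<in> borel_measurable (lebesgue_on \<Omega>)"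
    using assms by (auto simp: L2_def)
  show "(\<lambda>x. f x \<bullet> g x) \<in> borel_measurable (lebesgue_on \<Omega>)" by measurable
  show "integrable (lebesgue_on \<Omega>) (\<lambda>x. (norm (f x))\<^sup>2 + (norm (g x))\<^sup>2)"
    using assms by (auto simp: L2_def)
  show "AE x in lebesgue_on \<Omega>. norm (f x \<bullet> g x) \<le> norm ((norm (f x))\<^sup>2 + (norm (g x))\<^sup>2)"
  proof (rule AE_I2)
    fix x
    have "\<bar>f x \<bullet> g x\<bar> \<le> norm (f x) * norm (g x)" by (rule Cauchy_Schwarz_ineq2)
    also have "2 * \<dots> \<le> (norm (f x))\<^sup>2 + (norm (g x))\<^sup>2"
      using sum_squares_bound[of "norm (f x)" "norm (g x)"] by simp
    finally show "norm (f x \<bullet> g x) \<le> norm ((norm (f x))\<^sup>2 + (norm (g x))\<^sup>2)"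
      using mult_nonneg_nonneg[of "norm (f x)" "norm (g x)"] by simp
  qed
qed

lemma L2inner_commute: "L2inner \<Omega> f g = L2inner \<Omega> g f"
  by (simp add: L2inner_def inner_commute)

lemma L2inner_add_left:
  "L2 \<Omega> f \<Longrightarrow> L2 \<Omega> g \<Longrightarrow> L2 \<Omega> h \<Longrightarrow> L2inner \<Omega> (\<lambda>x. f x + g x) h = L2inner \<Omega> f h + L2inner \<Omega> g h"
  by (simp add: L2inner_def inner_add_left L2_inner_integrable)

lemma L2inner_diff_left:
  "L2 \<Omega> f \<Longrightarrow> L2 \<Omega> g \<Longrightarrow> L2 \<Omega> h \<Longrightarrow> L2inner \<Omega> (\<lambda>x. f x - g x) h = L2inner \<Omega> f h - L2inner \<Omega> g h"
  by (simp add: L2inner_def inner_diff_left L2_inner_integrable)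

lemma L2inner_scaleR_left: "L2inner \<Omega> (\<lambda>x. c *\<^sub>R f x) h = c * L2inner \<Omega> f h"
  by (simp add: L2inner_def)

lemma L2inner_mult_left: "L2inner \<Omega> (\<lambda>x. c * f x :: real) h = c * L2inner \<Omega> f h"
  using L2inner_scaleR_left[of \<Omega> c f h] by simp

lemma L2inner_add_right:
  "L2 \<Omega> f \<Longrightarrow> L2 \<Omega> g \<Longrightarrow> L2 \<Omega> h \<Longrightarrow> L2inner \<Omega> h (\<lambda>x. f x + g x) = L2inner \<Omega> h f + L2inner \<Omega> h g"
  by (simp add: L2inner_def inner_add_right L2_inner_integrable)

lemma L2inner_diff_right:
  "L2 \<Omega> f \<Longrightarrow> L2 \<Omega> g \<Longrightarrow> L2 \<Omega> h \<Longrightarrow> L2inner \<Omega> h (\<lambda>x. f x - g x) = L2inner \<Omega> h f - L2inner \<Omega> h g"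
  by (simp add: L2inner_def inner_diff_right L2_inner_integrable)

lemma L2inner_scaleR_right: "L2inner \<Omega> h (\<lambda>x. c *\<^sub>R f x) = c * L2inner \<Omega> h f"
  by (simp add: L2inner_def)

lemma L2inner_mult_right: "L2inner \<Omega> h (\<lambda>x. c * f x :: real) = c * L2inner \<Omega> h f"
  using L2inner_scaleR_right[of \<Omega> h c f] by simp

lemma L2inner_cong_AE:
  assumes "L2 \<Omega> f" "L2 \<Omega> f'" "L2 \<Omega> g" "L2 \<Omega> g'"
    and "AE x in lebesgue_on \<Omega>. f x = f' x" "AE x in lebesgue_on \<Omega>. g x = g' x"
  shows "L2inner \<Omega> f g = L2inner \<Omega> f' g'"
  unfolding L2inner_def
proof (rule integral_cong_AE)
  show "AE x in lebesgue_on \<Omega>. f x \<bullet> g x = f' x \<bullet> g' x"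
    using assms(5,6) by eventually_elim auto
qed (use assms in \<open>auto intro!: borel_measurable_integrable L2_inner_integrable\<close>)

lemma L2norm_square: "(L2norm \<Omega> f)\<^sup>2 = L2inner \<Omega> f f"
  by (simp add: L2norm_def L2inner_def power2_norm_eq_inner)

lemma L2norm_nonneg [simp]: "0 \<le> L2norm \<Omega> f"
  by (simp add: L2norm_def)

lemma L2norm_scaleR: "L2norm \<Omega> (\<lambda>x. c *\<^sub>R f x) = \<bar>c\<bar> * L2norm \<Omega> f"
  by (simp add: L2norm_def power_mult_distrib real_sqrt_mult)

lemma L2norm_cong_AE:
  assumes "L2 \<Omega> f" "L2 \<Omega> f'" "AE x in lebesgue_on \<Omega>. f x = f' x"
  shows "L2norm \<Omega> f = L2norm \<Omega> f'"
  using L2inner_cong_AE[OF assms(1,2,1,2,3,3)]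
  by (metis L2norm_square L2norm_nonneg power2_eq_iff_nonneg)

lemma L2inner_square_add:
  assumes "L2 \<Omega> f" "L2 \<Omega> g"
  shows "L2inner \<Omega> (\<lambda>x. f x + c *\<^sub>R g x) (\<lambda>x. f x + c *\<^sub>R g x)
     = L2inner \<Omega> f f + 2 * c * L2inner \<Omega> f g + c\<^sup>2 * L2inner \<Omega> g g"
  using assms
  by (simp add: L2inner_add_left L2inner_add_right L2_add L2_scaleR L2inner_scaleR_left
      L2inner_scaleR_right L2inner_commute[of \<Omega> g f] power2_eq_square algebra_simps)

text \<open>The case \<open>r = 0\<close> is included so that the criterion applies to semidefinite
  forms. It yields Cauchy-Schwarz here and later bounds the residual of a minimising
  sequence.\<close>

lemma psd_quadratic_discriminant:
  fixes p q r :: real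
  assumes "\<And>t. 0 \<le> p + 2 * t * q + t\<^sup>2 * r" "0 \<le> r"
  shows "q\<^sup>2 \<le> p * r"
proof (cases "r = 0")
  case True
  have "q = 0"
  proof (rule ccontr)
    assume "q \<noteq> 0"
    \<comment> \<open>With \<open>r = 0\<close> the expression is affine in \<open>t\<close>; this
      \<open>t\<close> gives it the value \<open>-1\<close>.\<close>
    then show False using assms(1)[of "- (p + 1) / (2 * q)"] True by (simp add: field_simps)
  qed
  then show ?thesis using True by simp
next
  case False
  then have "r > 0" using assms(2) by simp
  then show ?thesis using assms(1)[of "- q / r"] by (simp add: field_simps power2_eq_square)
qed

lemma L2_Cauchy_Schwarz:
  assumes "L2 \<Omega> f" "L2 \<Omega> g"
  shows "\<bar>L2inner \<Omega> f g\<bar> \<le> L2norm \<Omega> f * L2norm \<Omega> g"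
proof -
  have "(L2inner \<Omega> f g)\<^sup>2 \<le> L2inner \<Omega> f f * L2inner \<Omega> g g"
  proof (rule psd_quadratic_discriminant)
    fix t
    have "0 \<le> L2inner \<Omega> (\<lambda>x. f x + t *\<^sub>R g x) (\<lambda>x. f x + t *\<^sub>R g x)"
      by (metis L2norm_square zero_le_power2)
    then show "0 \<le> L2inner \<Omega> f f + 2 * t * L2inner \<Omega> f g + t\<^sup>2 * L2inner \<Omega> g g"
      using L2inner_square_add[OF assms, of t] by simp
  qed (metis L2norm_square zero_le_power2)
  then have "\<bar>L2inner \<Omega> f g\<bar>\<^sup>2 \<le> (L2norm \<Omega> f * L2norm \<Omega> g)\<^sup>2"
    by (simp add: L2norm_square power_mult_distrib)
  then show ?thesis by (rule power2_le_imp_le) simp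
qed

lemma L2norm_triangle:
  assumes "L2 \<Omega> f" "L2 \<Omega> g"
  shows "L2norm \<Omega> (\<lambda>x. f x + g x) \<le> L2norm \<Omega> f + L2norm \<Omega> g"
proof (rule power2_le_imp_le)
  have "(L2norm \<Omega> (\<lambda>x. f x + g x))\<^sup>2
      = (L2norm \<Omega> f)\<^sup>2 + 2 * L2inner \<Omega> f g + (L2norm \<Omega> g)\<^sup>2"
    using L2inner_square_add[OF assms, of 1] by (simp add: L2norm_square)
  also have "\<dots> \<le> (L2norm \<Omega> f + L2norm \<Omega> g)\<^sup>2"
    using L2_Cauchy_Schwarz[OF assms] by (simp add: power2_sum)
  finally show "(L2norm \<Omega> (\<lambda>x. f x + g x))\<^sup>2 \<le> (L2norm \<Omega> f + L2norm \<Omega> g)\<^sup>2" .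
qed simp

lemma L2inner_tendsto:
  assumes "\<And>k. L2 \<Omega> (f k)" "L2 \<Omega> g" "L2 \<Omega> h"
    and lim: "(\<lambda>k. L2norm \<Omega> (\<lambda>x. f k x - g x)) \<longlonglongrightarrow> 0"
  shows "(\<lambda>k. L2inner \<Omega> h (f k)) \<longlonglongrightarrow> L2inner \<Omega> h g"
proof (rule LIM_zero_cancel, rule Lim_null_comparison)
  show "\<forall>\<^sub>F k in sequentially. norm (L2inner \<Omega> h (f k) - L2inner \<Omega> h g)
      \<le> L2norm \<Omega> h * L2norm \<Omega> (\<lambda>x. f k x - g x)"
  proof (rule always_eventually, rule allI)
    fix k
    have "\<bar>L2inner \<Omega> h (\<lambda>x. f k x - g x)\<bar> \<le> L2norm \<Omega> h * L2norm \<Omega> (\<lambda>x. f k x - g x)"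
      using assms by (intro L2_Cauchy_Schwarz L2_diff) auto
    then show "norm (L2inner \<Omega> h (f k) - L2inner \<Omega> h g)
        \<le> L2norm \<Omega> h * L2norm \<Omega> (\<lambda>x. f k x - g x)"
      using assms by (simp add: L2inner_diff_right)
  qed
  show "(\<lambda>k. L2norm \<Omega> h * L2norm \<Omega> (\<lambda>x. f k x - g x)) \<longlonglongrightarrow> 0"
    using tendsto_mult_right_zero[OF lim] by simp
qed

section \<open>Completeness of the square integrable functions on a set of finite measure\<close>

lemma L2_L1_bound:
  assumes "\<Omega> \<in> lmeasurable" "L2 \<Omega> f"
  shows "integrable (lebesgue_on \<Omega>) f"
    and "integral\<^sup>L (lebesgue_on \<Omega>) (\<lambda>x. norm (f x)) \<le> L2norm \<Omega> f * sqrt (measure lebesgue \<Omega>)"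
proof -
  interpret finite_measure "lebesgue_on \<Omega>"
    using assms(1) by (rule finite_measure_lebesgue_on)
  have [measurable]: "f \<in> borel_measurable (lebesgue_on \<Omega>)"
    using assms by (auto simp: L2_def)
  have one: "L2 \<Omega> (\<lambda>x. 1 :: real)" by (simp add: L2_def)
  have nf: "L2 \<Omega> (\<lambda>x. norm (f x))"
    by (rule L2_dominated[OF assms(2), of _ 1]) auto
  show "integrable (lebesgue_on \<Omega>) f"
    using L2_inner_integrable[OF nf one] by (simp add: integrable_norm_iff)
  have "L2norm \<Omega> (\<lambda>x. 1 :: real) = sqrt (measure lebesgue \<Omega>)"
    using assms(1) by (simp add: L2norm_def measure_restrict_space)
  then show "integral\<^sup>L (lebesgue_on \<Omega>) (\<lambda>x. norm (f x)) \<le> L2norm \<Omega> f * sqrt (measure lebesgue \<Omega>)"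
    using L2_Cauchy_Schwarz[OF nf one] by (simp add: L2inner_def L2norm_def)
qed

text \<open>Monotone convergence lets sum and integral be exchanged, so the series of norms has a
  finite integral and is therefore finite almost everywhere.\<close>

lemma summable_L1_norms_AE:
  fixes d :: "nat \<Rightarrow> 'a \<Rightarrow> 'b::{banach, second_countable_topology}"
  assumes "\<And>k. integrable M (d k)" "summable (\<lambda>k. \<integral>x. norm (d k x) \<partial>M)"
  shows "AE x in M. summable (\<lambda>k. norm (d k x))"
proof -
  have [measurable]: "d k \<in> borel_measurable M" for k using assms(1)[of k] by auto
  have "(\<integral>\<^sup>+x. (\<Sum>k. ennreal (norm (d k x))) \<partial>M) = (\<Sum>k. \<integral>\<^sup>+x. ennreal (norm (d k x)) \<partial>M)"
    by (rule nn_integral_suminf) simp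
  also have "\<dots> = (\<Sum>k. ennreal (\<integral>x. norm (d k x) \<partial>M))"
    using assms(1) by (simp add: nn_integral_eq_integral)
  also have "\<dots> = ennreal (\<Sum>k. \<integral>x. norm (d k x) \<partial>M)"
    using assms(2) by (intro suminf_ennreal2) auto
  finally have "(\<integral>\<^sup>+x. (\<Sum>k. ennreal (norm (d k x))) \<partial>M) \<noteq> \<infinity>" by simp
  then have "AE x in M. (\<Sum>k. ennreal (norm (d k x))) \<noteq> \<infinity>"
    by (intro nn_integral_PInf_AE) auto
  then show ?thesis by eventually_elim (auto intro!: summable_suminf_not_top)
qed

text \<open>A subsequence with geometrically small increments converges almost everywhere, because
  on a set of finite measure its increments are also summable in the integral norm. Fatou's lemma
  then compares the limit with every late term, so the whole sequence converges and not just the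
  subsequence.\<close>

theorem Riesz_Fischer:
  fixes f :: "nat \<Rightarrow> 'a::euclidean_space \<Rightarrow> 'b::euclidean_space"
  assumes \<Omega>: "\<Omega> \<in> lmeasurable" and f: "\<And>k. L2 \<Omega> (f k)"
    and Cauchy: "\<And>e. e > 0 \<Longrightarrow> \<exists>N. \<forall>m\<ge>N. \<forall>n\<ge>N. L2norm \<Omega> (\<lambda>x. f m x - f n x) < e"
  obtains g where "L2 \<Omega> g" "(\<lambda>k. L2norm \<Omega> (\<lambda>x. f k x - g x)) \<longlonglongrightarrow> 0"
proof -
  define M where "M = lebesgue_on \<Omega>"
  have [measurable]: "f k \<in> borel_measurable M" for k using f[of k] by (auto simp: L2_def M_def)
  define N where "N k = (SOME N. \<forall>m\<ge>N. \<forall>n\<ge>N. L2norm \<Omega> (\<lambda>x. f m x - f n x) < (1/2)^k)" for k :: nat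
  have "\<exists>N. \<forall>m\<ge>N. \<forall>n\<ge>N. L2norm \<Omega> (\<lambda>x. f m x - f n x) < (1/2)^k" for k :: nat
    by (rule Cauchy) simp
  from someI_ex[OF this, folded N_def]
  have N: "L2norm \<Omega> (\<lambda>x. f m x - f n x) < (1/2)^k" if "m \<ge> N k" "n \<ge> N k" for k m n
    using that by simp
  \<comment> \<open>Summing the \<open>N j\<close> makes \<open>r\<close> monotone and at least
    \<open>N k\<close>; the added \<open>k\<close> forces \<open>r k \<ge> k\<close>, so that
    \<open>r k\<close> eventually passes any given threshold.\<close>
  define r where "r k = (\<Sum>j\<le>k. N j) + k" for k
  have rN: "r k \<ge> N k" for k
    using member_le_sum[of k "{..k}" N] by (simp add: r_def)
  have rmono: "r k \<le> r (Suc k)" for k by (simp add: r_def)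
  have rk: "r k \<ge> k" for k by (simp add: r_def)
  define d where "d k x = f (r (Suc k)) x - f (r k) x" for k x
  have dL2: "L2 \<Omega> (d k)" for k unfolding d_def by (intro L2_diff f)
  have "AE x in M. summable (\<lambda>k. norm (d k x))"
  proof (rule summable_L1_norms_AE)
    show "integrable M (d k)" for k
      unfolding M_def using L2_L1_bound(1)[OF \<Omega> dL2] .
    show "summable (\<lambda>k. \<integral>x. norm (d k x) \<partial>M)"
    proof (rule summable_comparison_test')
      show "summable (\<lambda>k. (1/2::real)^k * sqrt (measure lebesgue \<Omega>))"
        by (intro summable_mult2 summable_geometric) simp
      fix k :: nat
      have "(\<integral>x. norm (d k x) \<partial>M) \<le> L2norm \<Omega> (d k) * sqrt (measure lebesgue \<Omega>)"
        unfolding M_def by (rule L2_L1_bound(2)[OF \<Omega> dL2])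
      also have "\<dots> \<le> (1/2)^k * sqrt (measure lebesgue \<Omega>)"

      proof (rule mult_right_mono)
        show "L2norm \<Omega> (d k) \<le> (1/2)^k"
          using N[of k "r (Suc k)" "r k"] rN[of k] rmono[of k] by (simp add: d_def[abs_def])
      qed simp
      finally show "norm (\<integral>x. norm (d k x) \<partial>M) \<le> (1/2)^k * sqrt (measure lebesgue \<Omega>)" by simp
    qed
  qed
  then have conv: "AE x in M. convergent (\<lambda>k. f (r k) x)"
  proof eventually_elim
    case (elim x)
    have "(\<lambda>k. f (r k) x) = (\<lambda>k. f (r 0) x + (\<Sum>i<k. d i x))"
      unfolding d_def using sum_lessThan_telescope[of "\<lambda>i. f (r i) x"] by fastforce
    moreover have "convergent (\<lambda>k. \<Sum>i<k. d i x)"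
      using summable_norm_cancel[OF elim] by (simp only: summable_iff_convergent)
    then have "convergent (\<lambda>k. f (r 0) x + (\<Sum>i<k. d i x))"
      by (intro convergent_add convergent_const)
    ultimately show ?case by (simp only:)
  qed
  \<comment> \<open>\<open>lim\<close> is total and preserves measurability; it is the actual limit
    only where the subsequence converges, that is, almost everywhere.\<close>
  define g where "g x = lim (\<lambda>k. f (r k) x)" for x
  have gm [measurable]: "g \<in> borel_measurable M" unfolding g_def by measurable
  have lim: "AE x in M. (\<lambda>k. f (r k) x) \<longlonglongrightarrow> g x"
    using conv by eventually_elim (simp add: g_def convergent_LIMSEQ_iff)
  \<comment> \<open>Fatou along the subsequence, with \<open>m\<close> fixed: the bound
    \<open>e\<close> between late terms survives the passage to \<open>g\<close>, which also shows
    that \<open>f m - g\<close> is square integrable.\<close>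
  have main: "L2 \<Omega> (\<lambda>x. f m x - g x) \<and> L2norm \<Omega> (\<lambda>x. f m x - g x) \<le> e"
    if e: "e > 0" and K: "\<forall>m\<ge>K. \<forall>n\<ge>K. L2norm \<Omega> (\<lambda>x. f m x - f n x) < e" and m: "m \<ge> K" for e K m
  proof -
    have "(\<integral>\<^sup>+x. ennreal ((norm (f m x - g x))\<^sup>2) \<partial>M)
        = (\<integral>\<^sup>+x. liminf (\<lambda>k. ennreal ((norm (f m x - f (r k) x))\<^sup>2)) \<partial>M)"
    proof (rule nn_integral_cong_AE)
      show "AE x in M. ennreal ((norm (f m x - g x))\<^sup>2)
          = liminf (\<lambda>k. ennreal ((norm (f m x - f (r k) x))\<^sup>2))"
        using lim
      proof eventually_elim
        case (elim x)
        have "(\<lambda>k. ennreal ((norm (f m x - f (r k) x))\<^sup>2)) \<longlonglongrightarrow> ennreal ((norm (f m x - g x))\<^sup>2)"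
          by (intro tendsto_intros elim)
        then show ?case by (intro lim_imp_Liminf[symmetric]) auto
      qed
    qed
    also have "\<dots> \<le> liminf (\<lambda>k. \<integral>\<^sup>+x. ennreal ((norm (f m x - f (r k) x))\<^sup>2) \<partial>M)"
      by (intro nn_integral_liminf) simp
    also have "\<dots> \<le> ennreal (e\<^sup>2)"
    proof (rule Liminf_le)
      show "\<forall>\<^sub>F k in sequentially. (\<integral>\<^sup>+x. ennreal ((norm (f m x - f (r k) x))\<^sup>2) \<partial>M) \<le> ennreal (e\<^sup>2)"
        using eventually_ge_at_top[of K]
      proof eventually_elim
        case (elim k)
        have "(\<integral>\<^sup>+x. ennreal ((norm (f m x - f (r k) x))\<^sup>2) \<partial>M)
            = ennreal (integral\<^sup>L M (\<lambda>x. (norm (f m x - f (r k) x))\<^sup>2))"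
          unfolding M_def by (intro nn_integral_eq_integral L2_norm_square_integrable L2_diff f) auto
        also have "integral\<^sup>L M (\<lambda>x. (norm (f m x - f (r k) x))\<^sup>2) = (L2norm \<Omega> (\<lambda>x. f m x - f (r k) x))\<^sup>2"
          by (simp add: L2norm_def M_def)
        also have "ennreal \<dots> \<le> ennreal (e\<^sup>2)"
        proof (intro ennreal_leI power_mono)
          show "L2norm \<Omega> (\<lambda>x. f m x - f (r k) x) \<le> e"
            using K m le_trans[OF elim rk[of k]] less_imp_le by blast
        qed simp
        finally show ?case .
      qed
    qed simp
    finally have le: "(\<integral>\<^sup>+x. ennreal ((norm (f m x - g x))\<^sup>2) \<partial>M) \<le> ennreal (e\<^sup>2)" .
    have meas: "(\<lambda>x. (norm (f m x - g x))\<^sup>2) \<in> borel_measurable M" by simp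
    have int: "integrable M (\<lambda>x. (norm (f m x - g x))\<^sup>2)"
    proof (rule integrableI_bounded[OF meas])
      show "(\<integral>\<^sup>+x. ennreal (norm ((norm (f m x - g x))\<^sup>2)) \<partial>M) < \<infinity>"
        using le_less_trans[OF le ennreal_less_top] by simp
    qed
    have "(\<lambda>x. f m x - g x) \<in> borel_measurable M" by simp
    with int have "L2 \<Omega> (\<lambda>x. f m x - g x)" unfolding L2_def M_def by blast
    moreover have "ennreal (integral\<^sup>L M (\<lambda>x. (norm (f m x - g x))\<^sup>2)) \<le> ennreal (e\<^sup>2)"
      using le nn_integral_eq_integral[OF int] by simp
    then have "integral\<^sup>L M (\<lambda>x. (norm (f m x - g x))\<^sup>2) \<le> e\<^sup>2" by simp
    then have "L2norm \<Omega> (\<lambda>x. f m x - g x) \<le> e"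
      using e real_le_lsqrt unfolding L2norm_def M_def by fastforce
    ultimately show ?thesis by simp
  qed
  obtain K where K: "\<forall>m\<ge>K. \<forall>n\<ge>K. L2norm \<Omega> (\<lambda>x. f m x - f n x) < 1"
    using Cauchy[of 1] by (meson zero_less_one)
  from conjunct1[OF main[OF zero_less_one K order_refl]] have "L2 \<Omega> (\<lambda>x. f K x - g x)" .
  from L2_diff[OF f[of K] this] have "L2 \<Omega> g" by simp
  moreover have "(\<lambda>k. L2norm \<Omega> (\<lambda>x. f k x - g x)) \<longlonglongrightarrow> 0"
  proof (rule LIMSEQ_I)
    fix e :: real assume e: "e > 0"
    then have e2: "e / 2 > 0" by simp
    from Cauchy[OF e2] obtain K where K: "\<forall>m\<ge>K. \<forall>n\<ge>K. L2norm \<Omega> (\<lambda>x. f m x - f n x) < e/2" ..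
    have "norm (L2norm \<Omega> (\<lambda>x. f n x - g x) - 0) < e" if "n \<ge> K" for n
      using conjunct2[OF main[OF e2 K that]] e by simp
    then show "\<exists>K. \<forall>n\<ge>K. norm (L2norm \<Omega> (\<lambda>x. f n x - g x) - 0) < e" by blast
  qed
  ultimately show ?thesis by (rule that)
qed

subsection \<open>Smooth and test functions\<close>

definition grad :: "(real^'n::finite \<Rightarrow> real) \<Rightarrow> real^'n \<Rightarrow> real^'n" where
  "grad \<phi> x = (\<chi> i. partial i \<phi> x)"

text \<open>\<open>smooth\<close> refers to all iterated partial derivatives. Instead of computing
  them, it suffices to exhibit a family of differentiable functions that is stable under each
  \<open>partial i\<close>.\<close>

lemma smooth_in_closed_family:
  assumes "f \<in> F" and "\<And>f x. f \<in> F \<Longrightarrow> f differentiable (at x)" and "\<And>f i. f \<in> F \<Longrightarrow> partial i f \<in> F"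
  shows "smooth f"
proof -
  have "iter_partial is f \<in> F" for "is" by (induction "is") (use assms in auto)
  then show ?thesis using assms(2) by (simp add: smooth_def)
qed

lemma smooth_differentiable: "smooth \<phi> \<Longrightarrow> \<phi> differentiable (at x)"
  unfolding smooth_def by (metis iter_partial.simps(1))

text \<open>\<open>iter_partial\<close> applies the head of the list last, so an inner derivative is
  appended at the end of the list.\<close>

lemma smooth_partial:
  assumes "smooth \<phi>"
  shows "smooth (partial i \<phi>)"
proof -
  have "iter_partial is (partial i \<phi>) = iter_partial (is @ [i]) \<phi>" for "is"
    by (induction "is") auto
  then show ?thesis using assms by (simp add: smooth_def)
qed

lemma smooth_continuous: "smooth \<phi> \<Longrightarrow> continuous_on S \<phi>"
  by (metis continuous_at_imp_continuous_on differentiable_imp_continuous_within smooth_differentiable)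

lemma partial_eq:
  assumes "(f has_derivative f') (at x)"
  shows "partial i f x = f' (axis i 1)"
  by (simp add: partial_def frechet_derivative_at[OF assms, symmetric])

lemma has_derivative_frechet:
  "f differentiable (at x) \<Longrightarrow> (f has_derivative frechet_derivative f (at x)) (at x)"
  by (simp add: frechet_derivative_works)

lemma partial_mult:
  assumes "f differentiable (at x)" "g differentiable (at x)"
  shows "partial i (\<lambda>x. f x * g x) x = f x * partial i g x + partial i f x * g x"
  using partial_eq[OF has_derivative_mult[OF assms[THEN has_derivative_frechet]]]
  by (simp add: partial_def)

lemma partial_add_mult:
  assumes "f differentiable (at x)" "g differentiable (at x)"
  shows "partial i (\<lambda>x. f x + c * g x) x = partial i f x + c * partial i g x"
  using partial_eq[OF has_derivative_add[OF assms(1)[THEN has_derivative_frechet]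
        has_derivative_mult_right[OF assms(2)[THEN has_derivative_frechet]]]]
  by (simp add: partial_def)

lemma partial_const [simp]: "partial i (\<lambda>x. c) x = 0"
  using partial_eq[OF has_derivative_const] .

lemma smooth_const: "smooth (\<lambda>x. c)"
  by (rule smooth_in_closed_family[where F = "range (\<lambda>c x. c)"]) (auto simp: fun_eq_iff)

lemma smooth_add_mult:
  assumes "smooth f" "smooth g"
  shows "smooth (\<lambda>x. f x + c * g x)"
proof (rule smooth_in_closed_family[where F = "{\<lambda>x. f x + c * g x |f g. smooth f \<and> smooth g}"])
  fix h i assume "h \<in> {\<lambda>x. f x + c * g x |f g. smooth f \<and> smooth g}"
  then obtain f g where h: "h = (\<lambda>x. f x + c * g x)" and fg: "smooth f" "smooth g" by blast
  show "h differentiable at x" for x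
    unfolding h by (intro derivative_intros smooth_differentiable fg)
  have "partial i h = (\<lambda>x. partial i f x + c * partial i g x)"
    unfolding h by (intro ext partial_add_mult smooth_differentiable fg)
  then show "partial i h \<in> {\<lambda>x. f x + c * g x |f g. smooth f \<and> smooth g}"
    using fg smooth_partial by blast
next
  show "(\<lambda>x. f x + c * g x) \<in> {\<lambda>x. f x + c * g x |f g. smooth f \<and> smooth g}"
    using assms by blast
qed

lemma partial_outside_support:
  assumes "closed K" "\<And>x. x \<notin> K \<Longrightarrow> f x = 0" "x \<notin> K"
  shows "partial i f x = 0"
proof -
  have "(f has_derivative (\<lambda>x. 0)) (at x)"
  proof (rule has_derivative_transform_within_open[OF has_derivative_const[of 0]])
    show "open (- K)" "x \<in> - K" using assms by auto
  qed (simp add: assms(2))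
  from partial_eq[OF this] show ?thesis .
qed

lemma test_fun_smooth: "test_fun \<Omega> \<phi> \<Longrightarrow> smooth \<phi>"
  by (simp add: test_fun_def)

lemma test_fun_support:
  assumes "test_fun \<Omega> \<phi>"
  obtains K where "compact K" "K \<subseteq> \<Omega>" "\<And>x. x \<notin> K \<Longrightarrow> \<phi> x = 0" "\<And>i x. x \<notin> K \<Longrightarrow> partial i \<phi> x = 0"
proof
  let ?K = "closure {x. \<phi> x \<noteq> 0}"
  show "compact ?K" "?K \<subseteq> \<Omega>" using assms by (auto simp: test_fun_def)
  show 0: "\<phi> x = 0" if "x \<notin> ?K" for x
    using that closure_subset[of "{x. \<phi> x \<noteq> 0}"] by (auto dest: subsetD)
  show "partial i \<phi> x = 0" if "x \<notin> ?K" for i x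
    by (rule partial_outside_support[OF _ 0 that]) auto
qed

text \<open>Any compact subset of \<open>\<Omega>\<close> outside of which the function vanishes
  will do, so the closure in \<open>test_fun\<close> need never be computed.\<close>

lemma test_funI:
  assumes "smooth \<phi>" "compact K" "K \<subseteq> \<Omega>" "\<And>x. x \<notin> K \<Longrightarrow> \<phi> x = 0"
  shows "test_fun \<Omega> \<phi>"
proof -
  have "closure {x. \<phi> x \<noteq> 0} \<subseteq> K"
    using assms(2,4) by (intro closure_minimal) (auto simp: compact_imp_closed)
  moreover from this have "compact (closure {x. \<phi> x \<noteq> 0})"
    using compact_Int_closed[OF assms(2) closed_closure, of "{x. \<phi> x \<noteq> 0}"] by (simp add: Int_absorb1)
  ultimately show ?thesis using assms by (auto simp: test_fun_def)
qed

lemma test_fun_zero: "test_fun \<Omega> (\<lambda>x. 0)"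
  by (rule test_funI[where K = "{}"]) (auto intro: smooth_const)

lemma test_fun_add_mult:
  assumes "test_fun \<Omega> \<phi>" "test_fun \<Omega> \<psi>"
  shows "test_fun \<Omega> (\<lambda>x. \<phi> x + c * \<psi> x)"
proof -
  obtain K where K: "compact K" "K \<subseteq> \<Omega>" "\<And>x. x \<notin> K \<Longrightarrow> \<phi> x = 0"
    using test_fun_support[OF assms(1)] by metis
  obtain L where L: "compact L" "L \<subseteq> \<Omega>" "\<And>x. x \<notin> L \<Longrightarrow> \<psi> x = 0"
    using test_fun_support[OF assms(2)] by metis
  show ?thesis
    by (rule test_funI[where K = "K \<union> L"])
      (use assms K L in \<open>auto intro!: smooth_add_mult simp: test_fun_smooth\<close>)
qed

lemma grad_add_mult:
  assumes "smooth \<phi>" "smooth \<psi>"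
  shows "grad (\<lambda>x. \<phi> x + c * \<psi> x) x = grad \<phi> x + c *\<^sub>R grad \<psi> x"
  by (simp add: grad_def vec_eq_iff partial_add_mult smooth_differentiable assms)

subsection \<open>Integration by parts\<close>

lemma compactly_supported_lborel_integrable:
  fixes f :: "'a::euclidean_space \<Rightarrow> 'b::{banach, second_countable_topology}"
  assumes "continuous_on UNIV f" "compact K" "\<And>x. x \<notin> K \<Longrightarrow> f x = 0"
  shows "integrable lborel f"
proof -
  have "(\<lambda>x. indicator K x *\<^sub>R f x) = f" using assms(3) by (auto simp: indicator_def)
  then show ?thesis
    using borel_integrable_compact[OF assms(2), of f] assms(1) by (auto intro: continuous_on_subset)
qed

text \<open>Moves integrals to \<open>lborel\<close>, where translation invariance is available;
  nothing changes because the function vanishes off a subset of \<open>\<Omega>\<close>.\<close>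

lemma compactly_supported_lebesgue_on:
  fixes f :: "'a::euclidean_space \<Rightarrow> 'b::{banach, second_countable_topology}"
  assumes "\<Omega> \<in> sets lebesgue" "continuous_on UNIV f" "compact K" "K \<subseteq> \<Omega>" "\<And>x. x \<notin> K \<Longrightarrow> f x = 0"
  shows "integrable (lebesgue_on \<Omega>) f" "integral\<^sup>L (lebesgue_on \<Omega>) f = integral\<^sup>L lborel f"
proof -
  have int: "integrable lborel f"
    using compactly_supported_lborel_integrable assms by blast
  have [measurable]: "f \<in> borel_measurable lborel" using int by auto
  have eq: "(\<lambda>x. indicator \<Omega> x *\<^sub>R f x) = f" using assms(4,5) by (auto simp: indicator_def fun_eq_iff)
  show "integrable (lebesgue_on \<Omega>) f"
    using assms(1) int by (simp add: integrable_restrict_space eq integrable_completion)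
  show "integral\<^sup>L (lebesgue_on \<Omega>) f = integral\<^sup>L lborel f"
    using assms(1) int by (simp add: integral_restrict_space eq integral_completion)
qed

lemma integral_lborel_translate:
  fixes f :: "'a::euclidean_space \<Rightarrow> real"
  assumes "integrable lborel f"
  shows "integrable lborel (\<lambda>x. f (c + x))" "integral\<^sup>L lborel (\<lambda>x. f (c + x)) = integral\<^sup>L lborel f"
proof -
  have [measurable]: "f \<in> borel_measurable borel" using assms by auto
  show "integral\<^sup>L lborel (\<lambda>x. f (c + x)) = integral\<^sup>L lborel f"
    using integral_distr[of "(+) c" lborel borel f] by (simp add: lborel_distr_plus)
  show "integrable lborel (\<lambda>x. f (c + x))"
    using integrable_distr_eq[of "(+) c" lborel borel f] assms by (simp add: lborel_distr_plus)
qed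

lemma has_derivative_along_axis:
  assumes "f differentiable (at (x + s *\<^sub>R axis i 1))"
  shows "((\<lambda>s. f (x + s *\<^sub>R axis i 1)) has_real_derivative partial i f (x + s *\<^sub>R axis i 1)) (at s)"
proof -
  let ?f' = "frechet_derivative f (at (x + s *\<^sub>R axis i 1))"
  have lin: "linear ?f'"
    using has_derivative_linear[OF has_derivative_frechet[OF assms]] .
  have "((\<lambda>s. x + s *\<^sub>R axis i 1) has_derivative (\<lambda>h. h *\<^sub>R axis i 1)) (at s)"
    by (auto intro!: derivative_eq_intros)
  from has_derivative_compose[OF this has_derivative_frechet[OF assms]]
  have "((\<lambda>s. f (x + s *\<^sub>R axis i 1)) has_derivative (\<lambda>h. ?f' (h *\<^sub>R axis i 1))) (at s)" .
  moreover have "(\<lambda>h. ?f' (h *\<^sub>R axis i 1)) = (*) (partial i f (x + s *\<^sub>R axis i 1))"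
    by (simp add: fun_eq_iff partial_def linear_cmul[OF lin])
  ultimately show ?thesis by (simp add: has_field_derivative_def)
qed

text \<open>The difference quotients have integral zero by translation invariance, and converge
  boundedly to the partial derivative.\<close>
lemma integral_partial_zero:
  fixes f :: "real^'n::finite \<Rightarrow> real"
  assumes diff: "\<And>x. f differentiable (at x)" and cont: "continuous_on UNIV (partial i f)"
    and K: "compact K" "\<And>x. x \<notin> K \<Longrightarrow> f x = 0"
  shows "integral\<^sup>L lborel (partial i f) = 0"
proof -
  let ?e = "axis i 1 :: real^'n"
  have contf: "continuous_on UNIV f"
    using diff by (metis continuous_at_imp_continuous_on differentiable_imp_continuous_within)
  have p0: "x \<notin> K \<Longrightarrow> partial i f x = 0" for x
    using partial_outside_support[OF compact_imp_closed[OF K(1)] K(2)] .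
  have "compact (partial i f ` K)"
    using K(1) cont by (intro compact_continuous_image) (auto intro: continuous_on_subset)
  then obtain B where B: "\<And>x. x \<in> K \<Longrightarrow> \<bar>partial i f x\<bar> \<le> B"
    by (metis bounded_iff compact_imp_bounded imageI real_norm_def)
  have B': "\<bar>partial i f x\<bar> \<le> max B 0" for x
    using B[of x] p0[of x] by (cases "x \<in> K") auto
  define t where "t k = inverse (real (Suc k))" for k
  have t: "0 < t k" "t k \<le> 1" for k by (auto simp: t_def field_simps)
  have t0: "t \<longlonglongrightarrow> 0" unfolding t_def by (rule LIMSEQ_inverse_real_of_nat)
  define D where "D k x = (f (x + t k *\<^sub>R ?e) - f x) / t k" for k x
  have intf: "integrable lborel f"
    by (rule compactly_supported_lborel_integrable[OF contf K])
  have "integral\<^sup>L lborel (D k) = 0" for k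
    unfolding D_def using integral_lborel_translate[OF intf, of "t k *\<^sub>R ?e"] intf
    by (simp add: add.commute)
  \<comment> \<open>As all steps \<open>t k\<close> are at most 1, the points within distance 1 of
    \<open>K\<close> contain the supports of all difference quotients, which makes one integrable
    dominating function possible.\<close>
  define K' where "K' = (\<lambda>(x, y). x - y) ` (K \<times> cball 0 1)"
  have "compact K'" unfolding K'_def
    by (intro compact_continuous_image compact_Times K) (auto simp: case_prod_unfold intro!: continuous_intros)
  have KK': "x \<in> K'" if "x + s *\<^sub>R ?e \<in> K" "\<bar>s\<bar> \<le> 1" for x s
    using that unfolding K'_def by (auto intro!: image_eqI[where x = "(x + s *\<^sub>R ?e, s *\<^sub>R ?e)"])
  have D0: "D k x = 0" if "x \<notin> K'" for k x
  proof -
    have "x + t k *\<^sub>R ?e \<notin> K" "x \<notin> K" using KK'[of x "t k"] KK'[of x 0] that t[of k] by auto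
    then show ?thesis by (simp add: D_def K(2))
  qed
  have Dbd: "\<bar>D k x\<bar> \<le> max B 0" for k x
  proof -
    obtain s where "f (x + t k *\<^sub>R ?e) - f (x + 0 *\<^sub>R ?e) = (t k - 0) * partial i f (x + s *\<^sub>R ?e)"
      using MVT2[of 0 "t k" "\<lambda>s. f (x + s *\<^sub>R ?e)" "\<lambda>s. partial i f (x + s *\<^sub>R ?e)"]
        has_derivative_along_axis[OF diff] t[of k] by auto
    then show ?thesis using B'[of "x + s *\<^sub>R ?e"] t[of k] by (simp add: D_def)
  qed
  have [measurable]: "f \<in> borel_measurable borel" "partial i f \<in> borel_measurable borel"
    using contf cont by (auto intro: borel_measurable_continuous_onI)
  have "D k \<in> borel_measurable borel" for k unfolding D_def[abs_def] by measurable
  have "(\<lambda>k. integral\<^sup>L lborel (D k)) \<longlonglongrightarrow> integral\<^sup>L lborel (partial i f)"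
  proof (rule integral_dominated_convergence[where w = "\<lambda>x. indicator K' x *\<^sub>R max B 0"])
    show "integrable lborel (\<lambda>x. indicator K' x *\<^sub>R max B 0)"
      by (rule borel_integrable_compact) (use \<open>compact K'\<close> in auto)
    show "AE x in lborel. (\<lambda>k. D k x) \<longlonglongrightarrow> partial i f x"
    proof (rule AE_I2)
      fix x
      have "((\<lambda>s. (f (x + s *\<^sub>R ?e) - f x) / s) \<longlongrightarrow> partial i f x) (at 0)"
        using has_derivative_along_axis[of f x 0 i, OF diff] by (simp add: DERIV_def)
      from filterlim_compose[OF this, of t sequentially]
      show "(\<lambda>k. D k x) \<longlonglongrightarrow> partial i f x"
        unfolding D_def using t0 t(1)
        by (auto simp: filterlim_at intro!: always_eventually dest: order_less_imp_not_eq2)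
    qed
    show "AE x in lborel. norm (D k x) \<le> indicator K' x *\<^sub>R max B 0" for k
      using Dbd D0 by (auto simp: indicator_def)
  qed (use \<open>\<And>k. D k \<in> borel_measurable borel\<close> in auto)
  then show ?thesis using \<open>\<And>k. integral\<^sup>L lborel (D k) = 0\<close> by (simp add: LIMSEQ_const_iff)
qed

text \<open>The product \<open>\<phi> \<psi>\<close> inherits the compact support of
  \<open>\<psi>\<close>, so the integral of its partial derivative vanishes; the product rule splits
  it into the two sides.\<close>

lemma integration_by_parts:
  fixes \<phi> \<psi> :: "real^'n::finite \<Rightarrow> real"
  assumes \<Omega>: "\<Omega> \<in> sets lebesgue" and \<phi>: "smooth \<phi>" and \<psi>: "test_fun \<Omega> \<psi>"
  shows "integral\<^sup>L (lebesgue_on \<Omega>) (\<lambda>x. \<phi> x * partial i \<psi> x)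
     = - integral\<^sup>L (lebesgue_on \<Omega>) (\<lambda>x. partial i \<phi> x * \<psi> x)"
proof -
  obtain K where K: "compact K" "K \<subseteq> \<Omega>" "\<And>x. x \<notin> K \<Longrightarrow> \<psi> x = 0" "\<And>i x. x \<notin> K \<Longrightarrow> partial i \<psi> x = 0"
    using test_fun_support[OF \<psi>] by metis
  note s = \<phi> smooth_partial[OF \<phi>, of i] test_fun_smooth[OF \<psi>] smooth_partial[OF test_fun_smooth[OF \<psi>], of i]
  note c = s[THEN smooth_continuous]
  have p: "partial i (\<lambda>x. \<phi> x * \<psi> x) = (\<lambda>x. \<phi> x * partial i \<psi> x + partial i \<phi> x * \<psi> x)"
    by (intro ext partial_mult smooth_differentiable s)
  have "integral\<^sup>L lborel (partial i (\<lambda>x. \<phi> x * \<psi> x)) = 0"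
  proof (rule integral_partial_zero[OF _ _ K(1)])
    show "(\<lambda>x. \<phi> x * \<psi> x) differentiable at x" for x
      by (intro differentiable_mult smooth_differentiable s)
    show "continuous_on UNIV (partial i (\<lambda>x. \<phi> x * \<psi> x))"
      unfolding p by (intro continuous_intros c)
  qed (simp add: K)
  moreover have "integrable lborel (\<lambda>x. \<phi> x * partial i \<psi> x)" "integrable lborel (\<lambda>x. partial i \<phi> x * \<psi> x)"
    using K by (auto intro!: compactly_supported_lborel_integrable[OF _ K(1)] continuous_intros c)
  moreover have "integral\<^sup>L (lebesgue_on \<Omega>) (\<lambda>x. \<phi> x * partial i \<psi> x) = integral\<^sup>L lborel (\<lambda>x. \<phi> x * partial i \<psi> x)"
    "integral\<^sup>L (lebesgue_on \<Omega>) (\<lambda>x. partial i \<phi> x * \<psi> x) = integral\<^sup>L lborel (\<lambda>x. partial i \<phi> x * \<psi> x)"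
    using K by (auto intro!: compactly_supported_lebesgue_on(2)[OF \<Omega> _ K(1,2)] continuous_intros c)
  ultimately show ?thesis by (simp add: p)
qed

lemma L2_compactly_supported:
  fixes f :: "'a::euclidean_space \<Rightarrow> 'b::euclidean_space"
  assumes "\<Omega> \<in> sets lebesgue" "continuous_on UNIV f" "compact K" "K \<subseteq> \<Omega>" "\<And>x. x \<notin> K \<Longrightarrow> f x = 0"
  shows "L2 \<Omega> f"
  unfolding L2_def
  using compactly_supported_lebesgue_on(1)[OF assms] assms
  by (auto intro!: compactly_supported_lebesgue_on(1)[OF assms(1) _ assms(3,4)] continuous_intros)

lemma continuous_on_grad: "smooth \<phi> \<Longrightarrow> continuous_on S (grad \<phi>)"
  unfolding grad_def[abs_def] by (intro continuous_on_vec_lambda smooth_continuous smooth_partial)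

lemma grad_outside: "(\<And>i. partial i \<phi> x = 0) \<Longrightarrow> grad \<phi> x = 0"
  by (simp add: grad_def vec_eq_iff)

lemma L2_test_fun:
  assumes "\<Omega> \<in> sets lebesgue" "test_fun \<Omega> \<phi>"
  shows "L2 \<Omega> \<phi>" "L2 \<Omega> (grad \<phi>)"
proof -
  obtain K where K: "compact K" "K \<subseteq> \<Omega>" "\<And>x. x \<notin> K \<Longrightarrow> \<phi> x = 0" "\<And>i x. x \<notin> K \<Longrightarrow> partial i \<phi> x = 0"
    using test_fun_support[OF assms(2)] by metis
  note s = test_fun_smooth[OF assms(2)]
  show "L2 \<Omega> \<phi>" by (rule L2_compactly_supported[OF assms(1) smooth_continuous[OF s] K(1,2,3)])
  show "L2 \<Omega> (grad \<phi>)"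
    by (rule L2_compactly_supported[OF assms(1) continuous_on_grad[OF s] K(1,2) grad_outside[OF K(4)]])
qed

lemma L2_set_integrable:
  fixes y :: "real^'n::finite \<Rightarrow> 'b::euclidean_space"
  assumes "\<Omega> \<in> lmeasurable" "L2 \<Omega> y" "K \<in> sets lebesgue" "K \<subseteq> \<Omega>"
  shows "set_integrable lebesgue K y"
proof (rule set_integrable_subset)
  show "set_integrable lebesgue \<Omega> y"
    using L2_L1_bound(1)[OF assms(1,2)] fmeasurableD[OF assms(1)]
    by (simp add: set_integrable_def integrable_restrict_space)
qed (use assms in auto)

lemma L2_component:
  assumes "L2 \<Omega> (G :: real^'n::finite \<Rightarrow> real^'m::finite)"
  shows "L2 \<Omega> (\<lambda>x. G x $ i)"
proof (rule L2_dominated[OF assms, of _ 1])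
  show "(\<lambda>x. G x $ i) \<in> borel_measurable (lebesgue_on \<Omega>)"
    using L2_measurable[OF assms] by (simp add: cart_eq_inner_axis)
qed (simp add: component_le_norm_cart)

text \<open>On a set of finite measure, square integrability settles the integrability clauses of
  \<open>is_weak_grad\<close>, so that only the defining identity is left to check.\<close>

lemma is_weak_grad_L2I:
  assumes "\<Omega> \<in> lmeasurable" "L2 \<Omega> y" "L2 \<Omega> g"
    and "\<And>\<phi> i. test_fun \<Omega> \<phi> \<Longrightarrow> L2inner \<Omega> y (partial i \<phi>) = - L2inner \<Omega> (\<lambda>x. g x $ i) \<phi>"
  shows "is_weak_grad \<Omega> y g"
  unfolding is_weak_grad_def
  using assms L2_set_integrable[OF assms(1) L2_component[OF assms(3)], of \<Omega>]
    L2_set_integrable[OF assms(1,2)]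
  by (auto simp: L2inner_def fmeasurableD lmeasurable_compact)

lemma is_weak_grad_test_fun:
  assumes "\<Omega> \<in> lmeasurable" "test_fun \<Omega> \<phi>"
  shows "is_weak_grad \<Omega> \<phi> (grad \<phi>)"
  using assms L2_test_fun[OF fmeasurableD[OF assms(1)] assms(2)]
    integration_by_parts[OF fmeasurableD[OF assms(1)] test_fun_smooth[OF assms(2)]]
  by (intro is_weak_grad_L2I) (auto simp: L2inner_def grad_def)

subsection \<open>The Poincare inequality\<close>

text \<open>Integrate \<open>\<partial>\<^sub>i (\<phi>\<^sup>2 x\<^sub>i) = 2 \<phi> (\<partial>\<^sub>i \<phi>) x\<^sub>i + \<phi>\<^sup>2\<close>.\<close>
lemma Poincare_test_fun:
  fixes \<Omega> :: "(real^'n::finite) set"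
  assumes \<Omega>: "\<Omega> \<in> sets lebesgue" "\<And>x. x \<in> \<Omega> \<Longrightarrow> norm x \<le> R" and \<phi>: "test_fun \<Omega> \<phi>"
  shows "L2norm \<Omega> \<phi> \<le> 2 * R * L2norm \<Omega> (grad \<phi>)"
proof -
  \<comment> \<open>Any coordinate direction serves; the index type is nonempty.\<close>
  define i :: 'n where "i = undefined"
  obtain K where K: "compact K" "K \<subseteq> \<Omega>" "\<And>x. x \<notin> K \<Longrightarrow> \<phi> x = 0" "\<And>i x. x \<notin> K \<Longrightarrow> partial i \<phi> x = 0"
    using test_fun_support[OF \<phi>] by metis
  note s = test_fun_smooth[OF \<phi>]
  note c = s[THEN smooth_continuous] smooth_partial[OF s, THEN smooth_continuous]
  define w where "w x = (x $ i) * partial i \<phi> x" for x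
  have dx: "((\<lambda>x. x $ i) has_derivative (\<lambda>x. x $ i)) (at x)" for x :: "real^'n"
    by (rule bounded_linear_imp_has_derivative[OF bounded_linear_vec_nth])
  have diff: "(\<lambda>x. \<phi> x * x $ i) differentiable at x" for x
    using differentiable_mult[OF smooth_differentiable[OF s], of "\<lambda>x. x $ i"] dx
    by (auto simp: differentiable_def)
  have "partial i (\<lambda>x. \<phi> x * (\<phi> x * x $ i)) = (\<lambda>x. 2 * (\<phi> x * w x) + \<phi> x * \<phi> x)"
  proof
    fix x
    have "partial i (\<lambda>x. x $ i) x = 1" using partial_eq[OF dx, of i x] by simp
    then have "partial i (\<lambda>x. \<phi> x * x $ i) x = \<phi> x + partial i \<phi> x * x $ i"
      using partial_mult[OF smooth_differentiable[OF s], of "\<lambda>x. x $ i" x i] dx by (auto simp: differentiable_def)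
    then show "partial i (\<lambda>x. \<phi> x * (\<phi> x * x $ i)) x = 2 * (\<phi> x * w x) + \<phi> x * \<phi> x"
      using partial_mult[OF smooth_differentiable[OF s] diff, of i x] by (simp add: w_def algebra_simps)
  qed
  moreover have "integral\<^sup>L lborel (partial i (\<lambda>x. \<phi> x * (\<phi> x * x $ i))) = 0"
  proof (rule integral_partial_zero[OF _ _ K(1)])
    show "(\<lambda>x. \<phi> x * (\<phi> x * x $ i)) differentiable at x" for x
      by (intro differentiable_mult[OF _ diff] smooth_differentiable s)
    show "continuous_on UNIV (partial i (\<lambda>x. \<phi> x * (\<phi> x * x $ i)))"
      unfolding calculation w_def by (intro continuous_intros c)
  qed (simp add: K)
  ultimately have 0: "integral\<^sup>L lborel (\<lambda>x. 2 * (\<phi> x * w x) + \<phi> x * \<phi> x) = 0" by simp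
  have cont: "continuous_on UNIV \<phi>" "continuous_on UNIV w"
    unfolding w_def by (intro continuous_intros c)+
  have "integrable lborel (\<lambda>x. \<phi> x * w x)" "integrable lborel (\<lambda>x. \<phi> x * \<phi> x)"
    using K by (auto intro!: compactly_supported_lborel_integrable[OF _ K(1)] continuous_intros cont)
  with 0 have "integral\<^sup>L lborel (\<lambda>x. \<phi> x * \<phi> x) = - 2 * integral\<^sup>L lborel (\<lambda>x. \<phi> x * w x)"
    by simp
  moreover have "integral\<^sup>L (lebesgue_on \<Omega>) (\<lambda>x. \<phi> x * \<phi> x) = integral\<^sup>L lborel (\<lambda>x. \<phi> x * \<phi> x)"
     "integral\<^sup>L (lebesgue_on \<Omega>) (\<lambda>x. \<phi> x * w x) = integral\<^sup>L lborel (\<lambda>x. \<phi> x * w x)"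
    using K by (auto intro!: compactly_supported_lebesgue_on(2)[OF \<Omega>(1) _ K(1,2)] continuous_intros cont)
  \<comment> \<open>Since \<open>w\<close> is at most \<open>R\<close> times the gradient in norm,
    Cauchy-Schwarz and division by the norm of \<open>\<phi>\<close> give the constant
    \<open>2 * R\<close>.\<close>
  ultimately have eq: "L2inner \<Omega> \<phi> \<phi> = - 2 * L2inner \<Omega> \<phi> w" by (simp add: L2inner_def)
  have "R * norm (grad \<phi> x) \<ge> norm (w x)" if "x \<in> \<Omega>" for x
    unfolding w_def norm_mult
    using \<Omega>(2)[OF that] component_le_norm_cart[of x i] component_le_norm_cart[of "grad \<phi> x" i]
    by (intro mult_mono) (auto simp: grad_def)
  then have bd: "norm (w x) \<le> norm (R *\<^sub>R grad \<phi> x)" if "x \<in> \<Omega>" for x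
    using that order_trans[OF _ abs_ge_self] by (fastforce simp: abs_mult)
  note L = L2_test_fun[OF \<Omega>(1) \<phi>]
  have wL2: "L2 \<Omega> w"
    by (rule L2_compactly_supported[OF \<Omega>(1) cont(2) K(1,2)]) (simp add: w_def K)
  have "L2norm \<Omega> w \<le> L2norm \<Omega> (\<lambda>x. R *\<^sub>R grad \<phi> x)"
    unfolding L2norm_def using bd \<Omega>(1)
    by (intro real_sqrt_le_mono integral_mono L2_norm_square_integrable wL2 L2_scaleR L power_mono) auto
  also have "\<dots> = \<bar>R\<bar> * L2norm \<Omega> (grad \<phi>)" by (rule L2norm_scaleR)
  finally have w: "L2norm \<Omega> w \<le> \<bar>R\<bar> * L2norm \<Omega> (grad \<phi>)" .
  \<comment> \<open>Over an empty \<open>\<Omega>\<close> the bound \<open>R\<close> may be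
    negative; the norms vanish in that case.\<close>
  have R: "\<bar>R\<bar> * L2norm \<Omega> (grad \<phi>) = R * L2norm \<Omega> (grad \<phi>)"
  proof (cases "\<Omega> = {}")
    case True
    then show ?thesis by (simp add: L2norm_def)
  next
    case False
    then have "R \<ge> 0" using \<Omega>(2) norm_ge_zero order_trans by (metis all_not_in_conv)
    then show ?thesis by simp
  qed
  have "L2norm \<Omega> \<phi> * L2norm \<Omega> \<phi> \<le> 2 * (L2norm \<Omega> \<phi> * L2norm \<Omega> w)"
    using eq L2_Cauchy_Schwarz[OF L(1) wL2] by (simp add: L2norm_square[symmetric] power2_eq_square)
  then have "L2norm \<Omega> \<phi> * L2norm \<Omega> \<phi> \<le> L2norm \<Omega> \<phi> * (2 * R * L2norm \<Omega> (grad \<phi>))"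
    using mult_left_mono[OF w, of "L2norm \<Omega> \<phi>"] R by (simp add: algebra_simps)
  then show ?thesis
    using w R L2norm_nonneg[of \<Omega> w] L2norm_nonneg[of \<Omega> \<phi>]
    by (cases "L2norm \<Omega> \<phi> = 0") (auto simp: mult_le_cancel_left)
qed

subsection \<open>Bump functions\<close>

text \<open>The classical function \<open>exp (- 1 / t)\<close> with flat zero at the origin, times
  powers of \<open>1/t\<close>. Differentiation produces exactly such powers, so the span of the
  family is stable under it.\<close>

definition flat :: "nat \<Rightarrow> real \<Rightarrow> real" where
  "flat k t = (if t > 0 then (1/t)^k * exp (- (1/t)) else 0)"

text \<open>Substituting \<open>1/t\<close> turns the claim into the growth of \<open>exp\<close>
  beyond every power.\<close>

lemma flat_right_limit: "(flat k \<longlongrightarrow> 0) (at_right 0)"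
proof -
  have "((\<lambda>t. (inverse t)^k / exp (inverse t)) \<longlongrightarrow> (0::real)) (at_right 0)"
    by (rule filterlim_compose[OF tendsto_power_div_exp_0 filterlim_inverse_at_top_right])
  moreover have "\<forall>\<^sub>F t in at_right 0. (inverse t)^k / exp (inverse t) = flat k t"
    using eventually_at_right_less[of 0]
    by eventually_elim (simp add: flat_def exp_minus inverse_eq_divide)
  ultimately show ?thesis by (rule Lim_transform_eventually)
qed

text \<open>Away from \<open>0\<close> this is the product rule. At \<open>0\<close> the difference
  quotient is \<open>0\<close> from the left and equals \<open>flat (Suc k)\<close> from the right,
  which tends to \<open>0\<close> as well; hence the family is treated for all \<open>k\<close>
  together.\<close>

lemma flat_DERIV: "(flat k has_real_derivative flat (k + 2) t - real k * flat (k + 1) t) (at t)"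
proof -
  consider "t > 0" | "t < 0" | "t = 0" by linarith
  then show ?thesis
  proof cases
    case 1
    have "((\<lambda>t. (1/t)^k * exp (- (1/t))) has_real_derivative flat (k + 2) t - real k * flat (k + 1) t) (at t)"
    proof (cases k)
      case 0
      then show ?thesis using 1
        by (auto intro!: derivative_eq_intros simp: flat_def field_simps power2_eq_square)
    next
      case (Suc m)
      have "m = 0 \<or> t ^ m = t * t ^ (m - Suc 0)"
        by (cases m) auto
      then show ?thesis using 1 Suc
        by (auto intro!: derivative_eq_intros simp: flat_def field_simps power2_eq_square)
    qed
    then show ?thesis
      by (rule DERIV_cong_ev[OF refl _ refl, THEN iffD1, rotated])
        (use 1 eventually_nhds_in_open[of "{0<..}" t] in \<open>auto simp: flat_def elim!: eventually_mono\<close>)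
  next
    case 2
    have "((\<lambda>t. 0) has_real_derivative flat (k + 2) t - real k * flat (k + 1) t) (at t)"
      using 2 by (simp add: flat_def)
    then show ?thesis
      by (rule DERIV_cong_ev[OF refl _ refl, THEN iffD1, rotated])
        (use 2 eventually_nhds_in_open[of "{..<0}" t] in \<open>auto simp: flat_def elim!: eventually_mono\<close>)
  next
    case 3
    have "((\<lambda>h. flat k h / h) \<longlongrightarrow> 0) (at 0)"
      unfolding filterlim_at_split
    proof
      show "((\<lambda>h. flat k h / h) \<longlongrightarrow> 0) (at_left 0)"
        by (rule tendsto_eventually) (auto simp: flat_def eventually_at_filter)
      show "((\<lambda>h. flat k h / h) \<longlongrightarrow> 0) (at_right 0)"
        by (rule Lim_transform_eventually[OF flat_right_limit[of "Suc k"]])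
          (auto simp: flat_def eventually_at_filter)
    qed
    then show ?thesis using 3 by (simp add: DERIV_def flat_def)
  qed
qed

text \<open>The generators composed with affine functions of one coordinate, closed under sums and
  products: a family stable under partial derivatives, as \<open>smooth_in_closed_family\<close>
  requires. Slopes \<open>s\<close> of both signs are needed for the two opposite faces of a
  box.\<close>

inductive_set flat_algebra :: "(real^'n::finite \<Rightarrow> real) set" where
  const: "(\<lambda>x. c) \<in> flat_algebra"
| base: "(\<lambda>x. flat k (s * x $ j + d)) \<in> flat_algebra"
| add: "f \<in> flat_algebra \<Longrightarrow> g \<in> flat_algebra \<Longrightarrow> (\<lambda>x. f x + g x) \<in> flat_algebra"
| mult: "f \<in> flat_algebra \<Longrightarrow> g \<in> flat_algebra \<Longrightarrow> (\<lambda>x. f x * g x) \<in> flat_algebra"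

lemma flat_base_derivative:
  fixes x :: "real^'n::finite"
  shows "((\<lambda>x. flat k (s * x $ j + d)) has_derivative
    (\<lambda>h. (s * h $ j) * (flat (k + 2) (s * x $ j + d) - real k * flat (k + 1) (s * x $ j + d)))) (at x)"
proof -
  have "((\<lambda>x. s * x $ j + d) has_derivative (\<lambda>h. s * h $ j)) (at x)"
    by (auto intro!: derivative_eq_intros bounded_linear_imp_has_derivative bounded_linear_vec_nth)
  from has_derivative_compose[OF this flat_DERIV[THEN has_field_derivative_imp_has_derivative]]
  show ?thesis by (simp add: mult.commute)
qed

lemma flat_algebra_closed:
  assumes "f \<in> flat_algebra"
  shows "(\<forall>x. f differentiable (at x)) \<and> partial i f \<in> flat_algebra"
  using assms
proof induction
  case (const c)
  have "partial i (\<lambda>x. c) = (\<lambda>x. 0)" by (simp add: fun_eq_iff)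
  then show ?case by (simp add: flat_algebra.const)
next
  case (base k s j d)
  have "partial i (\<lambda>x. flat k (s * x $ j + d)) = (\<lambda>x. (s * axis i 1 $ j) *
      (flat (k + 2) (s * x $ j + d) + (- real k) * flat (k + 1) (s * x $ j + d)))"
    by (rule ext, subst partial_eq[OF flat_base_derivative]) simp
  also have "\<dots> \<in> flat_algebra" by (intro flat_algebra.intros)
  finally show ?case using differentiableI[OF flat_base_derivative] by auto
next
  case (add f g)
  have "partial i (\<lambda>x. f x + 1 * g x) = (\<lambda>x. partial i f x + 1 * partial i g x)"
    using add.IH by (intro ext partial_add_mult) auto
  then show ?case using add.IH by (auto intro: flat_algebra.add)
next
  case (mult f g)
  have "partial i (\<lambda>x. f x * g x) = (\<lambda>x. f x * partial i g x + partial i f x * g x)"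
    using mult.IH by (intro ext partial_mult) auto
  then show ?case using mult by (auto intro!: flat_algebra.add flat_algebra.mult differentiable_mult)
qed

lemma flat_algebra_smooth: "f \<in> flat_algebra \<Longrightarrow> smooth f"
  by (rule smooth_in_closed_family[where F = flat_algebra]) (use flat_algebra_closed in auto)

lemma flat_algebra_prod: "finite A \<Longrightarrow> (\<And>j. j \<in> A \<Longrightarrow> f j \<in> flat_algebra) \<Longrightarrow> (\<lambda>x. \<Prod>j\<in>A. f j x) \<in> flat_algebra"
  by (induction A rule: finite_induct) (auto intro: flat_algebra.intros)

text \<open>Two factors for each coordinate, one per face, make the function vanish off the open
  box. Scaling by \<open>Suc m\<close> drives every factor to 1 inside, so the bumps approximate the
  indicator of the box rather than a point mass.\<close>

definition box_bump :: "real^'n::finite \<Rightarrow> real^'n \<Rightarrow> nat \<Rightarrow> real^'n \<Rightarrow> real" where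
  "box_bump a b m x = (\<Prod>j\<in>UNIV. flat 0 (real (Suc m) * (x $ j - a $ j)) * flat 0 (real (Suc m) * (b $ j - x $ j)))"

lemma box_bump_test_fun:
  fixes a b :: "real^'n::finite"
  assumes "cbox a b \<subseteq> \<Omega>"
  shows "test_fun \<Omega> (box_bump a b m)"
proof (rule test_funI)
  have "(\<lambda>x. flat 0 (real (Suc m) * x $ j + - (real (Suc m) * a $ j))
      * flat 0 (- real (Suc m) * x $ j + real (Suc m) * b $ j)) \<in> flat_algebra" for j :: 'n
    by (intro flat_algebra.intros)
  from flat_algebra_prod[of UNIV, OF finite this]
  have "box_bump a b m \<in> flat_algebra"
    unfolding box_bump_def[abs_def] by (simp add: algebra_simps)
  then show "smooth (box_bump a b m)" by (rule flat_algebra_smooth)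
  fix x assume "x \<notin> cbox a b"
  then obtain j where "x $ j < a $ j \<or> b $ j < x $ j" by (auto simp: mem_box_cart not_le)
  then have "flat 0 (real (Suc m) * (x $ j - a $ j)) * flat 0 (real (Suc m) * (b $ j - x $ j)) = 0"
    by (auto simp: flat_def zero_less_mult_iff)
  then show "box_bump a b m x = 0"
    unfolding box_bump_def by (intro prod_zero) auto
qed (use assms in auto)

lemma flat_0_bounds: "0 \<le> flat 0 t" "flat 0 t \<le> 1"
  by (auto simp: flat_def)

lemma box_bump_bounded: "\<bar>box_bump a b m x\<bar> \<le> 1"
  unfolding box_bump_def abs_prod
  by (intro prod_le_1) (auto simp: abs_mult flat_0_bounds intro!: mult_le_one)

lemma flat_0_scale_tendsto: "(\<lambda>m. flat 0 (real (Suc m) * t)) \<longlonglongrightarrow> (if t > 0 then 1 else 0)"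
proof (cases "t > 0")
  case True
  have "(\<lambda>m. exp (- (inverse (real (Suc m)) * (1 / t)))) \<longlonglongrightarrow> exp (- (0 * (1 / t)))"
    by (intro tendsto_intros LIMSEQ_inverse_real_of_nat)
  moreover have "flat 0 (real (Suc m) * t) = exp (- (inverse (real (Suc m)) * (1 / t)))" for m
    using True mult_pos_pos[of "real (Suc m)" t] by (simp add: flat_def del: of_nat_Suc) (simp add: field_simps)
  ultimately show ?thesis using True by simp
next
  case False
  then show ?thesis by (simp add: flat_def zero_less_mult_iff)
qed

lemma box_bump_tendsto: "(\<lambda>m. box_bump a b m x) \<longlonglongrightarrow> indicator (box a b) x"
proof -
  have "(\<lambda>m. box_bump a b m x) \<longlonglongrightarrow> (\<Prod>j\<in>UNIV. (if x $ j - a $ j > 0 then 1 else 0) * (if b $ j - x $ j > 0 then 1 else 0))"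
    unfolding box_bump_def by (intro tendsto_prod tendsto_mult flat_0_scale_tendsto)
  also have "(\<Prod>j\<in>UNIV. (if x $ j - a $ j > 0 then 1 else 0) * (if b $ j - x $ j > 0 then 1 else 0)) = (indicator (box a b) x :: real)"
  proof (cases "x \<in> box a b")
    case False
    then obtain j where "\<not> (a $ j < x $ j \<and> x $ j < b $ j)" by (auto simp: mem_box_cart)
    then have "(\<Prod>j\<in>UNIV. (if x $ j - a $ j > 0 then 1 else 0) * (if b $ j - x $ j > 0 then 1 else 0)) = (0::real)"
      by (intro prod_zero) (auto intro!: bexI[of _ j])
    then show ?thesis using False by simp
  qed (auto simp: mem_box_cart)
  finally show ?thesis .
qed

subsection \<open>The fundamental lemma of the calculus of variations\<close>

text \<open>Open boxes generate the Borel sets and are stable under intersection, so vanishing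
  integrals spread from boxes to all Borel sets by a Dynkin argument. Testing with the sets where
  the function is positive or negative finishes the proof.\<close>

lemma integral_zero_on_boxes_AE:
  fixes H :: "real^'n::finite \<Rightarrow> real"
  assumes H: "integrable lebesgue H" and supp: "\<And>x. x \<notin> box c d \<Longrightarrow> H x = 0"
    and boxes: "\<And>a b. (LINT x:box a b|lebesgue. H x) = 0"
  shows "AE x in lebesgue. H x = 0"
proof -
  have setint: "set_integrable lebesgue A H" if "A \<in> sets borel" for A
    unfolding set_integrable_def by (rule integrable_mult_indicator[OF _ H]) (use that in simp)
  have UN: "(LINT x:UNIV|lebesgue. H x) = 0"
  proof -
    have "(LINT x:UNIV|lebesgue. H x) = (LINT x:box c d|lebesgue. H x)"
      unfolding set_lebesgue_integral_def
      using supp by (intro Bochner_Integration.integral_cong refl) (auto simp: indicator_def)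
    then show ?thesis by (simp add: boxes)
  qed
  have zero: "(LINT x:A|lebesgue. H x) = 0" if "A \<in> sets borel" for A
  proof -
    let ?E = "range (\<lambda>(a, b). box a b :: (real^'n) set)"
    have "A \<in> sigma_sets UNIV ?E" using that by (simp add: borel_eq_box)
    have Estable: "Int_stable ?E" by (auto simp: Int_stable_def box_Int_box)
    have Esub: "?E \<subseteq> Pow UNIV" by simp
    show ?thesis
    proof (rule sigma_sets_induct_disjoint[OF Estable Esub \<open>A \<in> sigma_sets UNIV ?E\<close>])
      fix A :: "(real^'n) set" assume "A \<in> ?E"
      then show "(LINT x:A|lebesgue. H x) = 0" using boxes by auto
    next
      show "(LINT x:{}|lebesgue. H x) = 0" by (simp add: set_lebesgue_integral_def)
    next
      fix A :: "(real^'n) set" assume A: "A \<in> sigma_sets UNIV ?E" "(LINT x:A|lebesgue. H x) = 0"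
      then have "A \<in> sets borel" by (simp add: borel_eq_box)
      then have "(LINT x:A \<union> (UNIV - A)|lebesgue. H x) = (LINT x:A|lebesgue. H x) + (LINT x:UNIV - A|lebesgue. H x)"
        by (intro set_integral_Un setint) auto
      also have "A \<union> (UNIV - A) = UNIV" by auto
      finally show "(LINT x:UNIV - A|lebesgue. H x) = 0" using A UN by simp
    next
      fix A :: "nat \<Rightarrow> (real^'n) set"
      assume A: "disjoint_family A" "range A \<subseteq> sigma_sets UNIV ?E" "\<And>i. (LINT x:A i|lebesgue. H x) = 0"
      then have b: "A i \<in> sets borel" for i by (auto simp: borel_eq_box)
      have "(LINT x:(\<Union>i. A i)|lebesgue. H x) = (\<Sum>i. (LINT x:A i|lebesgue. H x))"
        by (rule lebesgue_integral_countable_add) (use A(1) b setint in \<open>auto simp: disjoint_family_on_def\<close>)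
      then show "(LINT x:(\<Union>i. A i)|lebesgue. H x) = 0" using A by simp
    qed
  qed
  \<comment> \<open>\<open>H\<close> is only Lebesgue measurable, so its sign sets need not be
    Borel, while vanishing integrals are known on Borel sets only. A Borel representative has Borel
    sign sets.\<close>
  obtain H' where H': "H' \<in> borel_measurable lborel" and eq: "AE x in lborel. H x = H' x"
    using completion_ex_borel_measurable_real[of H lborel] H by auto
  have [measurable]: "H' \<in> borel_measurable borel" using H' by simp
  have eq': "AE x in lebesgue. H x = H' x" using eq by (rule AE_completion)
  have [measurable]: "H \<in> borel_measurable lebesgue" using H by auto
  have [measurable]: "H' \<in> borel_measurable lebesgue" using H' by (rule measurable_completion)
  have intH': "integrable lebesgue H'"
    using H eq' by (subst integrable_cong_AE[of H' _ H]) auto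
  \<comment> \<open>The values \<open>1\<close> and \<open>-1\<close> of \<open>s\<close> treat the
    positive and the negative part.\<close>
  have part: "AE x in lebesgue. indicator {x. 0 < s * H' x} x * (s * H' x) = 0" for s :: real
  proof -
    let ?A = "{x. 0 < s * H' x}"
    have A: "?A \<in> sets borel" by measurable
    have A': "?A \<in> sets lebesgue" using A by simp
    have int: "integrable lebesgue (\<lambda>x. indicator ?A x * (s * H' x))"
      using integrable_mult_indicator[OF A', of "\<lambda>x. s * H' x"] intH' by simp
    have "integral\<^sup>L lebesgue (\<lambda>x. indicator ?A x * (s * H' x))
        = s * integral\<^sup>L lebesgue (\<lambda>x. indicator ?A x * H' x)"
      by (simp add: mult.left_commute)
    also have "integral\<^sup>L lebesgue (\<lambda>x. indicator ?A x * H' x) = integral\<^sup>L lebesgue (\<lambda>x. indicator ?A x * H x)"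
      using eq' A' by (intro integral_cong_AE) (auto elim!: eventually_mono)
    also have "\<dots> = 0" using zero[OF A] by (simp add: set_lebesgue_integral_def)
    finally have "integral\<^sup>L lebesgue (\<lambda>x. indicator ?A x * (s * H' x)) = 0" by simp
    then show ?thesis
      using integral_nonneg_eq_0_iff_AE[OF int] by (auto simp: indicator_def)
  qed
  show ?thesis
    using part[of 1] part[of "-1"] eq'
  proof eventually_elim
    case (elim x)
    then show ?case by (cases "H' x" "0::real" rule: linorder_cases) (auto simp: indicator_def)
  qed
qed

text \<open>The bumps are bounded by 1 and converge to indicators of boxes, so dominated convergence
  makes the integral of \<open>h\<close> vanish on every box whose closed box lies in
  \<open>\<Omega>\<close>. As not every box does, the conclusion is drawn locally on one such box at
  a time and then patched together.\<close>

theorem fundamental_lemma_variations: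
  fixes h :: "real^'n::finite \<Rightarrow> real"
  assumes \<Omega>: "open \<Omega>" and h: "integrable (lebesgue_on \<Omega>) h"
    and zero: "\<And>\<phi>. test_fun \<Omega> \<phi> \<Longrightarrow> integral\<^sup>L (lebesgue_on \<Omega>) (\<lambda>x. h x * \<phi> x) = 0"
  shows "AE x in lebesgue_on \<Omega>. h x = 0"
proof -
  have \<Omega>L: "\<Omega> \<in> sets lebesgue" using \<Omega> by (simp add: borel_open)
  have h': "integrable lebesgue (\<lambda>x. indicator \<Omega> x * h x)"
    using h \<Omega>L by (simp add: integrable_restrict_space)
  have [measurable]: "h \<in> borel_measurable (lebesgue_on \<Omega>)" using h by auto
  have bumpm: "box_bump a b m \<in> borel_measurable (lebesgue_on \<Omega>)" if "cbox a b \<subseteq> \<Omega>" for a b m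
    using L2_measurable[OF L2_test_fun(1)[OF \<Omega>L box_bump_test_fun[OF that]]] .
  have boxes: "integral\<^sup>L lebesgue (\<lambda>x. indicator (box a b) x * h x) = 0" if ab: "cbox a b \<subseteq> \<Omega>" for a b
  proof -
    have "(\<lambda>m. integral\<^sup>L (lebesgue_on \<Omega>) (\<lambda>x. h x * box_bump a b m x))
        \<longlonglongrightarrow> integral\<^sup>L (lebesgue_on \<Omega>) (\<lambda>x. h x * indicator (box a b) x)"
    proof (rule integral_dominated_convergence[where w = "\<lambda>x. \<bar>h x\<bar>"])
      show "AE x in lebesgue_on \<Omega>. (\<lambda>m. h x * box_bump a b m x) \<longlonglongrightarrow> h x * indicator (box a b) x"
        by (intro AE_I2 tendsto_intros box_bump_tendsto)
      show "AE x in lebesgue_on \<Omega>. norm (h x * box_bump a b m x) \<le> \<bar>h x\<bar>" for m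
        by (intro AE_I2) (simp add: abs_mult mult_left_le box_bump_bounded)
      show "(\<lambda>x. h x * box_bump a b m x) \<in> borel_measurable (lebesgue_on \<Omega>)" for m
        using bumpm[OF ab] by simp
      have "indicat_real (box a b) \<in> borel_measurable lebesgue"
        by (intro borel_measurable_indicator fmeasurableD lmeasurable_box)
      then have "indicat_real (box a b) \<in> borel_measurable (lebesgue_on \<Omega>)"
        by (rule measurable_restrict_space1)
      then show "(\<lambda>x. h x * indicator (box a b) x) \<in> borel_measurable (lebesgue_on \<Omega>)" by simp
    qed (use h in simp)
    then have "integral\<^sup>L (lebesgue_on \<Omega>) (\<lambda>x. h x * indicator (box a b) x) = 0"
      using zero[OF box_bump_test_fun[OF ab]] by (simp add: LIMSEQ_const_iff)
    moreover have "indicator \<Omega> x * (h x * indicator (box a b) x) = indicator (box a b) x * h x" for x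
      using ab box_subset_cbox[of a b] by (auto simp: indicator_def)
    ultimately show ?thesis using \<Omega>L by (simp add: integral_restrict_space)
  qed
  have local: "AE x in lebesgue. x \<in> box c d \<longrightarrow> h x = 0" if cd: "cbox c d \<subseteq> \<Omega>" for c d
  proof -
    have "AE x in lebesgue. indicator (box c d) x * h x = 0"
    proof (rule integral_zero_on_boxes_AE[of _ c d])
      have "integrable lebesgue (\<lambda>x. indicator (box c d) x *\<^sub>R (indicator \<Omega> x * h x))"
        by (rule integrable_mult_indicator[OF _ h']) simp
      moreover have "(\<lambda>x. indicator (box c d) x *\<^sub>R (indicator \<Omega> x * h x)) = (\<lambda>x. indicator (box c d) x * h x)"
        using cd box_subset_cbox[of c d] by (auto simp: indicator_def fun_eq_iff)
      ultimately show "integrable lebesgue (\<lambda>x. indicator (box c d) x * h x)" by (simp only:)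
      fix a b
      obtain a' b' where ab: "box a b \<inter> box c d = box a' b'"
        using box_Int_box[of a b c d] by blast
      \<comment> \<open>Bumps require the closed box to lie in \<open>\<Omega>\<close>. For a
        nonempty intersection it is the closure of the open one, hence contained in
        \<open>cbox c d\<close>; an empty one contributes nothing.\<close>
      have "box a' b' = {} \<or> cbox a' b' \<subseteq> cbox c d"
        using ab closure_box[of a' b'] closure_mono[of "box a' b'" "cbox c d"] box_subset_cbox[of c d]
        by (metis Int_lower2 closed_cbox closure_closed order_trans)
      then have "integral\<^sup>L lebesgue (\<lambda>x. indicator (box a' b') x * h x) = 0"
        using boxes[of a' b'] cd by auto
      moreover have "(\<lambda>x. indicator (box a b) x *\<^sub>R (indicator (box c d) x * h x)) = (\<lambda>x. indicator (box a' b') x * h x)"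
        unfolding ab[symmetric] by (auto simp: indicator_def)
      ultimately show "(LINT x:box a b|lebesgue. indicator (box c d) x * h x) = 0"
        by (simp only: set_lebesgue_integral_def)
    qed simp
    then show ?thesis by eventually_elim (auto simp: indicator_def)
  qed
  \<comment> \<open>Lindelof: countably many boxes suffice to cover \<open>\<Omega>\<close>, so the
    union of their exceptional sets is still null.\<close>
  define \<F> where "\<F> = {box c d | c d. cbox c d \<subseteq> \<Omega>}"
  obtain \<F>' where \<F>': "\<F>' \<subseteq> \<F>" "countable \<F>'" "\<Union>\<F>' = \<Union>\<F>"
    using Lindelof[of \<F>] by (auto simp: \<F>_def open_box)
  have "AE x in lebesgue. \<forall>S\<in>\<F>'. x \<in> S \<longrightarrow> h x = 0"
    unfolding AE_ball_countable[OF \<F>'(2)]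
  proof
    fix S assume "S \<in> \<F>'"
    then obtain c d where "S = box c d" "cbox c d \<subseteq> \<Omega>" using \<F>'(1) unfolding \<F>_def by blast
    then show "AE x in lebesgue. x \<in> S \<longrightarrow> h x = 0" using local by simp
  qed
  moreover have "\<Omega> \<subseteq> \<Union>\<F>"
  proof
    fix x assume "x \<in> \<Omega>"
    then obtain c d where "x \<in> box c d" "cbox c d \<subseteq> \<Omega>"
      using open_contains_cbox[of \<Omega> x] \<Omega> by metis
    then show "x \<in> \<Union>\<F>" by (auto simp: \<F>_def)
  qed
  ultimately have "AE x in lebesgue. x \<in> \<Omega> \<longrightarrow> h x = 0"
    using \<F>'(3) by (auto elim!: eventually_mono)
  then show ?thesis using \<Omega>L by (simp add: AE_restrict_space_iff)
qed

subsection \<open>Weak gradients\<close>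

text \<open>Each component of the difference integrates to zero against all test functions. The
  components are only known to be integrable; their products with a test function are integrable
  because the latter is bounded.\<close>

lemma weak_grad_unique:
  assumes \<Omega>: "open \<Omega>" and g: "is_weak_grad \<Omega> y g" "is_weak_grad \<Omega> y g'"
  shows "AE x in lebesgue_on \<Omega>. g x = g' x"
proof -
  have \<Omega>L: "\<Omega> \<in> sets lebesgue" using \<Omega> by (simp add: borel_open)
  have int: "integrable (lebesgue_on \<Omega>) (\<lambda>x. f x $ i)" if "is_weak_grad \<Omega> y f" for f i
    using that \<Omega>L by (simp add: is_weak_grad_def set_integrable_def integrable_restrict_space)
  have "AE x in lebesgue_on \<Omega>. g x $ i - g' x $ i = 0" for i
  proof (rule fundamental_lemma_variations[OF \<Omega>])
    show "integrable (lebesgue_on \<Omega>) (\<lambda>x. g x $ i - g' x $ i)"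
      using int[OF g(1)] int[OF g(2)] by simp
    fix \<phi> assume \<phi>: "test_fun \<Omega> \<phi>"
    obtain K where K: "compact K" "K \<subseteq> \<Omega>" "\<And>x. x \<notin> K \<Longrightarrow> \<phi> x = 0"
      using test_fun_support[OF \<phi>] by metis
    have c: "continuous_on UNIV \<phi>" using smooth_continuous[OF test_fun_smooth[OF \<phi>]] .
    have "bounded (\<phi> ` K)"
      using K(1) c by (intro compact_imp_bounded compact_continuous_image) (auto intro: continuous_on_subset)
    then obtain B where B: "\<And>x. x \<in> K \<Longrightarrow> \<bar>\<phi> x\<bar> \<le> B" by (auto simp: bounded_iff)
    have [measurable]: "\<phi> \<in> borel_measurable (lebesgue_on \<Omega>)"
      using L2_measurable[OF L2_test_fun(1)[OF \<Omega>L \<phi>]] .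
    have mint: "integrable (lebesgue_on \<Omega>) (\<lambda>x. f x $ i * \<phi> x)" if "is_weak_grad \<Omega> y f" for f
    proof (rule Bochner_Integration.integrable_bound)
      show "integrable (lebesgue_on \<Omega>) (\<lambda>x. max B 0 * (f x $ i))" using int[OF that] by simp
      have [measurable]: "(\<lambda>x. f x $ i) \<in> borel_measurable (lebesgue_on \<Omega>)"
        using int[OF that] by blast
      show "(\<lambda>x. f x $ i * \<phi> x) \<in> borel_measurable (lebesgue_on \<Omega>)" by measurable
      have "\<bar>\<phi> x\<bar> \<le> max B 0" for x using B[of x] K(3)[of x] by (cases "x \<in> K") auto
      then show "AE x in lebesgue_on \<Omega>. norm (f x $ i * \<phi> x) \<le> norm (max B 0 * (f x $ i))"
        by (auto simp: abs_mult mult.commute[of "\<bar>f _ $ i\<bar>"] intro!: mult_right_mono)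
    qed
    have "integral\<^sup>L (lebesgue_on \<Omega>) (\<lambda>x. g x $ i * \<phi> x) = integral\<^sup>L (lebesgue_on \<Omega>) (\<lambda>x. g' x $ i * \<phi> x)"
    proof -
      have "integral\<^sup>L (lebesgue_on \<Omega>) (\<lambda>x. y x * partial i \<phi> x) = - integral\<^sup>L (lebesgue_on \<Omega>) (\<lambda>x. f x $ i * \<phi> x)"
        if "is_weak_grad \<Omega> y f" for f
        using that \<phi> by (simp add: is_weak_grad_def)
      from this[OF g(1)] this[OF g(2)] show ?thesis by simp
    qed
    then show "integral\<^sup>L (lebesgue_on \<Omega>) (\<lambda>x. (g x $ i - g' x $ i) * \<phi> x) = 0"
      using mint[OF g(1)] mint[OF g(2)] by (simp add: left_diff_distrib)
  qed
  then have "AE x in lebesgue_on \<Omega>. \<forall>i. g x $ i - g' x $ i = 0" by (simp add: AE_all_countable)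
  then show ?thesis by eventually_elim (simp add: vec_eq_iff)
qed

lemma is_weak_grad_weak_grad: "is_weak_grad \<Omega> y g \<Longrightarrow> is_weak_grad \<Omega> y (weak_grad \<Omega> y)"
  unfolding weak_grad_def by (rule someI[of "is_weak_grad \<Omega> y"])

lemma weak_grad_AE_eq:
  assumes "open \<Omega>" "is_weak_grad \<Omega> y g"
  shows "AE x in lebesgue_on \<Omega>. weak_grad \<Omega> y x = g x"
  using weak_grad_unique[OF assms(1) is_weak_grad_weak_grad[OF assms(2)] assms(2)] .

subsection \<open>Jets of Sobolev functions\<close>

lemma L2_sum: "(\<And>i. i \<in> I \<Longrightarrow> L2 \<Omega> (f i)) \<Longrightarrow> L2 \<Omega> (\<lambda>x. \<Sum>i\<in>I. f i x)"
  by (induction I rule: infinite_finite_induct) (auto intro: L2_add)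

lemma L2_fst:
  assumes "L2 \<Omega> U"
  shows "L2 \<Omega> (\<lambda>x. fst (U x))"
proof (rule L2_dominated[OF assms, of _ 1])
  show "(\<lambda>x. fst (U x)) \<in> borel_measurable (lebesgue_on \<Omega>)"
    using L2_measurable[OF assms]
    by (rule measurable_compose) (intro borel_measurable_continuous_onI continuous_intros)
  have "norm (fst p) \<le> norm p" for p :: "'b \<times> 'c"
    using norm_fst_le[of "fst p" "snd p"] by simp
  then show "AE x in lebesgue_on \<Omega>. norm (fst (U x)) \<le> 1 * norm (U x)" by simp
qed

lemma L2_snd:
  assumes "L2 \<Omega> U"
  shows "L2 \<Omega> (\<lambda>x. snd (U x))"
proof (rule L2_dominated[OF assms, of _ 1])
  show "(\<lambda>x. snd (U x)) \<in> borel_measurable (lebesgue_on \<Omega>)"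
    using L2_measurable[OF assms]
    by (rule measurable_compose) (intro borel_measurable_continuous_onI continuous_intros)
  have "norm (snd p) \<le> norm p" for p :: "'b \<times> 'c"
    using norm_snd_le[of "snd p" "fst p"] by simp
  then show "AE x in lebesgue_on \<Omega>. norm (snd (U x)) \<le> 1 * norm (U x)" by simp
qed

lemma L2_Pair:
  assumes "L2 \<Omega> f" "L2 \<Omega> g"
  shows "L2 \<Omega> (\<lambda>x. (f x, g x))"
  unfolding L2_def
proof
  show "(\<lambda>x. (f x, g x)) \<in> borel_measurable (lebesgue_on \<Omega>)"
    using assms by (intro borel_measurable_Pair L2_measurable)
  show "integrable (lebesgue_on \<Omega>) (\<lambda>x. (norm (f x, g x))\<^sup>2)"
    using assms by (simp add: norm_Pair L2_norm_square_integrable)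
qed

lemma L2inner_Pair:
  assumes "L2 \<Omega> f" "L2 \<Omega> g" "L2 \<Omega> h" "L2 \<Omega> k"
  shows "L2inner \<Omega> (\<lambda>x. (f x, g x)) (\<lambda>x. (h x, k x)) = L2inner \<Omega> f h + L2inner \<Omega> g k"
  using assms by (simp add: L2inner_def L2_inner_integrable)

lemma L2norm_Pair:
  assumes "L2 \<Omega> f" "L2 \<Omega> g"
  shows "(L2norm \<Omega> (\<lambda>x. (f x, g x)))\<^sup>2 = (L2norm \<Omega> f)\<^sup>2 + (L2norm \<Omega> g)\<^sup>2"
  using assms by (simp add: L2norm_square L2inner_Pair)

definition jet :: "(real^'n::finite) set \<Rightarrow> (real^'n \<Rightarrow> real) \<Rightarrow> real^'n \<Rightarrow> real \<times> (real^'n)" where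
  "jet \<Omega> y x = (y x, weak_grad \<Omega> y x)"

text \<open>Uses the classical gradient, so linearity holds at every point; for \<open>jet\<close>,
  whose gradient is chosen, it holds almost everywhere only.\<close>

definition test_jet :: "(real^'n::finite \<Rightarrow> real) \<Rightarrow> real^'n \<Rightarrow> real \<times> (real^'n)" where
  "test_jet \<phi> x = (\<phi> x, grad \<phi> x)"

text \<open>The mean square closure of the test jets. No weak gradient occurs, so this closure can
  be handled before its elements are recognised as jets of functions.\<close>

definition is_H01_jet :: "(real^'n::finite) set \<Rightarrow> (real^'n \<Rightarrow> real \<times> (real^'n)) \<Rightarrow> bool" where
  "is_H01_jet \<Omega> U \<longleftrightarrow> L2 \<Omega> U \<and>
     (\<exists>\<phi>. (\<forall>k. test_fun \<Omega> (\<phi> k)) \<and> (\<lambda>k. L2norm \<Omega> (\<lambda>x. test_jet (\<phi> k) x - U x)) \<longlonglongrightarrow> 0)"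

lemma test_jet_add_mult:
  assumes "test_fun \<Omega> \<phi>" "test_fun \<Omega> \<psi>"
  shows "test_jet (\<lambda>x. \<phi> x + c * \<psi> x) x = test_jet \<phi> x + c *\<^sub>R test_jet \<psi> x"
  using assms by (simp add: test_jet_def grad_add_mult test_fun_smooth)

lemma L2_test_jet: "\<Omega> \<in> sets lebesgue \<Longrightarrow> test_fun \<Omega> \<phi> \<Longrightarrow> L2 \<Omega> (test_jet \<phi>)"
  unfolding test_jet_def[abs_def] by (intro L2_Pair L2_test_fun)

lemma is_H01_jet_L2: "is_H01_jet \<Omega> U \<Longrightarrow> L2 \<Omega> U"
  by (simp add: is_H01_jet_def)

lemma is_H01_jet_add_scaleR:
  assumes \<Omega>: "\<Omega> \<in> sets lebesgue" and UV: "is_H01_jet \<Omega> U" "is_H01_jet \<Omega> V"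
  shows "is_H01_jet \<Omega> (\<lambda>x. U x + c *\<^sub>R V x)"
proof -
  obtain \<phi> where \<phi>: "\<And>k. test_fun \<Omega> (\<phi> k)" "(\<lambda>k. L2norm \<Omega> (\<lambda>x. test_jet (\<phi> k) x - U x)) \<longlonglongrightarrow> 0"
    using UV(1) by (auto simp: is_H01_jet_def)
  obtain \<psi> where \<psi>: "\<And>k. test_fun \<Omega> (\<psi> k)" "(\<lambda>k. L2norm \<Omega> (\<lambda>x. test_jet (\<psi> k) x - V x)) \<longlonglongrightarrow> 0"
    using UV(2) by (auto simp: is_H01_jet_def)
  note L2 = is_H01_jet_L2[OF UV(1)] is_H01_jet_L2[OF UV(2)] L2_test_jet[OF \<Omega> \<phi>(1)] L2_test_jet[OF \<Omega> \<psi>(1)]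
  have "(\<lambda>k. L2norm \<Omega> (\<lambda>x. test_jet (\<lambda>x. \<phi> k x + c * \<psi> k x) x - (U x + c *\<^sub>R V x))) \<longlonglongrightarrow> 0"
  proof (rule Lim_null_comparison)
    show "\<forall>\<^sub>F k in sequentially. norm (L2norm \<Omega> (\<lambda>x. test_jet (\<lambda>x. \<phi> k x + c * \<psi> k x) x - (U x + c *\<^sub>R V x)))
        \<le> L2norm \<Omega> (\<lambda>x. test_jet (\<phi> k) x - U x) + \<bar>c\<bar> * L2norm \<Omega> (\<lambda>x. test_jet (\<psi> k) x - V x)"
    proof (rule always_eventually, rule allI)
      fix k
      have "(\<lambda>x. test_jet (\<lambda>x. \<phi> k x + c * \<psi> k x) x - (U x + c *\<^sub>R V x))
          = (\<lambda>x. (test_jet (\<phi> k) x - U x) + c *\<^sub>R (test_jet (\<psi> k) x - V x))"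
        by (rule ext) (simp add: test_jet_add_mult[OF \<phi>(1) \<psi>(1)] algebra_simps)
      then show "norm (L2norm \<Omega> (\<lambda>x. test_jet (\<lambda>x. \<phi> k x + c * \<psi> k x) x - (U x + c *\<^sub>R V x)))
        \<le> L2norm \<Omega> (\<lambda>x. test_jet (\<phi> k) x - U x) + \<bar>c\<bar> * L2norm \<Omega> (\<lambda>x. test_jet (\<psi> k) x - V x)"
        using L2norm_triangle[of \<Omega> "\<lambda>x. test_jet (\<phi> k) x - U x" "\<lambda>x. c *\<^sub>R (test_jet (\<psi> k) x - V x)"]
        by (simp add: L2 L2_diff L2_scaleR L2norm_scaleR)
    qed
    have "(\<lambda>k. L2norm \<Omega> (\<lambda>x. test_jet (\<phi> k) x - U x) + \<bar>c\<bar> * L2norm \<Omega> (\<lambda>x. test_jet (\<psi> k) x - V x)) \<longlonglongrightarrow> 0 + \<bar>c\<bar> * 0"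
      by (intro tendsto_intros \<phi> \<psi>)
    then show "(\<lambda>k. L2norm \<Omega> (\<lambda>x. test_jet (\<phi> k) x - U x) + \<bar>c\<bar> * L2norm \<Omega> (\<lambda>x. test_jet (\<psi> k) x - V x)) \<longlonglongrightarrow> 0"
      by simp
  qed
  then show ?thesis
    unfolding is_H01_jet_def using L2 test_fun_add_mult[OF \<phi>(1) \<psi>(1)]
    by (intro conjI L2_add L2_scaleR exI[of _ "\<lambda>k x. \<phi> k x + c * \<psi> k x"]) auto
qed

text \<open>Pairing with a fixed square integrable field is continuous in mean square, so an
  identity tested on test functions extends to their closure.\<close>

lemma L2inner_zero_on_H01_jets:
  assumes \<Omega>: "\<Omega> \<in> sets lebesgue" and F: "L2 \<Omega> F"
    and zero: "\<And>\<phi>. test_fun \<Omega> \<phi> \<Longrightarrow> L2inner \<Omega> F (test_jet \<phi>) = 0" and U: "is_H01_jet \<Omega> U"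
  shows "L2inner \<Omega> F U = 0"
proof -
  obtain \<phi> where \<phi>: "\<And>k. test_fun \<Omega> (\<phi> k)" "(\<lambda>k. L2norm \<Omega> (\<lambda>x. test_jet (\<phi> k) x - U x)) \<longlonglongrightarrow> 0"
    using U by (auto simp: is_H01_jet_def)
  have "(\<lambda>k. L2inner \<Omega> F (test_jet (\<phi> k))) \<longlonglongrightarrow> L2inner \<Omega> F U"
    by (rule L2inner_tendsto[OF L2_test_jet[OF \<Omega> \<phi>(1)] is_H01_jet_L2[OF U] F \<phi>(2)])
  then show ?thesis using zero[OF \<phi>(1)] by (simp add: LIMSEQ_const_iff)
qed

lemma jet_test_fun_AE:
  assumes "open \<Omega>" "bounded \<Omega>" "test_fun \<Omega> \<phi>"
  shows "AE x in lebesgue_on \<Omega>. jet \<Omega> \<phi> x = test_jet \<phi> x"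
proof -
  have "\<Omega> \<in> lmeasurable" using assms by (simp add: lmeasurable_open)
  from weak_grad_AE_eq[OF assms(1) is_weak_grad_test_fun[OF this assms(3)]]
  show ?thesis by eventually_elim (simp add: jet_def test_jet_def)
qed

text \<open>For a chosen gradient even measurability has to be recovered: it comes from the
  integrability of the components demanded by \<open>is_weak_grad\<close>, and the size from
  agreement with \<open>g\<close> almost everywhere.\<close>

lemma L2_weak_grad:
  fixes \<Omega> :: "(real^'n::finite) set"
  assumes \<Omega>: "open \<Omega>" and g: "is_weak_grad \<Omega> y g" "L2 \<Omega> g"
  shows "L2 \<Omega> (weak_grad \<Omega> y)"
proof (rule L2_dominated[OF g(2), of _ 1])
  have \<Omega>m: "\<Omega> \<in> sets lebesgue" using \<Omega> by (simp add: borel_open)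
  have "integrable (lebesgue_on \<Omega>) (\<lambda>x. weak_grad \<Omega> y x $ i)" for i
    using is_weak_grad_weak_grad[OF g(1)] \<Omega>m
    by (simp add: is_weak_grad_def set_integrable_def integrable_restrict_space)
  then have "(\<lambda>x. \<Sum>i\<in>UNIV. (weak_grad \<Omega> y x $ i) *\<^sub>R (axis i 1 :: real^'n)) \<in> borel_measurable (lebesgue_on \<Omega>)"
    by (intro borel_measurable_sum borel_measurable_scaleR borel_measurable_integrable borel_measurable_const)
  moreover have "(\<Sum>i\<in>UNIV. (v $ i) *\<^sub>R axis i 1) = v" for v :: "real^'n"
    using basis_expansion[of v] by (simp add: scalar_mult_eq_scaleR)
  ultimately show "weak_grad \<Omega> y \<in> borel_measurable (lebesgue_on \<Omega>)" by simp
  show "AE x in lebesgue_on \<Omega>. norm (weak_grad \<Omega> y x) \<le> 1 * norm (g x)"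
    using weak_grad_AE_eq[OF \<Omega> g(1)] by eventually_elim simp
qed

lemma L2_jet:
  assumes "open \<Omega>" "L2 \<Omega> y" "is_weak_grad \<Omega> y g" "L2 \<Omega> g"
  shows "L2 \<Omega> (jet \<Omega> y)"
  unfolding jet_def[abs_def] using assms by (intro L2_Pair L2_weak_grad)

lemma L2_jet_test_fun:
  assumes "open \<Omega>" "bounded \<Omega>" "test_fun \<Omega> \<phi>"
  shows "L2 \<Omega> (jet \<Omega> \<phi>)"
proof -
  have \<Omega>: "\<Omega> \<in> lmeasurable" using assms by (simp add: lmeasurable_open)
  note L = L2_test_fun[OF fmeasurableD[OF \<Omega>] assms(3)]
  show ?thesis by (rule L2_jet[OF assms(1) L(1) is_weak_grad_test_fun[OF \<Omega> assms(3)] L(2)])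
qed

lemma L2norm_jet_diff:
  assumes "L2 \<Omega> (jet \<Omega> y)" "L2 \<Omega> (jet \<Omega> z)"
  shows "(L2norm \<Omega> (\<lambda>x. jet \<Omega> y x - jet \<Omega> z x))\<^sup>2
      = (L2norm \<Omega> (\<lambda>x. y x - z x))\<^sup>2 + (L2norm \<Omega> (\<lambda>x. weak_grad \<Omega> y x - weak_grad \<Omega> z x))\<^sup>2"
proof -
  have d: "(\<lambda>x. jet \<Omega> y x - jet \<Omega> z x) = (\<lambda>x. (y x - z x, weak_grad \<Omega> y x - weak_grad \<Omega> z x))"
    by (simp add: jet_def)
  show ?thesis
    unfolding d using L2_fst[OF L2_diff[OF assms]] L2_snd[OF L2_diff[OF assms]]
    by (intro L2norm_Pair) (simp_all add: jet_def)
qed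

text \<open>The right-hand side is the distance used in \<open>H01\<close>, with the chosen gradient
  of the test function; the left-hand side has the classical one. This is the bridge between
  \<open>H01\<close> and \<open>is_H01_jet\<close>.\<close>

lemma L2norm_test_jet_diff:
  assumes \<Omega>: "open \<Omega>" "bounded \<Omega>" and \<phi>: "test_fun \<Omega> \<phi>" and y: "L2 \<Omega> (jet \<Omega> y)"
  shows "(L2norm \<Omega> (\<lambda>x. test_jet \<phi> x - jet \<Omega> y x))\<^sup>2
      = (L2norm \<Omega> (\<lambda>x. \<phi> x - y x))\<^sup>2 + (L2norm \<Omega> (\<lambda>x. weak_grad \<Omega> \<phi> x - weak_grad \<Omega> y x))\<^sup>2"
proof -
  have \<Omega>m: "\<Omega> \<in> sets lebesgue" using \<Omega> by (simp add: borel_open)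
  note L = L2_jet_test_fun[OF \<Omega> \<phi>]
  have "L2norm \<Omega> (\<lambda>x. jet \<Omega> \<phi> x - jet \<Omega> y x) = L2norm \<Omega> (\<lambda>x. test_jet \<phi> x - jet \<Omega> y x)"
  proof (rule L2norm_cong_AE)
    show "AE x in lebesgue_on \<Omega>. jet \<Omega> \<phi> x - jet \<Omega> y x = test_jet \<phi> x - jet \<Omega> y x"
      using jet_test_fun_AE[OF \<Omega> \<phi>] by eventually_elim simp
  qed (intro L2_diff L y L2_test_jet \<phi> \<Omega>m)+
  then show ?thesis using L2norm_jet_diff[OF L y] by simp
qed

lemma H01_imp_L2_jet: "H01 \<Omega> y \<Longrightarrow> L2 \<Omega> (jet \<Omega> y)"
  unfolding jet_def[abs_def] H01_def H1_def by (auto intro: L2_Pair)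

lemma H01_imp_is_H01_jet:
  assumes \<Omega>: "open \<Omega>" "bounded \<Omega>" and y: "H01 \<Omega> y"
  shows "is_H01_jet \<Omega> (jet \<Omega> y)"
proof -
  obtain \<phi> where \<phi>: "\<And>k. test_fun \<Omega> (\<phi> k)" and lim: "(\<lambda>k. (L2norm \<Omega> (\<lambda>x. \<phi> k x - y x))\<^sup>2 +
      (L2norm \<Omega> (\<lambda>x. weak_grad \<Omega> (\<phi> k) x - weak_grad \<Omega> y x))\<^sup>2) \<longlonglongrightarrow> 0"
    using y by (auto simp: H01_def)
  have \<Omega>m: "\<Omega> \<in> sets lebesgue" using \<Omega> by (simp add: borel_open)
  note L2y = H01_imp_L2_jet[OF y]
  from lim have "(\<lambda>k. (L2norm \<Omega> (\<lambda>x. test_jet (\<phi> k) x - jet \<Omega> y x))\<^sup>2) \<longlonglongrightarrow> 0"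
    by (simp add: L2norm_test_jet_diff[OF \<Omega> \<phi> L2y])
  then have "(\<lambda>k. L2norm \<Omega> (\<lambda>x. test_jet (\<phi> k) x - jet \<Omega> y x)) \<longlonglongrightarrow> 0"
    using tendsto_real_sqrt by fastforce
  then show ?thesis unfolding is_H01_jet_def using L2y \<phi> by blast
qed

text \<open>The defining identity of the weak gradient says that jets are orthogonal to the fields
  \<open>(\<partial>\<^sub>i \<psi>, \<psi> e\<^sub>i)\<close>, so it passes to limits in mean square.\<close>
lemma is_H01_jet_imp_weak_grad:
  assumes \<Omega>: "open \<Omega>" "bounded \<Omega>" and U: "is_H01_jet \<Omega> U"
  shows "is_weak_grad \<Omega> (\<lambda>x. fst (U x)) (\<lambda>x. snd (U x))"
proof -
  have \<Omega>l: "\<Omega> \<in> lmeasurable" using \<Omega> by (simp add: lmeasurable_open)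
  note \<Omega>m = fmeasurableD[OF \<Omega>l]
  note L2U = is_H01_jet_L2[OF U]
  show ?thesis
  proof (rule is_weak_grad_L2I[OF \<Omega>l L2_fst[OF L2U] L2_snd[OF L2U]])
    fix \<psi> i assume \<psi>: "test_fun \<Omega> \<psi>"
    note L = L2_test_fun[OF \<Omega>m \<psi>]
    have L1: "L2 \<Omega> (partial i \<psi>)" using L2_component[OF L(2), of i] by (simp add: grad_def)
    have L2: "L2 \<Omega> (\<lambda>x. \<psi> x *\<^sub>R (axis i 1 :: real^'a))"
      by (rule L2_dominated[OF L(1), of _ 1]) (use L2_measurable[OF L(1)] in auto)
    have split: "L2inner \<Omega> (\<lambda>x. (partial i \<psi> x, \<psi> x *\<^sub>R axis i 1)) V
        = L2inner \<Omega> (\<lambda>x. fst (V x)) (partial i \<psi>) + L2inner \<Omega> (\<lambda>x. snd (V x) $ i) \<psi>" if V: "L2 \<Omega> V" for V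
    proof -
      have "L2inner \<Omega> (\<lambda>x. (partial i \<psi> x, \<psi> x *\<^sub>R axis i 1)) (\<lambda>x. (fst (V x), snd (V x)))
          = L2inner \<Omega> (partial i \<psi>) (\<lambda>x. fst (V x)) + L2inner \<Omega> (\<lambda>x. \<psi> x *\<^sub>R axis i 1) (\<lambda>x. snd (V x))"
        by (rule L2inner_Pair[OF L1 L2 L2_fst[OF V] L2_snd[OF V]])
      moreover have "L2inner \<Omega> (\<lambda>x. \<psi> x *\<^sub>R axis i 1) (\<lambda>x. snd (V x)) = L2inner \<Omega> (\<lambda>x. snd (V x) $ i) \<psi>"
        by (simp add: L2inner_def inner_axis' mult.commute)
      ultimately show ?thesis by (simp add: L2inner_commute[of \<Omega> "partial i \<psi>"])
    qed
    have "L2inner \<Omega> (\<lambda>x. (partial i \<psi> x, \<psi> x *\<^sub>R axis i 1)) U = 0"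
    proof (rule L2inner_zero_on_H01_jets[OF \<Omega>m L2_Pair[OF L1 L2] _ U])
      fix \<phi> assume \<phi>: "test_fun \<Omega> \<phi>"
      show "L2inner \<Omega> (\<lambda>x. (partial i \<psi> x, \<psi> x *\<^sub>R axis i 1)) (test_jet \<phi>) = 0"
        using integration_by_parts[OF \<Omega>m test_fun_smooth[OF \<phi>] \<psi>, of i]
        unfolding split[OF L2_test_jet[OF \<Omega>m \<phi>]] by (simp add: test_jet_def grad_def L2inner_def)
    qed
    then show "L2inner \<Omega> (\<lambda>x. fst (U x)) (partial i \<psi>) = - L2inner \<Omega> (\<lambda>x. snd (U x) $ i) \<psi>"
      by (simp add: split[OF L2U])
  qed
qed

text \<open>Completeness of \<open>H01\<close>: the second component of a limit of test jets is a
  weak gradient of the first, hence by uniqueness agrees with the chosen one almost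
  everywhere.\<close>

lemma is_H01_jet_imp_H01:
  assumes \<Omega>: "open \<Omega>" "bounded \<Omega>" and U: "is_H01_jet \<Omega> U"
  shows "AE x in lebesgue_on \<Omega>. jet \<Omega> (\<lambda>x. fst (U x)) x = U x" "H01 \<Omega> (\<lambda>x. fst (U x))"
proof -
  have \<Omega>l: "\<Omega> \<in> lmeasurable" using \<Omega> by (simp add: lmeasurable_open)
  note \<Omega>m = fmeasurableD[OF \<Omega>l]
  note L2U = is_H01_jet_L2[OF U]
  let ?y = "\<lambda>x. fst (U x)"
  note w = is_H01_jet_imp_weak_grad[OF \<Omega> U]
  show AE: "AE x in lebesgue_on \<Omega>. jet \<Omega> ?y x = U x"
    using weak_grad_AE_eq[OF \<Omega>(1) w] by eventually_elim (simp add: jet_def)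
  have L2y: "L2 \<Omega> (jet \<Omega> ?y)" by (rule L2_jet[OF \<Omega>(1) L2_fst[OF L2U] w L2_snd[OF L2U]])
  obtain \<phi> where \<phi>: "\<And>k. test_fun \<Omega> (\<phi> k)" "(\<lambda>k. L2norm \<Omega> (\<lambda>x. test_jet (\<phi> k) x - U x)) \<longlonglongrightarrow> 0"
    using U by (auto simp: is_H01_jet_def)
  have "L2norm \<Omega> (\<lambda>x. test_jet (\<phi> k) x - U x) = L2norm \<Omega> (\<lambda>x. test_jet (\<phi> k) x - jet \<Omega> ?y x)" for k
  proof (rule L2norm_cong_AE)
    show "AE x in lebesgue_on \<Omega>. test_jet (\<phi> k) x - U x = test_jet (\<phi> k) x - jet \<Omega> ?y x"
      using AE by eventually_elim simp
  qed (intro L2_diff L2y L2U L2_test_jet \<phi> \<Omega>m)+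
  with tendsto_power[OF \<phi>(2), of 2]
  have "(\<lambda>k. (L2norm \<Omega> (\<lambda>x. test_jet (\<phi> k) x - jet \<Omega> ?y x))\<^sup>2) \<longlonglongrightarrow> 0" by simp
  then have "(\<lambda>k. (L2norm \<Omega> (\<lambda>x. \<phi> k x - ?y x))\<^sup>2 +
      (L2norm \<Omega> (\<lambda>x. weak_grad \<Omega> (\<phi> k) x - weak_grad \<Omega> ?y x))\<^sup>2) \<longlonglongrightarrow> 0"
    by (simp add: L2norm_test_jet_diff[OF \<Omega> \<phi>(1) L2y])
  then show "H01 \<Omega> ?y"
    using w L2_fst[OF L2y] L2_snd[OF L2y] \<phi>(1) unfolding H01_def H1_def jet_def by auto
qed

subsection \<open>Existence of weak solutions\<close>

text \<open>The Riesz representation theorem on a space that need not be complete: a sequence minimising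
  \<open>B u u - 2 L u\<close> is Cauchy by the parallelogram law and represents \<open>L\<close> in the limit.\<close>
lemma riesz_minimizing_sequence:
  fixes B :: "('a \<Rightarrow> real) \<Rightarrow> ('a \<Rightarrow> real) \<Rightarrow> real" and L :: "('a \<Rightarrow> real) \<Rightarrow> real"
  assumes V0: "(\<lambda>x. 0) \<in> V"
    and Vlin: "\<And>u v c. u \<in> V \<Longrightarrow> v \<in> V \<Longrightarrow> (\<lambda>x. u x + c * v x) \<in> V"
    and Blin: "\<And>u v w c. u \<in> V \<Longrightarrow> v \<in> V \<Longrightarrow> w \<in> V \<Longrightarrow> B (\<lambda>x. u x + c * v x) w = B u w + c * B v w"
    and Bsym: "\<And>u v. u \<in> V \<Longrightarrow> v \<in> V \<Longrightarrow> B u v = B v u"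
    and Bpos: "\<And>u. u \<in> V \<Longrightarrow> 0 \<le> B u u"
    and Llin: "\<And>u v c. u \<in> V \<Longrightarrow> v \<in> V \<Longrightarrow> L (\<lambda>x. u x + c * v x) = L u + c * L v"
    and Lbd: "\<And>u. u \<in> V \<Longrightarrow> (L u)\<^sup>2 \<le> C * B u u" and C: "0 \<le> C"
  obtains \<phi> where "\<And>k. \<phi> k \<in> V"
    and "\<And>k l. B (\<lambda>x. \<phi> k x - \<phi> l x) (\<lambda>x. \<phi> k x - \<phi> l x) \<le> 2 / real (Suc k) + 2 / real (Suc l)"
    and "\<And>v. v \<in> V \<Longrightarrow> (\<lambda>k. B (\<phi> k) v) \<longlonglongrightarrow> L v"
proof -
  define E where "E u = B u u - 2 * L u" for u
  have Eexp: "E (\<lambda>x. u x + c * v x) = E u + 2 * c * (B u v - L v) + c\<^sup>2 * B v v"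
    if "u \<in> V" "v \<in> V" for u v c
  proof -
    have "B (\<lambda>x. u x + c * v x) (\<lambda>x. u x + c * v x) = B u (\<lambda>x. u x + c * v x) + c * B v (\<lambda>x. u x + c * v x)"
      by (rule Blin[OF that Vlin[OF that]])
    also have "B u (\<lambda>x. u x + c * v x) = B u u + c * B v u"
      using Bsym[OF that(1) Vlin[OF that]] Blin[OF that that(1)] by simp
    also have "B v (\<lambda>x. u x + c * v x) = B u v + c * B v v"
      using Bsym[OF that(2) Vlin[OF that]] Blin[OF that that(2)] by simp
    also have "B v u = B u v" by (rule Bsym[OF that(2,1)])
    finally show ?thesis by (simp add: E_def Llin[OF that] power2_eq_square algebra_simps)
  qed
  have Ebd: "- C \<le> E u" if u: "u \<in> V" for u
  proof -
    \<comment> \<open>The arithmetic-geometric mean inequality for \<open>C\<close> and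
      \<open>B u u\<close>, which bounds the energy from below by \<open>- C\<close>.\<close>
    have "4 * (C * B u u) = (C + B u u)\<^sup>2 - (C - B u u)\<^sup>2"
      by (simp add: power2_eq_square algebra_simps)
    also have "\<dots> \<le> (C + B u u)\<^sup>2" by simp
    finally have "(2 * L u)\<^sup>2 \<le> (C + B u u)\<^sup>2"
      using Lbd[OF u] by (simp add: power_mult_distrib)
    then have "2 * L u \<le> C + B u u"
      by (rule power2_le_imp_le) (use C Bpos[OF u] in simp)
    then show ?thesis by (simp add: E_def)
  qed
  define m where "m = Inf (E ` V)"
  have bdd: "bdd_below (E ` V)" using Ebd by (intro bdd_belowI[of _ "- C"]) auto
  have mle: "m \<le> E u" if "u \<in> V" for u
    unfolding m_def using that by (intro cInf_lower bdd) auto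
  have "\<exists>u\<in>V. E u < m + 1 / real (Suc k)" for k
  proof -
    have "Inf (E ` V) < m + 1 / real (Suc k)" by (simp add: m_def)
    then show ?thesis using cInf_lessD[of "E ` V"] V0 by blast
  qed
  then obtain \<phi> where \<phi>: "\<And>k. \<phi> k \<in> V" "\<And>k. E (\<phi> k) < m + 1 / real (Suc k)" by metis
  have diff: "(\<lambda>x. u x - v x) \<in> V" if "u \<in> V" "v \<in> V" for u v
    using Vlin[OF that, of "-1"] by simp
  show ?thesis
  proof (rule that[OF \<phi>(1)])
    fix k l
    let ?d = "\<lambda>x. \<phi> k x - \<phi> l x"
    have d: "?d \<in> V" by (intro diff \<phi>)
    have "E (\<phi> k) = E (\<phi> l) + 2 * (B (\<phi> l) ?d - L ?d) + B ?d ?d"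
      using Eexp[OF \<phi>(1)[of l] d, of 1] by simp
    \<comment> \<open>The energy at the midpoint of \<open>\<phi> k\<close> and
      \<open>\<phi> l\<close> is at least the infimum. Eliminating the linear term bounds
      \<open>B ?d ?d\<close> by twice the sum of the two excesses over \<open>m\<close>.\<close>
    moreover have "m \<le> E (\<phi> l) + (B (\<phi> l) ?d - L ?d) + B ?d ?d / 4"
      using Eexp[OF \<phi>(1)[of l] d, of "1/2"] mle[OF Vlin[OF \<phi>(1)[of l] d, of "1/2"]]
      by (simp add: power2_eq_square)
    ultimately show "B ?d ?d \<le> 2 / real (Suc k) + 2 / real (Suc l)"
      using \<phi>(2)[of k] \<phi>(2)[of l] by simp
  next
    fix v assume v: "v \<in> V"
    have sq: "(B (\<phi> k) v - L v)\<^sup>2 \<le> B v v * inverse (real (Suc k))" for k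
    proof -
      \<comment> \<open>The energy along the line through \<open>\<phi> k\<close> in direction
        \<open>v\<close> never falls below \<open>m\<close>; this is a nonnegative quadratic in
        \<open>t\<close> whose linear coefficient is twice the residual.\<close>
      have "(B (\<phi> k) v - L v)\<^sup>2 \<le> (E (\<phi> k) - m) * B v v"
      proof (rule psd_quadratic_discriminant[OF _ Bpos[OF v]])
        fix t
        show "0 \<le> E (\<phi> k) - m + 2 * t * (B (\<phi> k) v - L v) + t\<^sup>2 * B v v"
          using Eexp[OF \<phi>(1)[of k] v, of t] mle[OF Vlin[OF \<phi>(1)[of k] v, of t]] by simp
      qed
      also have "\<dots> \<le> inverse (real (Suc k)) * B v v"
        using \<phi>(2)[of k] Bpos[OF v] by (intro mult_right_mono) (auto simp: inverse_eq_divide)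
      finally show ?thesis by (simp add: mult.commute)
    qed
    have "(\<lambda>k. (B (\<phi> k) v - L v)\<^sup>2) \<longlonglongrightarrow> 0"
    proof (rule Lim_null_comparison)
      show "\<forall>\<^sub>F k in sequentially. norm ((B (\<phi> k) v - L v)\<^sup>2) \<le> B v v * inverse (real (Suc k))"
        using sq by simp
      show "(\<lambda>k. B v v * inverse (real (Suc k))) \<longlonglongrightarrow> 0"
        by (rule tendsto_mult_right_zero[OF LIMSEQ_inverse_real_of_nat])
    qed
    then have "(\<lambda>k. sqrt ((B (\<phi> k) v - L v)\<^sup>2)) \<longlonglongrightarrow> sqrt 0" by (rule tendsto_real_sqrt)
    then have "(\<lambda>k. B (\<phi> k) v - L v) \<longlonglongrightarrow> 0"
      by (simp add: tendsto_rabs_zero_iff)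
    then show "(\<lambda>k. B (\<phi> k) v) \<longlonglongrightarrow> L v" by (rule LIM_zero_cancel)
  qed
qed

lemma Linf_mult_L2:
  fixes f :: "'a::euclidean_space \<Rightarrow> real"
  assumes "Linf \<Omega> c" "L2 \<Omega> f"
  shows "L2 \<Omega> (\<lambda>x. c x * f x)"
proof -
  obtain C where C: "AE x in lebesgue_on \<Omega>. \<bar>c x\<bar> \<le> C" using assms(1) by (auto simp: Linf_def)
  show ?thesis
  proof (rule L2_dominated[OF assms(2), of _ C])
    show "(\<lambda>x. c x * f x) \<in> borel_measurable (lebesgue_on \<Omega>)"
      using assms L2_measurable[OF assms(2)] by (auto simp: Linf_def)
    show "AE x in lebesgue_on \<Omega>. norm (c x * f x) \<le> C * norm (f x)"
      using C by eventually_elim (simp add: abs_mult mult_right_mono)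
  qed
qed

section \<open>The elliptic form, its coercivity and the solution of variational equations\<close>

locale elliptic =
  fixes \<Omega> :: "(real^'n::finite) set" and a :: "'n \<Rightarrow> 'n \<Rightarrow> real^'n \<Rightarrow> real" and c0 :: "real^'n \<Rightarrow> real"
    and \<theta> :: real
  assumes dom: "open \<Omega>" "bounded \<Omega>"
    and coef: "\<And>i j. Linf \<Omega> (a i j)" "Linf \<Omega> c0"
    and c0_nonneg: "AE x in lebesgue_on \<Omega>. c0 x \<ge> 0"
    and sym: "\<And>i j. AE x in lebesgue_on \<Omega>. a i j x = a j i x"
    and theta: "\<theta> > 0"
    and ellip: "AE x in lebesgue_on \<Omega>. \<forall>\<xi>::real^'n.
                  (\<Sum>i\<in>UNIV. \<Sum>j\<in>UNIV. a i j x * (\<xi> $ i) * (\<xi> $ j)) \<ge> \<theta> * (norm \<xi>)^2"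
begin

text \<open>Chosen so that the form of the operator becomes the mean square inner product of
  \<open>flux U\<close> with another jet. Limits and almost everywhere equalities can then be
  treated with the tools for \<open>L2inner\<close>.\<close>

definition flux :: "(real^'n \<Rightarrow> real \<times> (real^'n)) \<Rightarrow> real^'n \<Rightarrow> real \<times> (real^'n)" where
  "flux U x = (c0 x * fst (U x), \<Sum>i\<in>UNIV. \<Sum>j\<in>UNIV. (a i j x * snd (U x) $ i) *\<^sub>R axis j 1)"

lemma dom_lmeasurable: "\<Omega> \<in> lmeasurable"
  using dom by (simp add: lmeasurable_open)

lemma dom_measurable: "\<Omega> \<in> sets lebesgue"
  by (rule fmeasurableD[OF dom_lmeasurable])

lemma L2_flux:
  assumes "L2 \<Omega> U"
  shows "L2 \<Omega> (flux U)"
proof -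
  have "L2 \<Omega> (\<lambda>x. (a i j x * snd (U x) $ i) *\<^sub>R (axis j 1 :: real^'n))" for i j
  proof -
    have "L2 \<Omega> (\<lambda>x. a i j x * snd (U x) $ i)"
      by (intro Linf_mult_L2 coef L2_component L2_snd assms)
    then show ?thesis
      by (rule L2_dominated[of _ _ _ 1]) (use L2_measurable[OF \<open>L2 \<Omega> (\<lambda>x. a i j x * snd (U x) $ i)\<close>] in auto)
  qed
  then show ?thesis unfolding flux_def[abs_def]
    by (intro L2_Pair L2_sum Linf_mult_L2 coef L2_fst assms)
qed

lemma flux_inner:
  "flux U x \<bullet> V x = (\<Sum>i\<in>UNIV. \<Sum>j\<in>UNIV. a i j x * (snd (U x) $ i) * (snd (V x) $ j)) + c0 x * fst (U x) * fst (V x)"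
  by (simp add: flux_def inner_prod_def inner_sum_left inner_axis')

lemma flux_add_scaleR: "flux (\<lambda>x. U x + c *\<^sub>R V x) x = flux U x + c *\<^sub>R flux V x"
  by (simp add: flux_def scaleR_sum_right sum.distrib[symmetric] algebra_simps)

lemma flux_symmetric:
  assumes "L2 \<Omega> U" "L2 \<Omega> V"
  shows "L2inner \<Omega> (flux U) V = L2inner \<Omega> (flux V) U"
  unfolding L2inner_def
proof (rule integral_cong_AE)
  have "AE x in lebesgue_on \<Omega>. \<forall>i j. a i j x = a j i x"
    using sym by (simp add: AE_all_countable)
  then show "AE x in lebesgue_on \<Omega>. flux U x \<bullet> V x = flux V x \<bullet> U x"
  proof eventually_elim
    case (elim x)
    have "(\<Sum>i\<in>UNIV. \<Sum>j\<in>UNIV. a i j x * (snd (U x) $ i) * (snd (V x) $ j))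
        = (\<Sum>j\<in>UNIV. \<Sum>i\<in>UNIV. a i j x * (snd (U x) $ i) * (snd (V x) $ j))"
      by (rule sum.swap)
    also have "\<dots> = (\<Sum>i\<in>UNIV. \<Sum>j\<in>UNIV. a i j x * (snd (V x) $ i) * (snd (U x) $ j))"
      by (intro sum.cong refl) (metis (no_types, lifting) elim mult.commute mult.left_commute)
    finally show ?case by (simp add: flux_inner)
  qed
qed (use L2_inner_integrable[OF L2_flux] assms in \<open>auto intro!: borel_measurable_integrable\<close>)

text \<open>Ellipticity bounds the gradient part and \<open>c0\<close> contributes a nonnegative
  term. Only the gradient is controlled; the function itself is recovered from the Poincare
  inequality.\<close>

lemma flux_coercive:
  assumes "L2 \<Omega> U"
  shows "\<theta> * (L2norm \<Omega> (\<lambda>x. snd (U x)))\<^sup>2 \<le> L2inner \<Omega> (flux U) U"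
proof -
  have "\<theta> * (L2norm \<Omega> (\<lambda>x. snd (U x)))\<^sup>2 = integral\<^sup>L (lebesgue_on \<Omega>) (\<lambda>x. \<theta> * (norm (snd (U x)))\<^sup>2)"
    by (simp add: L2norm_def)
  also have "\<dots> \<le> L2inner \<Omega> (flux U) U"
    unfolding L2inner_def
  proof (rule integral_mono_AE)
    show "AE x in lebesgue_on \<Omega>. \<theta> * (norm (snd (U x)))\<^sup>2 \<le> flux U x \<bullet> U x"
      using ellip c0_nonneg
    proof eventually_elim
      case (elim x)
      have "0 \<le> c0 x * fst (U x) * fst (U x)" using elim(2) by (simp add: mult.assoc)
      then show ?case using elim(1)[rule_format, of "snd (U x)"] by (simp add: flux_inner)
    qed
  qed (use L2_norm_square_integrable[OF L2_snd[OF assms]] L2_inner_integrable[OF L2_flux assms] assms in auto)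
  finally show ?thesis .
qed

lemma Apair_eq: "Apair \<Omega> a c0 y z = L2inner \<Omega> (flux (jet \<Omega> y)) (jet \<Omega> z)"
  unfolding Apair_def L2inner_def flux_inner by (simp add: jet_def)

lemma test_jet_coercive:
  obtains C where "C > 0" "\<And>\<phi>. test_fun \<Omega> \<phi> \<Longrightarrow>
    (L2norm \<Omega> (test_jet \<phi>))\<^sup>2 \<le> C * L2inner \<Omega> (flux (test_jet \<phi>)) (test_jet \<phi>)"
proof -
  obtain R where R: "\<And>x. x \<in> \<Omega> \<Longrightarrow> norm x \<le> R" using dom(2) by (auto simp: bounded_iff)
  show ?thesis
  \<comment> \<open>The summand \<open>(2 * R)\<^sup>2\<close> is the squared Poincare constant, the
    \<open>1\<close> accounts for the gradient itself, and \<open>\<theta>\<close> is the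
    ellipticity constant.\<close>
  proof (rule that[of "((2 * R)\<^sup>2 + 1) / \<theta>"])
    show "((2 * R)\<^sup>2 + 1) / \<theta> > 0" using theta by (simp add: add_nonneg_pos)
    fix \<phi> assume \<phi>: "test_fun \<Omega> \<phi>"
    have "(L2norm \<Omega> (test_jet \<phi>))\<^sup>2 = (L2norm \<Omega> \<phi>)\<^sup>2 + (L2norm \<Omega> (grad \<phi>))\<^sup>2"
      unfolding test_jet_def[abs_def] using L2_test_fun[OF dom_measurable \<phi>] by (rule L2norm_Pair)
    also have "(L2norm \<Omega> \<phi>)\<^sup>2 \<le> (2 * R * L2norm \<Omega> (grad \<phi>))\<^sup>2"
      by (intro power_mono Poincare_test_fun dom_measurable R \<phi>) auto
    finally have "(L2norm \<Omega> (test_jet \<phi>))\<^sup>2 \<le> ((2 * R)\<^sup>2 + 1) * (L2norm \<Omega> (grad \<phi>))\<^sup>2"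
      by (simp add: power_mult_distrib algebra_simps)
    also have "\<dots> = ((2 * R)\<^sup>2 + 1) / \<theta> * (\<theta> * (L2norm \<Omega> (grad \<phi>))\<^sup>2)" using theta by simp
    also have "\<dots> \<le> ((2 * R)\<^sup>2 + 1) / \<theta> * L2inner \<Omega> (flux (test_jet \<phi>)) (test_jet \<phi>)"
      using flux_coercive[OF L2_test_jet[OF dom_measurable \<phi>]] theta
      by (intro mult_left_mono) (auto simp: test_jet_def)
    finally show "(L2norm \<Omega> (test_jet \<phi>))\<^sup>2
        \<le> ((2 * R)\<^sup>2 + 1) / \<theta> * L2inner \<Omega> (flux (test_jet \<phi>)) (test_jet \<phi>)" .
  qed
qed

theorem weak_solution_exists:
  assumes F: "L2 \<Omega> F"
  obtains p where "H01 \<Omega> p" "\<And>z. H01 \<Omega> z \<Longrightarrow> Apair \<Omega> a c0 p z = L2inner \<Omega> F (jet \<Omega> z)"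
proof -
  let ?V = "{\<phi>. test_fun \<Omega> \<phi>}"
  let ?B = "\<lambda>\<phi> \<psi>. L2inner \<Omega> (flux (test_jet \<phi>)) (test_jet \<psi>)"
  let ?L = "\<lambda>\<phi>. L2inner \<Omega> F (test_jet \<phi>)"
  note tL2 = L2_test_jet[OF dom_measurable]
  obtain C where C: "C > 0" "\<And>\<phi>. test_fun \<Omega> \<phi> \<Longrightarrow> (L2norm \<Omega> (test_jet \<phi>))\<^sup>2 \<le> C * ?B \<phi> \<phi>"
    by (rule test_jet_coercive) (rule that)
  have lin: "test_jet (\<lambda>x. u x + c * v x) = (\<lambda>x. test_jet u x + c *\<^sub>R test_jet v x)"
    if "test_fun \<Omega> u" "test_fun \<Omega> v" for u v c
    using test_jet_add_mult[OF that] by (rule ext)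
  obtain \<phi> where \<phi>: "\<And>k. \<phi> k \<in> ?V"
    and C\<phi>: "\<And>k l. ?B (\<lambda>x. \<phi> k x - \<phi> l x) (\<lambda>x. \<phi> k x - \<phi> l x) \<le> 2 / real (Suc k) + 2 / real (Suc l)"
    and lim: "\<And>v. v \<in> ?V \<Longrightarrow> (\<lambda>k. ?B (\<phi> k) v) \<longlonglongrightarrow> ?L v"
  \<comment> \<open>The constant bounding the functional combines Cauchy-Schwarz with
    coercivity.\<close>
  proof (rule riesz_minimizing_sequence[of ?V ?B ?L "(L2norm \<Omega> F)\<^sup>2 * C"])
    fix u assume "u \<in> ?V"
    then have u: "test_fun \<Omega> u" by simp
    have "\<bar>?L u\<bar>\<^sup>2 \<le> (L2norm \<Omega> F * L2norm \<Omega> (test_jet u))\<^sup>2"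
      using L2_Cauchy_Schwarz[OF F tL2[OF u]] by (intro power_mono) auto
    also have "\<dots> \<le> (L2norm \<Omega> F)\<^sup>2 * (C * ?B u u)"
      unfolding power_mult_distrib by (intro mult_left_mono C u) auto
    finally show "(?L u)\<^sup>2 \<le> (L2norm \<Omega> F)\<^sup>2 * C * ?B u u" by simp
    show "0 \<le> ?B u u"
      using flux_coercive[OF tL2[OF u]] theta by (meson less_imp_le mult_nonneg_nonneg order_trans zero_le_power2)
  next
    fix u v w c assume "u \<in> ?V" "v \<in> ?V" "w \<in> ?V"
    then have uvw: "test_fun \<Omega> u" "test_fun \<Omega> v" "test_fun \<Omega> w" by auto
    have "flux (\<lambda>x. test_jet u x + c *\<^sub>R test_jet v x) = (\<lambda>x. flux (test_jet u) x + c *\<^sub>R flux (test_jet v) x)"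
      by (rule ext) (rule flux_add_scaleR)
    then show "?B (\<lambda>x. u x + c * v x) w = ?B u w + c * ?B v w"
      using uvw by (simp add: lin L2inner_add_left L2inner_scaleR_left L2_scaleR L2_flux tL2)
  next
    fix u v c assume "u \<in> ?V" "v \<in> ?V"
    then have uv: "test_fun \<Omega> u" "test_fun \<Omega> v" by auto
    show "(\<lambda>x. u x + c * v x) \<in> ?V" using test_fun_add_mult[OF uv] by simp
    show "?B u v = ?B v u" by (intro flux_symmetric tL2 uv)
    show "?L (\<lambda>x. u x + c * v x) = ?L u + c * ?L v"
      using uv F by (simp add: lin L2inner_add_right L2inner_scaleR_right L2_scaleR tL2)
  next
    show "(\<lambda>x. 0) \<in> ?V" using test_fun_zero by simp
    show "0 \<le> (L2norm \<Omega> F)\<^sup>2 * C" using C(1) by simp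
  qed (rule that)
  have \<phi>t: "test_fun \<Omega> (\<phi> k)" for k using \<phi> by simp
  have Cauchy: "\<exists>N. \<forall>m\<ge>N. \<forall>n\<ge>N. L2norm \<Omega> (\<lambda>x. test_jet (\<phi> m) x - test_jet (\<phi> n) x) < e" if e: "e > 0" for e
  proof -
    \<comment> \<open>Past \<open>N\<close> the squared distance is at most \<open>C\<close> times
      two summands \<open>2 / (N + 1)\<close>, which is below the square of
      \<open>e\<close>.\<close>
    obtain N where N: "inverse (real (Suc N)) < e\<^sup>2 / (4 * C)"
      using reals_Archimedean[of "e\<^sup>2 / (4 * C)"] e C(1) by auto
    show ?thesis
    proof (intro exI[of _ N] allI impI)
      fix m n assume mn: "m \<ge> N" "n \<ge> N"
      have d: "test_fun \<Omega> (\<lambda>x. \<phi> m x - \<phi> n x)"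
        using test_fun_add_mult[OF \<phi>t \<phi>t, of m "-1" n] by simp
      have "test_jet (\<lambda>x. \<phi> m x - \<phi> n x) = (\<lambda>x. test_jet (\<phi> m) x - test_jet (\<phi> n) x)"
        using lin[OF \<phi>t \<phi>t, of m "-1" n] by simp
      then have "(L2norm \<Omega> (\<lambda>x. test_jet (\<phi> m) x - test_jet (\<phi> n) x))\<^sup>2
          \<le> C * ?B (\<lambda>x. \<phi> m x - \<phi> n x) (\<lambda>x. \<phi> m x - \<phi> n x)"
        using C(2)[OF d] by simp
      also have "\<dots> \<le> C * (2 / real (Suc m) + 2 / real (Suc n))"
        using C\<phi> C(1) by (intro mult_left_mono) auto
      also have "\<dots> \<le> C * (2 / real (Suc N) + 2 / real (Suc N))"
        using C(1) mn by (intro mult_left_mono add_mono divide_left_mono) auto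
      also have "\<dots> = C * (4 * inverse (real (Suc N)))" by (simp add: inverse_eq_divide)
      also have "\<dots> < C * (4 * (e\<^sup>2 / (4 * C)))"
        using C(1) N by (intro mult_strict_left_mono) auto
      also have "\<dots> = e\<^sup>2" using C(1) by simp
      finally show "L2norm \<Omega> (\<lambda>x. test_jet (\<phi> m) x - test_jet (\<phi> n) x) < e"
        by (rule power2_less_imp_less) (use e in simp)
    qed
  qed
  obtain U where U: "L2 \<Omega> U" "(\<lambda>k. L2norm \<Omega> (\<lambda>x. test_jet (\<phi> k) x - U x)) \<longlonglongrightarrow> 0"
    using Riesz_Fischer[OF dom_lmeasurable tL2[OF \<phi>t] Cauchy] .
  have HU: "is_H01_jet \<Omega> U" unfolding is_H01_jet_def by (intro conjI exI[of _ \<phi>] allI U \<phi>t)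
  have test: "L2inner \<Omega> (flux U) (test_jet v) = L2inner \<Omega> F (test_jet v)" if v: "test_fun \<Omega> v" for v
  proof (rule LIMSEQ_unique)
    show "(\<lambda>k. ?B (\<phi> k) v) \<longlonglongrightarrow> L2inner \<Omega> F (test_jet v)" using lim v by simp
    \<comment> \<open>Symmetry moves the flux to the fixed function \<open>v\<close>, so that the
      limit is taken against a fixed field.\<close>
    have "(\<lambda>k. L2inner \<Omega> (flux (test_jet v)) (test_jet (\<phi> k))) \<longlonglongrightarrow> L2inner \<Omega> (flux (test_jet v)) U"
      by (intro L2inner_tendsto U tL2 \<phi>t L2_flux v)
    then show "(\<lambda>k. ?B (\<phi> k) v) \<longlonglongrightarrow> L2inner \<Omega> (flux U) (test_jet v)"
      unfolding flux_symmetric[OF tL2[OF v] U(1)] flux_symmetric[OF tL2[OF v] tL2[OF \<phi>t]] .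
  qed
  let ?p = "\<lambda>x. fst (U x)"
  note p = is_H01_jet_imp_H01[OF dom HU]
  note pL2 = H01_imp_L2_jet[OF p(2)]
  show ?thesis
  proof (rule that[OF p(2)])
    fix z assume "H01 \<Omega> z"
    then have z: "is_H01_jet \<Omega> (jet \<Omega> z)" by (rule H01_imp_is_H01_jet[OF dom])
    note zL2 = is_H01_jet_L2[OF z]
    have "L2inner \<Omega> (\<lambda>x. flux U x - F x) (jet \<Omega> z) = 0"
      by (rule L2inner_zero_on_H01_jets[OF dom_measurable L2_diff[OF L2_flux[OF U(1)] F] _ z])
        (simp add: L2inner_diff_left L2_flux U F tL2 test)
    then have "L2inner \<Omega> (flux U) (jet \<Omega> z) = L2inner \<Omega> F (jet \<Omega> z)"
      by (simp add: L2inner_diff_left L2_flux U F zL2)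
    moreover have "L2inner \<Omega> (flux (jet \<Omega> ?p)) (jet \<Omega> z) = L2inner \<Omega> (flux U) (jet \<Omega> z)"
    proof (rule L2inner_cong_AE)
      show "AE x in lebesgue_on \<Omega>. flux (jet \<Omega> ?p) x = flux U x"
        using p(1) by eventually_elim (simp add: flux_def)
    qed (intro L2_flux pL2 U zL2 AE_I2 refl)+
    ultimately show "Apair \<Omega> a c0 ?p z = L2inner \<Omega> F (jet \<Omega> z)" by (simp add: Apair_eq)
  qed
qed

end

subsection \<open>Linearity of the state equation\<close>

text \<open>A linear combination of jets is again a limit of test jets, so it belongs to its first
  component. This yields membership and the almost everywhere linearity of the chosen gradients
  together.\<close>

lemma H01_add_mult:
  assumes "open \<Omega>" "bounded \<Omega>" "H01 \<Omega> y" "H01 \<Omega> z"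
  shows "H01 \<Omega> (\<lambda>x. y x + c * z x)"
    and "AE x in lebesgue_on \<Omega>. jet \<Omega> (\<lambda>x. y x + c * z x) x = jet \<Omega> y x + c *\<^sub>R jet \<Omega> z x"
proof -
  have "is_H01_jet \<Omega> (\<lambda>x. jet \<Omega> y x + c *\<^sub>R jet \<Omega> z x)"
    using assms by (intro is_H01_jet_add_scaleR H01_imp_is_H01_jet) (auto simp: borel_open)
  from is_H01_jet_imp_H01[OF assms(1,2) this]
  show "H01 \<Omega> (\<lambda>x. y x + c * z x)"
    and "AE x in lebesgue_on \<Omega>. jet \<Omega> (\<lambda>x. y x + c * z x) x = jet \<Omega> y x + c *\<^sub>R jet \<Omega> z x"
    by (simp_all add: jet_def)
qed

lemma H01_imp_L2:
  assumes "H01 \<Omega> y"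
  shows "L2 \<Omega> y" "L2 \<Omega> (weak_grad \<Omega> y)"
  using assms by (auto simp: H01_def H1_def)

lemma weak_grad_add_mult_AE:
  assumes "open \<Omega>" "bounded \<Omega>" "H01 \<Omega> y" "H01 \<Omega> z"
  shows "AE x in lebesgue_on \<Omega>. weak_grad \<Omega> (\<lambda>x. y x + c * z x) x = weak_grad \<Omega> y x + c *\<^sub>R weak_grad \<Omega> z x"
  using H01_add_mult(2)[OF assms] by eventually_elim (simp add: jet_def)

section \<open>The admissible sets and separation in the plane\<close>

lemma Wset_L2:
  assumes "\<Omega> \<in> lmeasurable" "u \<in> Wset \<Omega> ua ub"
  shows "L2 \<Omega> u"
proof -
  interpret finite_measure "lebesgue_on \<Omega>"
    using assms(1) by (rule finite_measure_lebesgue_on)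
  have "Linf \<Omega> u" using assms(2) by (simp add: Wset_def)
  moreover have "L2 \<Omega> (\<lambda>x. 1 :: real)" by (simp add: L2_def)
  ultimately show ?thesis using Linf_mult_L2 by fastforce
qed

lemma Wset_convex:
  assumes u: "u \<in> Wset \<Omega> ua ub" and v: "v \<in> Wset \<Omega> ua ub" and t: "0 \<le> t" "t \<le> 1"
  shows "(\<lambda>x. u x + t * (v x - u x)) \<in> Wset \<Omega> ua ub"
proof -
  have AE: "AE x in lebesgue_on \<Omega>. ua \<le> u x + t * (v x - u x) \<and> u x + t * (v x - u x) \<le> ub"
  proof -
    have "AE x in lebesgue_on \<Omega>. ua \<le> u x \<and> u x \<le> ub" "AE x in lebesgue_on \<Omega>. ua \<le> v x \<and> v x \<le> ub"
      using u v by (auto simp: Wset_def)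
    then show ?thesis
    proof eventually_elim
      case (elim x)
      have eq: "u x + t * (v x - u x) = (1 - t) * u x + t * v x" by (simp add: algebra_simps)
      have "(1 - t) * ua + t * ua \<le> (1 - t) * u x + t * v x" "(1 - t) * u x + t * v x \<le> (1 - t) * ub + t * ub"
        using elim t by (auto intro!: add_mono mult_left_mono)
      then show ?case unfolding eq by (simp add: algebra_simps)
    qed
  qed
  have "AE x in lebesgue_on \<Omega>. \<bar>u x + t * (v x - u x)\<bar> \<le> max \<bar>ua\<bar> \<bar>ub\<bar>"
    using AE by eventually_elim auto
  moreover have "(\<lambda>x. u x + t * (v x - u x)) \<in> borel_measurable (lebesgue_on \<Omega>)"
    using u v by (auto simp: Wset_def Linf_def)
  ultimately show ?thesis using AE by (auto simp: Wset_def Linf_def)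
qed

lemma Kset_iff: "z \<in> Kset \<Omega> \<delta> \<longleftrightarrow> L2 \<Omega> z \<and> (L2norm \<Omega> z)\<^sup>2 \<le> \<delta>"
  by (auto simp: Kset_def L2norm_def)

text \<open>A point of the sphere is not interior: it is nonzero as \<open>\<delta> > 0\<close>, and
  a slight dilation leaves the ball.\<close>

lemma L2_interior_Kset:
  assumes v: "v \<in> L2_interior \<Omega> (Kset \<Omega> \<delta>)" and \<delta>: "\<delta> > 0"
  shows "(L2norm \<Omega> v)\<^sup>2 < \<delta>"
proof (rule ccontr)
  obtain e where vK: "v \<in> Kset \<Omega> \<delta>" and e: "e > 0"
    "\<And>w. L2 \<Omega> w \<Longrightarrow> L2norm \<Omega> (\<lambda>x. w x - v x) < e \<Longrightarrow> w \<in> Kset \<Omega> \<delta>"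
    using v by (auto simp: L2_interior_def)
  assume "\<not> (L2norm \<Omega> v)\<^sup>2 < \<delta>"
  then have eq: "(L2norm \<Omega> v)\<^sup>2 = \<delta>" using vK by (simp add: Kset_iff)
  have n: "L2norm \<Omega> v > 0"
    using eq \<delta> L2norm_nonneg[of \<Omega> v] by (metis less_eq_real_def less_irrefl power_zero_numeral)
  \<comment> \<open>Dilation by \<open>1 + s\<close> moves \<open>v\<close> by exactly
    \<open>e / 2\<close>.\<close>
  define s where "s = e / (2 * L2norm \<Omega> v)"
  have s: "s > 0" using e n by (simp add: s_def)
  have vL2: "L2 \<Omega> v" using vK by (simp add: Kset_iff)
  have "(\<lambda>x. (1 + s) *\<^sub>R v x) \<in> Kset \<Omega> \<delta>"
  proof (rule e(2))
    have "(\<lambda>x. (1 + s) *\<^sub>R v x - v x) = (\<lambda>x. s *\<^sub>R v x)" by (simp add: scaleR_left_distrib)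
    then show "L2norm \<Omega> (\<lambda>x. (1 + s) *\<^sub>R v x - v x) < e"
      using e n s by (simp add: L2norm_scaleR) (simp add: s_def)
  qed (intro L2_scaleR vL2)
  then have "(1 + s)\<^sup>2 * \<delta> \<le> \<delta>" by (simp add: Kset_iff L2norm_scaleR power_mult_distrib eq)
  moreover have "(1 + s)\<^sup>2 > 1" using s by (simp add: power2_eq_square algebra_simps add_pos_pos)
  ultimately show False using \<delta> by simp
qed

lemma planar_multipliers:
  fixes P :: "(real \<times> real) set"
  assumes "convex P" "P \<noteq> {}" and neg: "\<And>p. p \<in> P \<Longrightarrow> \<not> (fst p < 0 \<and> snd p < 0)"
  obtains l \<nu> where "0 \<le> l" "0 \<le> \<nu>" "0 < l + \<nu>" "\<And>p. p \<in> P \<Longrightarrow> 0 \<le> l * fst p + \<nu> * snd p"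
proof -
  let ?Q = "{..<0::real} \<times> {..<0::real}"
  have "convex ?Q" by (intro convex_Times convex_real_interval)
  moreover have "?Q \<noteq> {}" by (auto intro: exI[of _ "-1"])
  moreover have "?Q \<inter> P = {}" using neg by fastforce
  ultimately obtain c b where c: "c \<noteq> 0" and Q: "\<And>x. x \<in> ?Q \<Longrightarrow> c \<bullet> x \<le> b" and P: "\<And>x. x \<in> P \<Longrightarrow> b \<le> c \<bullet> x"
    using separating_hyperplane_sets[of ?Q P] assms(1,2) by metis
  define l \<nu> where "l = fst c" and "\<nu> = snd c"
  have Q': "l * s + \<nu> * t \<le> b" if "s < 0" "t < 0" for s t
    using Q[of "(s, t)"] that by (simp add: l_def \<nu>_def inner_prod_def)
  \<comment> \<open>The origin is a boundary point of the quadrant, approached along the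
    diagonal.\<close>
  have b: "0 \<le> b"
  proof -
    have "((\<lambda>t. l * t + \<nu> * t) \<longlongrightarrow> l * 0 + \<nu> * 0) (at_left 0)" by (intro tendsto_intros)
    moreover have "\<forall>\<^sub>F t in at_left 0. l * t + \<nu> * t \<le> b"
      using Q' by (auto simp: eventually_at_filter)
    ultimately have "l * 0 + \<nu> * 0 \<le> b" by (rule tendsto_upperbound) simp
    then show ?thesis by simp
  qed
  have l: "0 \<le> l"
  proof (rule ccontr)
    assume "\<not> 0 \<le> l"
    \<comment> \<open>The quadrant is unbounded: with this first coordinate and second coordinate
      \<open>-1\<close>, the functional is at least \<open>b + 1\<close>, contradicting the
      separation.\<close>
    then have "(b + \<bar>\<nu>\<bar> + 1) / l < 0" and "l * ((b + \<bar>\<nu>\<bar> + 1) / l) = b + \<bar>\<nu>\<bar> + 1"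
      using b by (auto simp: divide_less_0_iff)
    then show False using Q'[of "(b + \<bar>\<nu>\<bar> + 1) / l" "-1"] by simp
  qed
  have \<nu>: "0 \<le> \<nu>"
  proof (rule ccontr)
    assume "\<not> 0 \<le> \<nu>"
    then have "(b + \<bar>l\<bar> + 1) / \<nu> < 0" and "\<nu> * ((b + \<bar>l\<bar> + 1) / \<nu>) = b + \<bar>l\<bar> + 1"
      using b by (auto simp: divide_less_0_iff)
    then show False using Q'[of "-1" "(b + \<bar>l\<bar> + 1) / \<nu>"] by simp
  qed
  have "0 < l + \<nu>"
    using c l \<nu> by (auto simp: l_def \<nu>_def prod_eq_iff)
  moreover have "0 \<le> l * fst p + \<nu> * snd p" if "p \<in> P" for p
    using P[OF that] b by (simp add: l_def \<nu>_def inner_prod_def)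
  ultimately show ?thesis using that l \<nu> by blast
qed

context elliptic
begin

lemma Apair_add_mult:
  assumes "H01 \<Omega> y" "H01 \<Omega> z" "H01 \<Omega> w"
  shows "Apair \<Omega> a c0 (\<lambda>x. y x + c * z x) w = Apair \<Omega> a c0 y w + c * Apair \<Omega> a c0 z w"
proof -
  note L = H01_imp_L2_jet[OF assms(1)] H01_imp_L2_jet[OF assms(2)] H01_imp_L2_jet[OF assms(3)]
  have "Apair \<Omega> a c0 (\<lambda>x. y x + c * z x) w
      = L2inner \<Omega> (\<lambda>x. flux (jet \<Omega> y) x + c *\<^sub>R flux (jet \<Omega> z) x) (jet \<Omega> w)"
    unfolding Apair_eq
  proof (rule L2inner_cong_AE)
    show "AE x in lebesgue_on \<Omega>. flux (jet \<Omega> (\<lambda>x. y x + c * z x)) x = flux (jet \<Omega> y) x + c *\<^sub>R flux (jet \<Omega> z) x"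
      using H01_add_mult(2)[OF dom assms(1,2), of c]
    proof eventually_elim
      case (elim x)
      then have "flux (jet \<Omega> (\<lambda>x. y x + c * z x)) x = flux (\<lambda>x. jet \<Omega> y x + c *\<^sub>R jet \<Omega> z x) x"
        by (simp add: flux_def)
      then show ?case by (simp add: flux_add_scaleR)
    qed
  qed (intro L2_flux L2_add L2_scaleR L H01_imp_L2_jet H01_add_mult dom assms AE_I2 refl)+
  also have "\<dots> = Apair \<Omega> a c0 y w + c * Apair \<Omega> a c0 z w"
    by (simp add: Apair_eq L2inner_add_left L2inner_scaleR_left L2_scaleR L2_flux L)
  finally show ?thesis .
qed

text \<open>In the adjoint equation the unknown stands in the second argument, whereas
  \<open>weak_solution_exists\<close> provides it in the first.\<close>

lemma Apair_symmetric:
  assumes "H01 \<Omega> y" "H01 \<Omega> z"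
  shows "Apair \<Omega> a c0 y z = Apair \<Omega> a c0 z y"
  unfolding Apair_eq by (intro flux_symmetric H01_imp_L2_jet assms)

lemma weak_sol_add_mult:
  assumes "weak_sol \<Omega> a c0 g y" "weak_sol \<Omega> a c0 h z" "L2 \<Omega> g" "L2 \<Omega> h"
  shows "weak_sol \<Omega> a c0 (\<lambda>x. g x + c * h x) (\<lambda>x. y x + c * z x)"
  using assms unfolding weak_sol_def
  by (auto simp: Apair_add_mult H01_imp_L2 L2inner_add_left L2inner_mult_left L2_mult intro: H01_add_mult dom)

lemma weak_sol_exists:
  assumes "L2 \<Omega> g"
  obtains z where "weak_sol \<Omega> a c0 g z"
proof -
  have F: "L2 \<Omega> (\<lambda>x. (g x, 0 :: real^'n))" by (intro L2_Pair assms L2_zero)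
  obtain p where p: "H01 \<Omega> p" "\<And>z. H01 \<Omega> z \<Longrightarrow> Apair \<Omega> a c0 p z = L2inner \<Omega> (\<lambda>x. (g x, 0)) (jet \<Omega> z)"
    by (rule weak_solution_exists[OF F]) (rule that)
  have "L2inner \<Omega> (\<lambda>x. (g x, 0 :: real^'n)) (jet \<Omega> z) = L2inner \<Omega> g z" for z
    by (simp add: L2inner_def jet_def)
  with p show ?thesis by (intro that[of p]) (simp add: weak_sol_def)
qed

end

subsection \<open>The optimality system\<close>

locale control = elliptic \<Omega> a c0 \<theta>
  for \<Omega> :: "(real^'n::finite) set" and a c0 \<theta> +
  fixes yd f :: "real^'n \<Rightarrow> real" and ua ub \<alpha> \<delta> :: real and ybar ubar :: "real^'n \<Rightarrow> real"
  assumes data: "L2 \<Omega> yd" "L2 \<Omega> f"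
    and delta: "\<delta> > 0"
    and opt_feas: "weak_sol \<Omega> a c0 (\<lambda>x. ubar x + f x) ybar"
                  "weak_grad \<Omega> ybar \<in> Kset \<Omega> \<delta>" "ubar \<in> Wset \<Omega> ua ub"
    and opt_min: "\<And>y u. weak_sol \<Omega> a c0 (\<lambda>x. u x + f x) y \<Longrightarrow>
                  weak_grad \<Omega> y \<in> Kset \<Omega> \<delta> \<Longrightarrow> u \<in> Wset \<Omega> ua ub \<Longrightarrow>
                  Jcost \<Omega> yd \<alpha> ybar ubar \<le> Jcost \<Omega> yd \<alpha> y u"
begin

text \<open>A relation rather than a map: as total functions, weak solutions are not unique, so the
  state increment \<open>z\<close> is carried along with the control.\<close>

definition directions :: "((real^'n \<Rightarrow> real) \<times> (real^'n \<Rightarrow> real)) set" where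
  "directions = {(u, z). u \<in> Wset \<Omega> ua ub \<and> weak_sol \<Omega> a c0 (\<lambda>x. u x - ubar x) z}"

text \<open>The coefficient of \<open>t\<close> when the cost is expanded along the segment from the
  optimal pair.\<close>

definition cost_slope :: "(real^'n \<Rightarrow> real) \<Rightarrow> (real^'n \<Rightarrow> real) \<Rightarrow> real" where
  "cost_slope u z = L2inner \<Omega> (\<lambda>x. ybar x - yd x) z + \<alpha> * L2inner \<Omega> ubar (\<lambda>x. u x - ubar x)"

definition constraint_slope :: "(real^'n \<Rightarrow> real) \<Rightarrow> real" where
  "constraint_slope z = L2inner \<Omega> (weak_grad \<Omega> ybar) (weak_grad \<Omega> z)"

text \<open>The quantified \<open>ybar\<close> shadows the optimal state fixed by the locale, which
  later is its witness. Keeping \<open>lam\<close> as a parameter lets one predicate express the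
  general and the normalised system.\<close>

definition optimality_system :: "real \<Rightarrow> bool" where
  "optimality_system lam \<longleftrightarrow> (\<exists>ybar pbar. \<exists>\<mu>::real^'n \<Rightarrow> real^'n.
            H01 \<Omega> ybar \<and> H01 \<Omega> pbar \<and> L2 \<Omega> \<mu> \<and>
            lam + L2norm \<Omega> \<mu> > 0 \<and>
            (\<forall>z. H01 \<Omega> z \<longrightarrow> Apair \<Omega> a c0 ybar z = L2inner \<Omega> ubar z + L2inner \<Omega> f z) \<and>
            (\<forall>z. H01 \<Omega> z \<longrightarrow> Apair \<Omega> a c0 z pbar =
                 lam * L2inner \<Omega> (\<lambda>x. ybar x - yd x) z + L2inner \<Omega> \<mu> (weak_grad \<Omega> z)) \<and>
            (\<forall>z\<in>Kset \<Omega> \<delta>. L2inner \<Omega> \<mu> (\<lambda>x. z x - weak_grad \<Omega> ybar x) \<le> 0) \<and>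
            (\<forall>u\<in>Wset \<Omega> ua ub.
               integral\<^sup>L (lebesgue_on \<Omega>) (\<lambda>x. (pbar x + lam * \<alpha> * ubar x) * (u x - ubar x)) \<ge> 0))"

lemma ybar_H01: "H01 \<Omega> ybar"
  using opt_feas(1) by (simp add: weak_sol_def)

lemma W_L2: "u \<in> Wset \<Omega> ua ub \<Longrightarrow> L2 \<Omega> u"
  by (rule Wset_L2[OF dom_lmeasurable])

lemma ubar_L2: "L2 \<Omega> ubar"
  by (rule W_L2[OF opt_feas(3)])

lemma directions_H01: "(u, z) \<in> directions \<Longrightarrow> H01 \<Omega> z"
  by (simp add: directions_def weak_sol_def)

lemma direction_exists:
  assumes "u \<in> Wset \<Omega> ua ub"
  obtains z where "(u, z) \<in> directions"
proof -
  obtain z where "weak_sol \<Omega> a c0 (\<lambda>x. u x - ubar x) z"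
    by (rule weak_sol_exists[OF L2_diff[OF W_L2[OF assms] ubar_L2]]) (rule that)
  with assms show ?thesis by (intro that) (simp add: directions_def)
qed

lemma constraint_slope_add_mult:
  assumes "H01 \<Omega> z" "H01 \<Omega> w"
  shows "constraint_slope (\<lambda>x. z x + c * w x) = constraint_slope z + c * constraint_slope w"
proof -
  note L = H01_imp_L2(2)[OF assms(1)] H01_imp_L2(2)[OF assms(2)] H01_imp_L2(2)[OF ybar_H01]
  have "constraint_slope (\<lambda>x. z x + c * w x) = L2inner \<Omega> (weak_grad \<Omega> ybar) (\<lambda>x. weak_grad \<Omega> z x + c *\<^sub>R weak_grad \<Omega> w x)"
    unfolding constraint_slope_def
    by (intro L2inner_cong_AE L weak_grad_add_mult_AE dom assms L2_add L2_scaleR H01_imp_L2 H01_add_mult AE_I2 refl)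
  then show ?thesis
    by (simp add: constraint_slope_def L2inner_add_right L2inner_scaleR_right L L2_scaleR)
qed

text \<open>The convex combination of increments is written with \<open>w x + (-1) * z x\<close>
  because the linearity lemmas for \<open>H01\<close> and \<open>weak_sol\<close> have the form
  \<open>y x + c * z x\<close>, applied twice here.\<close>

lemma cost_slope_add_mult:
  assumes "L2 \<Omega> z" "L2 \<Omega> w" "L2 \<Omega> u" "L2 \<Omega> v"
  shows "cost_slope (\<lambda>x. u x + c * (v x - u x)) (\<lambda>x. z x + c * (w x + (-1) * z x))
     = (1 - c) * cost_slope u z + c * cost_slope v w"
proof -
  have comb: "L2inner \<Omega> h (\<lambda>x. p x + c * (q x + (-1) * p x)) = (1 - c) * L2inner \<Omega> h p + c * L2inner \<Omega> h q"
    if "L2 \<Omega> h" "L2 \<Omega> p" "L2 \<Omega> q" for h p q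
    unfolding L2inner_add_right[OF that(2) L2_mult[OF L2_add[OF that(3) L2_mult[OF that(2)]]] that(1)]
      L2inner_mult_right L2inner_add_right[OF that(3) L2_mult[OF that(2)] that(1)]
    by (simp add: algebra_simps)
  have eq: "(\<lambda>x. u x + c * (v x - u x) - ubar x) = (\<lambda>x. (u x - ubar x) + c * ((v x - ubar x) + (-1) * (u x - ubar x)))"
    by (simp add: algebra_simps)
  have L: "L2 \<Omega> (\<lambda>x. u x - ubar x)" "L2 \<Omega> (\<lambda>x. v x - ubar x)" "L2 \<Omega> (\<lambda>x. ybar x - yd x)"
    by (intro L2_diff assms ubar_L2 data H01_imp_L2 ybar_H01)+
  show ?thesis
    unfolding cost_slope_def eq comb[OF ubar_L2 L(1,2)] comb[OF L(3) assms(1,2)]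
    by (simp add: algebra_simps)
qed

lemma directions_convex:
  assumes "(u, z) \<in> directions" "(v, w) \<in> directions" "0 \<le> t" "t \<le> 1"
  shows "(\<lambda>x. u x + t * (v x - u x), \<lambda>x. z x + t * (w x + (-1) * z x)) \<in> directions"
proof -
  have uv: "u \<in> Wset \<Omega> ua ub" "v \<in> Wset \<Omega> ua ub"
    and sol: "weak_sol \<Omega> a c0 (\<lambda>x. u x - ubar x) z" "weak_sol \<Omega> a c0 (\<lambda>x. v x - ubar x) w"
    using assms by (auto simp: directions_def)
  have L: "L2 \<Omega> (\<lambda>x. u x - ubar x)" "L2 \<Omega> (\<lambda>x. v x - ubar x)"
    by (intro L2_diff W_L2 uv ubar_L2)+
  have "weak_sol \<Omega> a c0 (\<lambda>x. (u x - ubar x) + t * ((v x - ubar x) + (-1) * (u x - ubar x)))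
      (\<lambda>x. z x + t * (w x + (-1) * z x))"
    by (intro weak_sol_add_mult sol L L2_add L2_mult)
  moreover have "(\<lambda>x. (u x - ubar x) + t * ((v x - ubar x) + (-1) * (u x - ubar x)))
      = (\<lambda>x. u x + t * (v x - u x) - ubar x)" by (simp add: algebra_simps)
  ultimately show ?thesis using Wset_convex[OF uv assms(3,4)] by (simp add: directions_def)
qed

section \<open>Exact expansions along a direction and absence of feasible descent\<close>

lemma Jcost_expansion:
  assumes "H01 \<Omega> z" "L2 \<Omega> u"
  shows "Jcost \<Omega> yd \<alpha> (\<lambda>x. ybar x + t * z x) (\<lambda>x. ubar x + t * (u x - ubar x))
     = Jcost \<Omega> yd \<alpha> ybar ubar + t * cost_slope u z
       + t\<^sup>2 * ((L2norm \<Omega> z)\<^sup>2 + \<alpha> * (L2norm \<Omega> (\<lambda>x. u x - ubar x))\<^sup>2) / 2"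
proof -
  have L: "L2 \<Omega> (\<lambda>x. ybar x - yd x)" "L2 \<Omega> z" "L2 \<Omega> (\<lambda>x. u x - ubar x)"
    by (intro L2_diff assms ubar_L2 data H01_imp_L2 ybar_H01)+
  have "(\<lambda>x. ybar x + t * z x - yd x) = (\<lambda>x. (ybar x - yd x) + t *\<^sub>R z x)" by auto
  then have "(L2norm \<Omega> (\<lambda>x. ybar x + t * z x - yd x))\<^sup>2 = (L2norm \<Omega> (\<lambda>x. ybar x - yd x))\<^sup>2
      + 2 * t * L2inner \<Omega> (\<lambda>x. ybar x - yd x) z + t\<^sup>2 * (L2norm \<Omega> z)\<^sup>2"
    using L2inner_square_add[OF L(1,2), of t] by (simp add: L2norm_square)
  moreover have "(L2norm \<Omega> (\<lambda>x. ubar x + t * (u x - ubar x)))\<^sup>2 = (L2norm \<Omega> ubar)\<^sup>2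
      + 2 * t * L2inner \<Omega> ubar (\<lambda>x. u x - ubar x) + t\<^sup>2 * (L2norm \<Omega> (\<lambda>x. u x - ubar x))\<^sup>2"
    using L2inner_square_add[OF ubar_L2 L(3), of t] by (simp add: L2norm_square)
  ultimately show ?thesis by (simp add: Jcost_def cost_slope_def field_simps)
qed

lemma gradient_expansion:
  assumes "H01 \<Omega> z"
  shows "(L2norm \<Omega> (weak_grad \<Omega> (\<lambda>x. ybar x + t * z x)))\<^sup>2
    = (L2norm \<Omega> (weak_grad \<Omega> ybar))\<^sup>2 + 2 * t * constraint_slope z + t\<^sup>2 * (L2norm \<Omega> (weak_grad \<Omega> z))\<^sup>2"
proof -
  note L = H01_imp_L2(2)[OF ybar_H01] H01_imp_L2(2)[OF assms]
  have "L2norm \<Omega> (weak_grad \<Omega> (\<lambda>x. ybar x + t * z x)) = L2norm \<Omega> (\<lambda>x. weak_grad \<Omega> ybar x + t *\<^sub>R weak_grad \<Omega> z x)"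
    by (intro L2norm_cong_AE weak_grad_add_mult_AE dom ybar_H01 assms L2_add L2_scaleR L H01_imp_L2(2) H01_add_mult)
  then show ?thesis
    using L2inner_square_add[OF L, of t] by (simp add: L2norm_square constraint_slope_def)
qed

text \<open>A small step along the direction would stay feasible and lower the cost. The squared
  gradient norm stays below \<open>\<delta>\<close> either by slack and continuity, or because its
  slope is negative; convexity keeps the control admissible.\<close>

lemma no_feasible_descent:
  assumes d: "(u, z) \<in> directions" and j: "cost_slope u z < 0"
    and g: "constraint_slope z < 0 \<or> (L2norm \<Omega> (weak_grad \<Omega> ybar))\<^sup>2 < \<delta>"
  shows False
proof -
  define q where "q = ((L2norm \<Omega> z)\<^sup>2 + \<alpha> * (L2norm \<Omega> (\<lambda>x. u x - ubar x))\<^sup>2) / 2"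
  define r where "r = (L2norm \<Omega> (weak_grad \<Omega> z))\<^sup>2"
  define G where "G = (L2norm \<Omega> (weak_grad \<Omega> ybar))\<^sup>2"
  have G: "G \<le> \<delta>" using opt_feas(2) by (simp add: Kset_iff G_def)
  have u: "u \<in> Wset \<Omega> ua ub" and sol: "weak_sol \<Omega> a c0 (\<lambda>x. u x - ubar x) z"
    using d by (auto simp: directions_def)
  have z: "H01 \<Omega> z" using directions_H01[OF d] .
  have "((\<lambda>t. cost_slope u z + t * q) \<longlongrightarrow> cost_slope u z + 0 * q) (at_right 0)"
    by (intro tendsto_intros)
  then have ev1: "\<forall>\<^sub>F t in at_right 0. cost_slope u z + t * q < 0"
    using j by (intro order_tendstoD(2)) auto
  have ev2: "\<forall>\<^sub>F t in at_right 0. G + 2 * t * constraint_slope z + t\<^sup>2 * r \<le> \<delta>"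
  proof (cases "G < \<delta>")
    case True
    have "((\<lambda>t. G + 2 * t * constraint_slope z + t\<^sup>2 * r) \<longlongrightarrow> G + 2 * 0 * constraint_slope z + 0\<^sup>2 * r) (at_right 0)"
      by (intro tendsto_intros)
    then have "\<forall>\<^sub>F t in at_right 0. G + 2 * t * constraint_slope z + t\<^sup>2 * r < \<delta>"
      using True by (intro order_tendstoD(2)) auto
    then show ?thesis by eventually_elim simp
  next
    case False
    then have g': "constraint_slope z < 0" using g by (simp add: G_def)
    \<comment> \<open>The increment of the squared gradient norm is \<open>t\<close> times this
      expression, so without slack its sign for small \<open>t\<close> is decided by the
      slope.\<close>
    have "((\<lambda>t. 2 * constraint_slope z + t * r) \<longlongrightarrow> 2 * constraint_slope z + 0 * r) (at_right 0)"
      by (intro tendsto_intros)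
    then have "\<forall>\<^sub>F t in at_right 0. 2 * constraint_slope z + t * r < 0"
      by (rule order_tendstoD(2)) (use g' in simp)
    then show ?thesis
      using eventually_at_right_less[of 0]
    proof eventually_elim
      case (elim t)
      then have "t * (2 * constraint_slope z + t * r) \<le> 0" by (intro mult_nonneg_nonpos) auto
      then show ?case using G by (simp add: power2_eq_square algebra_simps)
    qed
  qed
  have ev3: "\<forall>\<^sub>F t in at_right 0. t < (1::real)"
    by (rule eventually_at_right_real[of 0 1, THEN eventually_mono]) auto
  obtain t where t: "0 < t" "t < 1" "cost_slope u z + t * q < 0"
    "G + 2 * t * constraint_slope z + t\<^sup>2 * r \<le> \<delta>"
    using eventually_happens[OF eventually_conj[OF eventually_at_right_less[of 0]
          eventually_conj[OF ev3 eventually_conj[OF ev1 ev2]]]] by auto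
  let ?y = "\<lambda>x. ybar x + t * z x" and ?u = "\<lambda>x. ubar x + t * (u x - ubar x)"
  have "weak_sol \<Omega> a c0 (\<lambda>x. (ubar x + f x) + t * (u x - ubar x)) ?y"
    by (intro weak_sol_add_mult opt_feas(1) sol L2_add L2_diff W_L2 u ubar_L2 data)
  moreover have "(\<lambda>x. (ubar x + f x) + t * (u x - ubar x)) = (\<lambda>x. ?u x + f x)" by auto
  ultimately have "weak_sol \<Omega> a c0 (\<lambda>x. ?u x + f x) ?y" by simp
  moreover have "weak_grad \<Omega> ?y \<in> Kset \<Omega> \<delta>"
    using t(4) gradient_expansion[OF z, of t] H01_imp_L2(2)[OF H01_add_mult(1)[OF dom ybar_H01 z]]
    by (simp add: Kset_iff G_def r_def)
  moreover have "?u \<in> Wset \<Omega> ua ub"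
    using t by (intro Wset_convex opt_feas u) auto
  ultimately have "Jcost \<Omega> yd \<alpha> ybar ubar \<le> Jcost \<Omega> yd \<alpha> ?y ?u" by (rule opt_min)
  also have "\<dots> = Jcost \<Omega> yd \<alpha> ybar ubar + t * (cost_slope u z + t * q)"
    unfolding Jcost_expansion[OF z W_L2[OF u]] by (simp add: q_def power2_eq_square algebra_simps)
  also have "\<dots> < Jcost \<Omega> yd \<alpha> ybar ubar" using t by (simp add: mult_pos_neg)
  finally show False by simp
qed

text \<open>Turns scalar multipliers into the full system with
  \<open>\<mu> = \<nu> \<nabla>ybar\<close>. The condition \<open>compl\<close> is complementary
  slackness: it puts the gradient on the sphere whenever \<open>\<nu>\<close> is nonzero.\<close>

lemma optimality_systemI:
  assumes l: "0 \<le> l" "0 \<le> \<nu>" "0 < l + \<nu>"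
    and compl: "\<nu> = 0 \<or> (L2norm \<Omega> (weak_grad \<Omega> ybar))\<^sup>2 = \<delta>"
    and nonneg: "\<And>u z. (u, z) \<in> directions \<Longrightarrow> 0 \<le> l * cost_slope u z + \<nu> * constraint_slope z"
  shows "optimality_system l"
proof -
  let ?g = "weak_grad \<Omega> ybar"
  define \<mu> where "\<mu> x = \<nu> *\<^sub>R ?g x" for x
  have g: "L2 \<Omega> ?g" by (rule H01_imp_L2(2)[OF ybar_H01])
  have e: "L2 \<Omega> (\<lambda>x. ybar x - yd x)" by (intro L2_diff data H01_imp_L2 ybar_H01)
  have \<mu>: "L2 \<Omega> \<mu>" unfolding \<mu>_def by (intro L2_scaleR g)
  have F: "L2 \<Omega> (\<lambda>x. (l * (ybar x - yd x), \<mu> x))" by (intro L2_Pair L2_mult e \<mu>)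
  obtain p where p: "H01 \<Omega> p"
    "\<And>z. H01 \<Omega> z \<Longrightarrow> Apair \<Omega> a c0 p z = L2inner \<Omega> (\<lambda>x. (l * (ybar x - yd x), \<mu> x)) (jet \<Omega> z)"
    by (rule weak_solution_exists[OF F]) (rule that)
  have adjoint: "Apair \<Omega> a c0 z p = l * L2inner \<Omega> (\<lambda>x. ybar x - yd x) z + L2inner \<Omega> \<mu> (weak_grad \<Omega> z)"
    if z: "H01 \<Omega> z" for z
  proof -
    have "Apair \<Omega> a c0 z p = L2inner \<Omega> (\<lambda>x. (l * (ybar x - yd x), \<mu> x)) (\<lambda>x. (z x, weak_grad \<Omega> z x))"
      using p(2)[OF z] Apair_symmetric[OF z p(1)] by (simp add: jet_def[abs_def])
    also have "\<dots> = L2inner \<Omega> (\<lambda>x. l * (ybar x - yd x)) z + L2inner \<Omega> \<mu> (weak_grad \<Omega> z)"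
      by (intro L2inner_Pair L2_mult e \<mu> H01_imp_L2 z)
    finally show ?thesis by (simp add: L2inner_mult_left)
  qed
  have state: "Apair \<Omega> a c0 ybar z = L2inner \<Omega> ubar z + L2inner \<Omega> f z" if "H01 \<Omega> z" for z
    using opt_feas(1) that by (simp add: weak_sol_def L2inner_add_left ubar_L2 data H01_imp_L2)
  \<comment> \<open>On the sphere no element of the ball has a larger inner product with the
    gradient than the gradient itself, by Cauchy-Schwarz.\<close>
  have normal: "L2inner \<Omega> \<mu> (\<lambda>x. z x - ?g x) \<le> 0" if "z \<in> Kset \<Omega> \<delta>" for z
  proof (cases "\<nu> = 0")
    case True
    then show ?thesis by (simp add: \<mu>_def[abs_def] L2inner_def)
  next
    case False
    then have \<delta>: "(L2norm \<Omega> ?g)\<^sup>2 = \<delta>" using compl by simp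
    have z: "L2 \<Omega> z" "(L2norm \<Omega> z)\<^sup>2 \<le> (L2norm \<Omega> ?g)\<^sup>2" using that by (auto simp: Kset_iff \<delta>)
    then have "L2norm \<Omega> z \<le> L2norm \<Omega> ?g" using power2_le_imp_le L2norm_nonneg by blast
    then have "L2inner \<Omega> ?g z \<le> L2norm \<Omega> ?g * L2norm \<Omega> ?g"
      using L2_Cauchy_Schwarz[OF g z(1)] mult_left_mono[of "L2norm \<Omega> z" "L2norm \<Omega> ?g" "L2norm \<Omega> ?g"] by simp
    then have "L2inner \<Omega> ?g (\<lambda>x. z x - ?g x) \<le> 0"
      by (simp add: L2inner_diff_right z g L2norm_square[symmetric] power2_eq_square)
    then show ?thesis using l by (simp add: \<mu>_def[abs_def] L2inner_scaleR_left mult_nonneg_nonpos)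
  qed
  have nontrivial: "0 < l + L2norm \<Omega> \<mu>"
  proof (cases "l = 0")
    case True
    then have "\<nu> > 0" using l by simp
    moreover from this have "L2norm \<Omega> ?g > 0"
      using compl delta L2norm_nonneg[of \<Omega> ?g] by (metis less_eq_real_def less_irrefl power_zero_numeral)
    ultimately show ?thesis using True by (simp add: \<mu>_def[abs_def] L2norm_scaleR)
  next
    case False
    then show ?thesis using l L2norm_nonneg[of \<Omega> \<mu>] by linarith
  qed
  \<comment> \<open>Testing the adjoint equation with \<open>z\<close> and the equation for
    \<open>z\<close> with \<open>p\<close> gives the same number, which trades the slopes for a
    pairing of \<open>p\<close> with the control increment.\<close>
  have variational: "0 \<le> integral\<^sup>L (lebesgue_on \<Omega>) (\<lambda>x. (p x + l * \<alpha> * ubar x) * (u x - ubar x))"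
    if u: "u \<in> Wset \<Omega> ua ub" for u
  proof -
    obtain z where d: "(u, z) \<in> directions" by (rule direction_exists[OF u]) (rule that)
    have z: "H01 \<Omega> z" using directions_H01[OF d] .
    have w: "L2 \<Omega> (\<lambda>x. u x - ubar x)" by (intro L2_diff W_L2 u ubar_L2)
    have "0 \<le> l * cost_slope u z + \<nu> * constraint_slope z" by (rule nonneg[OF d])
    also have "\<dots> = Apair \<Omega> a c0 z p + l * \<alpha> * L2inner \<Omega> ubar (\<lambda>x. u x - ubar x)"
      by (simp add: adjoint[OF z] cost_slope_def constraint_slope_def \<mu>_def[abs_def] L2inner_scaleR_left algebra_simps)
    also have "Apair \<Omega> a c0 z p = L2inner \<Omega> p (\<lambda>x. u x - ubar x)"
      using d p(1) by (simp add: directions_def weak_sol_def L2inner_commute)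
    also have "L2inner \<Omega> p (\<lambda>x. u x - ubar x) + l * \<alpha> * L2inner \<Omega> ubar (\<lambda>x. u x - ubar x)
        = L2inner \<Omega> (\<lambda>x. p x + (l * \<alpha>) * ubar x) (\<lambda>x. u x - ubar x)"
      by (subst L2inner_add_left) (auto intro: H01_imp_L2 p w L2_mult ubar_L2 simp: L2inner_mult_left)
    finally show ?thesis by (simp add: L2inner_def)
  qed
  show ?thesis
    unfolding optimality_system_def
    by (intro exI[of _ ybar] exI[of _ p] exI[of _ \<mu>] conjI allI impI ballI
        ybar_H01 p(1) \<mu> nontrivial state adjoint normal variational)
qed

text \<open>With slack every direction of negative cost slope would be feasible for small steps, so
  the multipliers \<open>1\<close> and \<open>0\<close> work.\<close>

lemma inactive_optimality_system:
  assumes "(L2norm \<Omega> (weak_grad \<Omega> ybar))\<^sup>2 < \<delta>"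
  shows "optimality_system 1"
proof (rule optimality_systemI[of 1 0])
  fix u z assume "(u, z) \<in> directions"
  then have "\<not> cost_slope u z < 0" using no_feasible_descent assms by blast
  then show "0 \<le> 1 * cost_slope u z + 0 * constraint_slope z" by simp
qed auto

text \<open>Both slopes are affine in the direction and the directions are convex, so the attained
  pairs of slopes form a convex set that avoids the open negative quadrant.\<close>

lemma active_multipliers:
  assumes active: "(L2norm \<Omega> (weak_grad \<Omega> ybar))\<^sup>2 = \<delta>"
  obtains l \<nu> where "0 \<le> l" "0 \<le> \<nu>" "0 < l + \<nu>"
    "\<And>u z. (u, z) \<in> directions \<Longrightarrow> 0 \<le> l * cost_slope u z + \<nu> * constraint_slope z"
proof -
  define P where "P = (\<lambda>(u, z). (cost_slope u z, constraint_slope z)) ` directions"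
  have "convex P"
    unfolding convex_alt
  proof (intro ballI allI impI)
    fix x y and t :: real assume "x \<in> P" "y \<in> P" and t: "0 \<le> t \<and> t \<le> 1"
    then obtain u z v w where d: "(u, z) \<in> directions" "(v, w) \<in> directions"
      and xy: "x = (cost_slope u z, constraint_slope z)" "y = (cost_slope v w, constraint_slope w)"
      by (auto simp: P_def)
    note H = directions_H01[OF d(1)] directions_H01[OF d(2)]
    have L: "L2 \<Omega> u" "L2 \<Omega> v" using d by (auto simp: directions_def W_L2)
    let ?u = "\<lambda>x. u x + t * (v x - u x)" and ?z = "\<lambda>x. z x + t * (w x + (-1) * z x)"
    have "constraint_slope ?z = (1 - t) * constraint_slope z + t * constraint_slope w"
      unfolding constraint_slope_add_mult[OF H(1) H01_add_mult(1)[OF dom H(2,1)]]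
        constraint_slope_add_mult[OF H(2,1)] by (simp add: algebra_simps)
    then have "(1 - t) *\<^sub>R x + t *\<^sub>R y = (cost_slope ?u ?z, constraint_slope ?z)"
      unfolding cost_slope_add_mult[OF H01_imp_L2(1)[OF H(1)] H01_imp_L2(1)[OF H(2)] L]
      by (simp add: xy)
    moreover have "(?u, ?z) \<in> directions" using t by (intro directions_convex d) auto
    ultimately show "(1 - t) *\<^sub>R x + t *\<^sub>R y \<in> P" unfolding P_def by force
  qed
  \<comment> \<open>The optimal control itself gives a direction, with right-hand side zero.\<close>
  moreover obtain z0 where "(ubar, z0) \<in> directions" by (rule direction_exists[OF opt_feas(3)]) (rule that)
  then have "P \<noteq> {}" by (auto simp: P_def)
  moreover have "\<not> (fst p < 0 \<and> snd p < 0)" if "p \<in> P" for p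
    using that unfolding P_def by (auto dest: no_feasible_descent)
  ultimately obtain l \<nu> where l: "0 \<le> l" "0 \<le> \<nu>" "0 < l + \<nu>"
    "\<And>p. p \<in> P \<Longrightarrow> 0 \<le> l * fst p + \<nu> * snd p"
    by (rule planar_multipliers) (assumption, rule that)
  show ?thesis
  proof (rule that[OF l(1-3)])
    fix u z assume "(u, z) \<in> directions"
    then have "(cost_slope u z, constraint_slope z) \<in> P" by (force simp: P_def)
    from l(4)[OF this] show "0 \<le> l * cost_slope u z + \<nu> * constraint_slope z" by simp
  qed
qed

lemma Fritz_John_system: "\<exists>l\<ge>0. optimality_system l"
proof (cases "(L2norm \<Omega> (weak_grad \<Omega> ybar))\<^sup>2 < \<delta>")
  case True
  then show ?thesis using inactive_optimality_system zero_le_one by blast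
next
  case False
  then have active: "(L2norm \<Omega> (weak_grad \<Omega> ybar))\<^sup>2 = \<delta>" using opt_feas(2) by (simp add: Kset_iff)
  from active_multipliers[OF this] obtain l \<nu> where l: "0 \<le> l" "0 \<le> \<nu>" "0 < l + \<nu>"
    "\<And>u z. (u, z) \<in> directions \<Longrightarrow> 0 \<le> l * cost_slope u z + \<nu> * constraint_slope z" by blast
  from optimality_systemI[OF l(1-3) disjI2[OF active] l(4)] l(1) show ?thesis by blast
qed

text \<open>The Slater gradient lies strictly inside the ball on whose sphere the active gradient
  lies, so its inner product with the latter is less than \<open>\<delta>\<close> and the constraint
  slope is negative. With \<open>l = 0\<close> the multiplier inequality would fail for this
  direction.\<close>

lemma Slater_system:
  assumes u0: "u0 \<in> Wset \<Omega> ua ub" and z0: "weak_sol \<Omega> a c0 (\<lambda>x. u0 x - ubar x) z0"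
    and slater: "(\<lambda>x. weak_grad \<Omega> ybar x + weak_grad \<Omega> z0 x) \<in> L2_interior \<Omega> (Kset \<Omega> \<delta>)"
  shows "optimality_system 1"
proof (cases "(L2norm \<Omega> (weak_grad \<Omega> ybar))\<^sup>2 < \<delta>")
  case True
  then show ?thesis by (rule inactive_optimality_system)
next
  case False
  let ?g = "weak_grad \<Omega> ybar" and ?v = "\<lambda>x. weak_grad \<Omega> ybar x + weak_grad \<Omega> z0 x"
  have active: "(L2norm \<Omega> ?g)\<^sup>2 = \<delta>" using False opt_feas(2) by (simp add: Kset_iff)
  from active_multipliers[OF this] obtain l \<nu> where l: "0 \<le> l" "0 \<le> \<nu>" "0 < l + \<nu>"
    "\<And>u z. (u, z) \<in> directions \<Longrightarrow> 0 \<le> l * cost_slope u z + \<nu> * constraint_slope z" by blast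
  have d: "(u0, z0) \<in> directions" using u0 z0 by (simp add: directions_def)
  have L: "L2 \<Omega> ?g" "L2 \<Omega> (weak_grad \<Omega> z0)"
    by (intro H01_imp_L2 ybar_H01 directions_H01[OF d])+
  have "(L2norm \<Omega> ?v)\<^sup>2 < (L2norm \<Omega> ?g)\<^sup>2" using L2_interior_Kset[OF slater delta] active by simp
  then have lt: "L2norm \<Omega> ?v < L2norm \<Omega> ?g" by (rule power2_less_imp_less) simp
  have pos: "0 < L2norm \<Omega> ?g" using le_less_trans[OF L2norm_nonneg lt] .
  have "L2inner \<Omega> ?g ?v \<le> L2norm \<Omega> ?g * L2norm \<Omega> ?v"
    using L2_Cauchy_Schwarz[OF L(1) L2_add[OF L]] by simp
  also have "\<dots> < L2norm \<Omega> ?g * L2norm \<Omega> ?g" using lt pos by (rule mult_strict_left_mono)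
  finally have "constraint_slope z0 < 0"
    by (simp add: constraint_slope_def L2inner_add_right L L2norm_square[symmetric] power2_eq_square)
  then have "l \<noteq> 0" using l(3) l(4)[OF d] mult_pos_neg[of \<nu> "constraint_slope z0"] by auto
  then have lpos: "l > 0" using l(1) by simp
  show ?thesis
  \<comment> \<open>The multiplier inequality is homogeneous, so both multipliers may be divided by
    \<open>l\<close>.\<close>
  proof (rule optimality_systemI[of 1 "\<nu> / l"])
    fix u z assume "(u, z) \<in> directions"
    then have "0 \<le> (l * cost_slope u z + \<nu> * constraint_slope z) / l" using l lpos by simp
    then show "0 \<le> 1 * cost_slope u z + \<nu> / l * constraint_slope z" using lpos by (simp add: add_divide_distrib)
  qed (use l lpos active in \<open>auto simp: add_pos_nonneg\<close>)
qed

end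

theorem theorem5:
  fixes \<Omega> :: "(real^'n) set"
    and a :: "'n \<Rightarrow> 'n \<Rightarrow> real^'n \<Rightarrow> real" and c0 :: "real^'n \<Rightarrow> real"
    and yd f :: "real^'n \<Rightarrow> real"
    and ua ub \<alpha> \<delta> \<theta> :: real
    and ybar0 ubar :: "real^'n \<Rightarrow> real"
  assumes dim: "CARD('n) = 2 \<or> CARD('n) = 3"
    and dom: "convex \<Omega>" "open \<Omega>" "bounded \<Omega>"
    and bdry: "C11_boundary \<Omega> \<or> polygonal_boundary \<Omega>"
    and data: "L2 \<Omega> yd" "L2 \<Omega> f"
    and alpha: "\<alpha> > 0"
    and delta: "\<delta> > 0"
    and Wne: "ua \<le> ub"
    and coef: "\<And>i j. Linf \<Omega> (a i j)" "Linf \<Omega> c0"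
    and c0_nonneg: "AE x in lebesgue_on \<Omega>. c0 x \<ge> 0"
    and sym: "\<And>i j. AE x in lebesgue_on \<Omega>. a i j x = a j i x"
    and theta: "\<theta> > 0"
    and ellip: "AE x in lebesgue_on \<Omega>. \<forall>\<xi>::real^'n.
                  (\<Sum>i\<in>UNIV. \<Sum>j\<in>UNIV. a i j x * (\<xi> $ i) * (\<xi> $ j)) \<ge> \<theta> * (norm \<xi>)^2"
    and opt_feas: "weak_sol \<Omega> a c0 (\<lambda>x. ubar x + f x) ybar0"
                  "weak_grad \<Omega> ybar0 \<in> Kset \<Omega> \<delta>" "ubar \<in> Wset \<Omega> ua ub"
    and opt_min: "\<And>y u. weak_sol \<Omega> a c0 (\<lambda>x. u x + f x) y \<Longrightarrow>
                  weak_grad \<Omega> y \<in> Kset \<Omega> \<delta> \<Longrightarrow> u \<in> Wset \<Omega> ua ub \<Longrightarrow>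
                  Jcost \<Omega> yd \<alpha> ybar0 ubar \<le> Jcost \<Omega> yd \<alpha> y u"
  shows "(\<exists>lam::real. \<exists>ybar pbar. \<exists>\<mu>::real^'n \<Rightarrow> real^'n.
            lam \<ge> 0 \<and> H01 \<Omega> ybar \<and> H01 \<Omega> pbar \<and> L2 \<Omega> \<mu> \<and>
            lam + L2norm \<Omega> \<mu> > 0 \<and>
            (\<forall>z. H01 \<Omega> z \<longrightarrow> Apair \<Omega> a c0 ybar z = L2inner \<Omega> ubar z + L2inner \<Omega> f z) \<and>
            (\<forall>z. H01 \<Omega> z \<longrightarrow> Apair \<Omega> a c0 z pbar =
                 lam * L2inner \<Omega> (\<lambda>x. ybar x - yd x) z + L2inner \<Omega> \<mu> (weak_grad \<Omega> z)) \<and>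
            (\<forall>z\<in>Kset \<Omega> \<delta>. L2inner \<Omega> \<mu> (\<lambda>x. z x - weak_grad \<Omega> ybar x) \<le> 0) \<and>
            (\<forall>u\<in>Wset \<Omega> ua ub.
               integral\<^sup>L (lebesgue_on \<Omega>) (\<lambda>x. (pbar x + lam * \<alpha> * ubar x) * (u x - ubar x)) \<ge> 0))
       \<and> ((\<exists>u0\<in>Wset \<Omega> ua ub. \<exists>z0. weak_sol \<Omega> a c0 (\<lambda>x. u0 x - ubar x) z0 \<and>
              (\<lambda>x. weak_grad \<Omega> ybar0 x + weak_grad \<Omega> z0 x) \<in> L2_interior \<Omega> (Kset \<Omega> \<delta>))
          \<longrightarrow> (\<exists>ybar pbar. \<exists>\<mu>::real^'n \<Rightarrow> real^'n.
            H01 \<Omega> ybar \<and> H01 \<Omega> pbar \<and> L2 \<Omega> \<mu> \<and>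
            1 + L2norm \<Omega> \<mu> > 0 \<and>
            (\<forall>z. H01 \<Omega> z \<longrightarrow> Apair \<Omega> a c0 ybar z = L2inner \<Omega> ubar z + L2inner \<Omega> f z) \<and>
            (\<forall>z. H01 \<Omega> z \<longrightarrow> Apair \<Omega> a c0 z pbar =
                 1 * L2inner \<Omega> (\<lambda>x. ybar x - yd x) z + L2inner \<Omega> \<mu> (weak_grad \<Omega> z)) \<and>
            (\<forall>z\<in>Kset \<Omega> \<delta>. L2inner \<Omega> \<mu> (\<lambda>x. z x - weak_grad \<Omega> ybar x) \<le> 0) \<and>
            (\<forall>u\<in>Wset \<Omega> ua ub.
               integral\<^sup>L (lebesgue_on \<Omega>) (\<lambda>x. (pbar x + 1 * \<alpha> * ubar x) * (u x - ubar x)) \<ge> 0)))"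
proof -
  interpret control \<Omega> a c0 \<theta> yd f ua ub \<alpha> \<delta> ybar0 ubar
    by unfold_locales
      (use dom data coef c0_nonneg sym theta ellip delta opt_feas opt_min in auto)
  obtain l where "l \<ge> 0" "optimality_system l" using Fritz_John_system by blast
  then show ?thesis
    using Slater_system unfolding optimality_system_def by blast
qed

end
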